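(* Let $X$ be a Čech-complete space, let $(M,d)$ be a metric space, and let $G\subseteq C(X,M)$ be such that $\overline{G}^{M^X}$ is compact. Then the following conditions are equivalent: (a) $G$ is hereditarily almost equicontinuous. (b) $L$ is hereditarily almost equicontinuous on $F$, for all $L\in[G]^{\leq\omega}$ and every separable and compact subset $F$ of $X$. (c) $(\overline{L}^{M^X})|_F$ is metrizable, for all $L\in[G]^{\leq\omega}$ and every separable and compact subset $F$ of $X$. (d) $(F,t_p(\overline{L}^{M^X}))$ is Lindel\"of, for all $L\in[G]^{\leq\omega}$ and every separable and compact subset $F$ of $X$.
   Context: $C(X,M)$ is the set of continuous functions from $X$ to $M$. A Čech-complete space is a completely regular Hausdorff space that is a $G_\delta$-subset of its Stone-Čech compactification. $[G]^{\leq\omega}$ is the set of all countable subsets of $G$. For $S\subseteq M^X$, $\overline{S}^{M^X}$ is the closure of $S$ in the Tychonoff product $M^X$ (topology of pointwise convergence on $X$). For a set $H$ of functions from $X$ to $M$ and $F\subseteq X$, $H|_F=\{h|_F:h\in H\}\subseteq M^F$, with the topology $t_p(F)$ of pointwise convergence on $F$. $(F,t_p(H))$ is the set $F$ with the weak (initial) topology generated by the functions in $H|_F$. A point $x\in X$ is an equicontinuity point of $G\subseteq C(X,M)$ if for every $\epsilon>0$ there is a neighborhood $U$ of $x$ such that $\mathrm{diam}(g(U))<\epsilon$ for all $g\in G$. $G$ is almost equicontinuous if its set of equicontinuity points is dense in $X$, and hereditarily almost equicontinuous if $G|_A$ is almost equicontinuous (as a subset of $C(A,M)$) for every nonempty closed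 subset $A$ of $X$. "$L$ is hereditarily almost equicontinuous on $F$" means that $L|_F\subseteq C(F,M)$ is hereditarily almost equicontinuous. *)

theory Defs
  imports "HOL-Analysis.Analysis"
begin

definition unit_maps :: "'a topology \<Rightarrow> ('a \<Rightarrow> real) set" where
  "unit_maps X = {f \<in> extensional (topspace X). continuous_map X (top_of_set {0..1}) f}"

definition unit_cube :: "'a topology \<Rightarrow> (('a \<Rightarrow> real) \<Rightarrow> real) topology" where
  "unit_cube X = product_topology (\<lambda>_. top_of_set {0..1}) (unit_maps X)"

definition Stone_Cech_map :: "'a topology \<Rightarrow> 'a \<Rightarrow> ('a \<Rightarrow> real) \<Rightarrow> real" where
  "Stone_Cech_map X x = (\<lambda>f\<in>unit_maps X. f x)"

text \<open>The closure of the canonical image of \<open>X\<close> in the cube indexed by all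
  continuous functions from \<open>X\<close> to the unit interval.  For completely regular Hausdorff \<open>X\<close>
  the map \<open>Stone_Cech_map X\<close> is a dense embedding, and every continuous function from \<open>X\<close>
  to the unit interval extends along it; see the lemmas below.\<close>

definition Stone_Cech :: "'a topology \<Rightarrow> (('a \<Rightarrow> real) \<Rightarrow> real) topology" where
  "Stone_Cech X =
     subtopology (unit_cube X) (unit_cube X closure_of (Stone_Cech_map X ` topspace X))"

definition Cech_complete_space :: "'a topology \<Rightarrow> bool" where
  "Cech_complete_space X \<longleftrightarrow>
     completely_regular_space X \<and> Hausdorff_space X \<and>
     gdelta_in (Stone_Cech X) (Stone_Cech_map X ` topspace X)"

lemma compact_Hausdorff_unit_cube: "compact_space (unit_cube X)" "Hausdorff_space (unit_cube X)"
  unfolding unit_cube_def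
  by (simp_all add: compact_space_product_topology Hausdorff_space_product_topology
      compact_space_subtopology compactin_euclidean_iff Hausdorff_space_subtopology)

lemma compact_space_Stone_Cech: "compact_space (Stone_Cech X)"
  unfolding Stone_Cech_def
  by (intro compact_space_subtopology closedin_compact_space compact_Hausdorff_unit_cube) simp

lemma Hausdorff_space_Stone_Cech: "Hausdorff_space (Stone_Cech X)"
  unfolding Stone_Cech_def
  by (intro Hausdorff_space_subtopology compact_Hausdorff_unit_cube)

lemma Stone_Cech_map_in: "Stone_Cech_map X ` topspace X \<subseteq> topspace (unit_cube X)"
proof
  fix p assume "p \<in> Stone_Cech_map X ` topspace X"
  then obtain x where x: "x \<in> topspace X" and p: "p = Stone_Cech_map X x"
    by blast
  have "f x \<in> {0..1}" if "f \<in> unit_maps X" for f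
    using that x by (force simp: unit_maps_def continuous_map_in_subtopology)
  then show "p \<in> topspace (unit_cube X)"
    unfolding p Stone_Cech_map_def unit_cube_def
    by (simp only: topspace_product_topology restrict_PiE_iff topspace_euclidean_subtopology) blast
qed

lemma topspace_Stone_Cech:
  "topspace (Stone_Cech X) = unit_cube X closure_of (Stone_Cech_map X ` topspace X)"
  unfolding Stone_Cech_def by (simp add: closure_of_subset_topspace inf.absorb2)

lemma Stone_Cech_map_dense:
  "Stone_Cech X closure_of (Stone_Cech_map X ` topspace X) = topspace (Stone_Cech X)"
proof -
  let ?S = "Stone_Cech_map X ` topspace X"
  have "?S \<subseteq> unit_cube X closure_of ?S"
    by (rule closure_of_subset[OF Stone_Cech_map_in])
  then have "(unit_cube X closure_of ?S) \<inter> ?S = ?S"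
    by (rule inf.absorb2)
  then show ?thesis
    unfolding topspace_Stone_Cech unfolding Stone_Cech_def closure_of_subtopology by (simp only: Int_absorb)
qed

lemma Stone_Cech_map_embedding:
  assumes "completely_regular_space X" "Hausdorff_space X"
  shows "embedding_map X (Stone_Cech X) (Stone_Cech_map X)"
proof -
  have eq: "mspace (submetric (cfunspace X euclidean_metric) {f. f \<in> topspace X \<rightarrow> {0..1}})
      = unit_maps X"
    by (auto simp: unit_maps_def continuous_map_in_subtopology image_subset_iff_funcset
        intro: bounded_subset[OF bounded_closed_interval])
  have "embedding_map X (unit_cube X) (Stone_Cech_map X)"
    using completely_regular_space_cube_embedding_explicit[OF assms]
    unfolding eq unit_cube_def Stone_Cech_map_def .
  then show ?thesis
    unfolding Stone_Cech_def embedding_map_in_subtopology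
    using closure_of_subset[OF Stone_Cech_map_in] by (intro conjI)
qed

lemma Stone_Cech_extension:
  assumes "continuous_map X (top_of_set {0..1::real}) f"
  shows "\<exists>g. continuous_map (Stone_Cech X) (top_of_set {0..1}) g \<and>
             (\<forall>x\<in>topspace X. g (Stone_Cech_map X x) = f x)"
proof (intro exI conjI ballI)
  let ?f = "restrict f (topspace X)"
  have f: "?f \<in> unit_maps X"
    using continuous_map_eq[OF assms, of ?f] by (simp add: unit_maps_def)
  show "continuous_map (Stone_Cech X) (top_of_set {0..1}) (\<lambda>p. p ?f)"
    unfolding Stone_Cech_def unit_cube_def
    by (intro continuous_map_from_subtopology continuous_map_product_projection f)
  show "Stone_Cech_map X x ?f = f x" if "x \<in> topspace X" for x
    using f that by (simp add: Stone_Cech_map_def)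
qed

definition pointwise_topology :: "'a set \<Rightarrow> 'b topology \<Rightarrow> ('a \<Rightarrow> 'b) topology" where
  "pointwise_topology S Y = product_topology (\<lambda>_. Y) S"

definition pointwise_closure :: "'a set \<Rightarrow> 'b topology \<Rightarrow> ('a \<Rightarrow> 'b) set \<Rightarrow> ('a \<Rightarrow> 'b) set" where
  "pointwise_closure S Y H = pointwise_topology S Y closure_of H"

definition continuous_functions :: "'a topology \<Rightarrow> 'b topology \<Rightarrow> ('a \<Rightarrow> 'b) set" where
  "continuous_functions X Y = {f \<in> extensional (topspace X). continuous_map X Y f}"

definition restrict_functions :: "('a \<Rightarrow> 'b) set \<Rightarrow> 'a set \<Rightarrow> ('a \<Rightarrow> 'b) set" where
  "restrict_functions H F = (\<lambda>h. restrict h F) ` H"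

text \<open>The initial topology on \<open>S\<close> for \<open>H\<close>.  The set \<open>S\<close> is included in the generating family
  so that the carrier is \<open>S\<close> also for empty \<open>H\<close> (when the topology is indiscrete).\<close>

definition weak_topology :: "'a set \<Rightarrow> 'b topology \<Rightarrow> ('a \<Rightarrow> 'b) set \<Rightarrow> 'a topology" where
  "weak_topology S Y H =
     topology_generated_by (insert S {h -` U \<inter> S | h U. h \<in> H \<and> openin Y U})"

text \<open>The diameter takes the value \<open>\<infinity>\<close> on unbounded sets; a real-valued supremum would be
  unspecified there.\<close>

definition mdiameter :: "'b metric \<Rightarrow> 'b set \<Rightarrow> ennreal" where
  "mdiameter m S = (SUP (y, z)\<in>S \<times> S. ennreal (mdist m y z))"

definition equicontinuity_point ::
    "'a topology \<Rightarrow> 'b metric \<Rightarrow> ('a \<Rightarrow> 'b) set \<Rightarrow> 'a \<Rightarrow> bool" where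
  "equicontinuity_point X m G x \<longleftrightarrow>
     x \<in> topspace X \<and>
     (\<forall>\<epsilon>>0. \<exists>U. openin X U \<and> x \<in> U \<and> (\<forall>g\<in>G. mdiameter m (g ` U) < ennreal \<epsilon>))"

definition almost_equicontinuous ::
    "'a topology \<Rightarrow> 'b metric \<Rightarrow> ('a \<Rightarrow> 'b) set \<Rightarrow> bool" where
  "almost_equicontinuous X m G \<longleftrightarrow>
     X closure_of {x. equicontinuity_point X m G x} = topspace X"

definition hereditarily_almost_equicontinuous ::
    "'a topology \<Rightarrow> 'b metric \<Rightarrow> ('a \<Rightarrow> 'b) set \<Rightarrow> bool" where
  "hereditarily_almost_equicontinuous X m G \<longleftrightarrow>
     (\<forall>A. closedin X A \<and> A \<noteq> {} \<longrightarrow>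
        almost_equicontinuous (subtopology X A) m (restrict_functions G A))"

end

theory Submission
  imports Defs "HOL-Probability.Infinite_Product_Measure"
begin

text \<open>
  All conditions are compared with the pseudometric \<open>\<rho>(x, y) = sup {d(l x, l y) | l \<in> L}\<close>:
  hereditary almost equicontinuity says that \<open>\<rho>\<close> fragments \<open>F\<close>, and (b), (c), (d) amount to
  \<open>\<rho>\<close>-separability of \<open>F\<close>, that is, to covers of \<open>F\<close> by countably many sets of small
  \<open>\<rho>\<close>-diameter.  The implications (a) to (b) to (c) to (d) go through this property.

  For (d) to (a), a failure of (a) together with Cech-completeness yields a Cantor scheme of open sets
  and functions \<open>g\<^sub>s \<in> G\<close>, indexed by finite binary words \<open>s\<close>, such that \<open>g\<^sub>s\<close> separates the two
  children of \<open>s\<close> by a fixed distance.  It lives on a separable compact set \<open>F\<close> and reduces everything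
  to the Cantor space with the fair coin measure.  If the \<open>g\<^sub>s\<close> are totally bounded in measure, then at
  every point all of whose weak neighbourhoods are non-null the evaluation is uniformly continuous for
  convergence in measure (Borel-Cantelli and cluster points), so there are only countably many such
  points, and the Lindelof property covers the space by sets of total measure less than 1.
  Otherwise a sequence that is separated in measure contains an independent subsequence, and the weak
  topology fails to be Lindelof because of an almost disjoint family of branches of the binary tree.
\<close>

text \<open>The compact closure of \<open>L\<close> is not assumed metrizable, so a sequence of
  functions has cluster points but in general no convergent subsequence. Every limit argument
  therefore tests a cluster point at finitely many points at a time, and takes a joint cluster point
  when two functions have to be compared along the same indices. Cluster points are continuous for
  the weak topology by its definition, yet on the Cantor space they need not be Borel. Weakly open
  sets are thus never measured themselves but enclosed in measurable sets, and the dichotomy by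
  convergence in measure concerns only the continuous functions of the scheme. Towards countable
  covers the obstacle is different: fragmentation supplies sets that are open in the original
  topology, whereas a countable base is available for the weak topology only. A minimal closed set
  reconciles the two. It plays the role of a closed set on which the quotient map identifying points
  not separated by \<open>L\<close> is irreducible.\<close>

lemma mdist_self [simp]: "x \<in> mspace m \<Longrightarrow> mdist m x x = 0"
  by (rule mdist_zero[THEN iffD2]) auto

lemma infinite_Collect_mono:
  assumes "infinite {j \<in> J. P j}" "\<And>j. P j \<Longrightarrow> Q j"
  shows "infinite {j \<in> J. Q j}"
proof -
  have "{j \<in> J. P j} \<subseteq> {j \<in> J. Q j}"
    using assms(2) by blast
  then show ?thesis
    using assms(1) infinite_super by blast
qed

lemma openin_mdist_less:
  assumes "continuous_map T (mtopology_of m) f" "continuous_map T (mtopology_of m) g"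
  shows "openin T {x \<in> topspace T. mdist m (f x) (g x) < r}"
  using openin_continuous_map_preimage[OF continuous_map_mdist[OF assms], of "{..<r}"]
  by simp

lemma openin_mdist_greater:
  assumes "continuous_map T (mtopology_of m) f" "continuous_map T (mtopology_of m) g"
  shows "openin T {x \<in> topspace T. mdist m (f x) (g x) > r}"
  using openin_continuous_map_preimage[OF continuous_map_mdist[OF assms], of "{r<..}"]
  by simp

lemma closedin_mdist_le:
  assumes "continuous_map T (mtopology_of m) f" "continuous_map T (mtopology_of m) g"
  shows "closedin T {x \<in> topspace T. mdist m (f x) (g x) \<le> r}"
  using closedin_continuous_map_preimage[OF continuous_map_mdist[OF assms], of "{..r}"]
  by simp

lemma topspace_weak_topology [simp]: "topspace (weak_topology S Y H) = S"
  unfolding weak_topology_def by auto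

lemma continuous_map_weak_topology:
  assumes "h \<in> H" "h ` S \<subseteq> topspace Y"
  shows "continuous_map (weak_topology S Y H) Y h"
proof -
  have "openin (weak_topology S Y H) {x \<in> S. h x \<in> U}" if "openin Y U" for U
  proof -
    have "{x \<in> S. h x \<in> U} = h -` U \<inter> S" by auto
    then show ?thesis
      unfolding weak_topology_def using assms that
      by (intro topology_generated_by_Basis) auto
  qed
  then show ?thesis
    using assms by (auto simp: continuous_map_def)
qed

lemma topspace_pointwise_topology [simp]:
  "topspace (pointwise_topology S Y) = S \<rightarrow>\<^sub>E topspace Y"
  by (simp add: pointwise_topology_def)

lemma openin_pointwise_ball:
  assumes "finite E" "E \<subseteq> S" "\<And>x. x \<in> E \<Longrightarrow> c x \<in> mspace m"
  shows "openin (pointwise_topology S (mtopology_of m))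
           {h \<in> S \<rightarrow>\<^sub>E mspace m. \<forall>x\<in>E. mdist m (h x) (c x) < e}"
proof -
  let ?T = "pointwise_topology S (mtopology_of m)"
  have "openin ?T {h \<in> topspace ?T. mdist m (h x) (c x) < e}" if "x \<in> E" for x
    using assms that
    by (intro openin_mdist_less) (auto simp: pointwise_topology_def intro: continuous_map_product_projection)
  then have "openin ?T (topspace ?T \<inter> \<Inter>((\<lambda>x. {h \<in> topspace ?T. mdist m (h x) (c x) < e}) ` E))"
    using assms(1) by (intro openin_Int_Inter openin_topspace) auto
  moreover have "topspace ?T \<inter> \<Inter>((\<lambda>x. {h \<in> topspace ?T. mdist m (h x) (c x) < e}) ` E)
      = {h \<in> S \<rightarrow>\<^sub>E mspace m. \<forall>x\<in>E. mdist m (h x) (c x) < e}"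
    by auto
  ultimately show ?thesis by simp
qed

lemma pointwise_closure_approx:
  assumes "h \<in> pointwise_closure S (mtopology_of m) L" "finite E" "E \<subseteq> S" "e > 0"
  shows "\<exists>l\<in>L. \<forall>x\<in>E. mdist m (l x) (h x) < e"
proof -
  have h: "h \<in> S \<rightarrow>\<^sub>E mspace m"
    using assms(1) by (simp add: pointwise_closure_def in_closure_of)
  let ?U = "{f \<in> S \<rightarrow>\<^sub>E mspace m. \<forall>x\<in>E. mdist m (f x) (h x) < e}"
  have "openin (pointwise_topology S (mtopology_of m)) ?U"
    using h assms by (intro openin_pointwise_ball) auto
  moreover have "h \<in> ?U"
    using h assms by (auto simp: PiE_iff subset_iff)
  moreover have "\<forall>T. h \<in> T \<and> openin (pointwise_topology S (mtopology_of m)) T \<longrightarrow> (\<exists>l. l \<in> L \<and> l \<in> T)"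
    using assms(1) unfolding pointwise_closure_def in_closure_of by (rule conjunct2)
  ultimately have "\<exists>l. l \<in> L \<and> l \<in> ?U"
    by (simp only:)
  then show ?thesis by auto
qed

text \<open>Indices rather than values are counted, so the family may repeat functions. If every
  point of \<open>K\<close> had a neighbourhood met for finitely many indices only, a finite
  subcover would make \<open>J\<close> finite.\<close>

lemma compactin_cluster_point:
  assumes "compactin T K" "infinite J" "\<And>j. j \<in> J \<Longrightarrow> f j \<in> K"
  shows "\<exists>p\<in>K. \<forall>U. openin T U \<and> p \<in> U \<longrightarrow> infinite {j \<in> J. f j \<in> U}"
proof (rule ccontr)
  assume "\<not> ?thesis"
  then obtain U where U: "\<And>p. p \<in> K \<Longrightarrow> openin T (U p) \<and> p \<in> U p \<and> finite {j \<in> J. f j \<in> U p}"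
    by metis
  obtain Q where Q: "finite Q" "Q \<subseteq> U ` K" "K \<subseteq> \<Union>Q"
    using compactinD[OF assms(1), of "U ` K"] U by blast
  have "J \<subseteq> (\<Union>V\<in>Q. {j \<in> J. f j \<in> V})"
    using assms(3) Q(3) by blast
  moreover have "finite (\<Union>V\<in>Q. {j \<in> J. f j \<in> V})"
    using Q U by blast
  ultimately show False
    using assms(2) finite_subset by blast
qed

text \<open>Separate cluster points of \<open>f\<close> and \<open>g\<close> could be approached
  along unrelated indices. A cluster point of the pairs in \<open>K \<times> K\<close> approximates
  both at the same \<open>j\<close>.\<close>

lemma pointwise_cluster_pair:
  assumes K: "compactin (pointwise_topology S (mtopology_of m)) K" and "infinite J"
    and "\<And>j. j \<in> J \<Longrightarrow> f j \<in> K" "\<And>j. j \<in> J \<Longrightarrow> g j \<in> K"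
  shows "\<exists>p\<in>K. \<exists>q\<in>K. \<forall>E e. finite E \<and> E \<subseteq> S \<and> e > 0 \<longrightarrow>
     infinite {j \<in> J. \<forall>x\<in>E. mdist m (f j x) (p x) < e \<and> mdist m (g j x) (q x) < e}"
proof -
  let ?T = "pointwise_topology S (mtopology_of m)"
  have "compactin (prod_topology ?T ?T) (K \<times> K)"
    using K by (simp add: compactin_Times)
  from compactin_cluster_point[OF this \<open>infinite J\<close>, of "\<lambda>j. (f j, g j)"] assms(3,4)
  obtain p q where pq: "p \<in> K" "q \<in> K" and
    inf: "\<And>U. openin (prod_topology ?T ?T) U \<Longrightarrow> (p,q) \<in> U \<Longrightarrow> infinite {j \<in> J. (f j, g j) \<in> U}"
    by auto
  have sub: "K \<subseteq> S \<rightarrow>\<^sub>E mspace m"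
    using compactin_subset_topspace[OF K] by simp
  show ?thesis
  proof (intro bexI conjI allI impI)
    fix E :: "'a set" and e :: real assume E: "finite E \<and> E \<subseteq> S \<and> e > 0"
    let ?U = "\<lambda>p. {h \<in> S \<rightarrow>\<^sub>E mspace m. \<forall>x\<in>E. mdist m (h x) (p x) < e}"
    have in_space: "c x \<in> mspace m" if "c \<in> K" "x \<in> E" for c x
      using sub that E by auto
    have "openin (prod_topology ?T ?T) (?U p \<times> ?U q)"
      using E pq in_space
      by (intro openin_prod_Times_iff[THEN iffD2] disjI2 conjI openin_pointwise_ball) auto
    moreover have "(p,q) \<in> ?U p \<times> ?U q"
      using pq sub E in_space by auto
    ultimately have "infinite {j \<in> J. (f j, g j) \<in> ?U p \<times> ?U q}"
      by (rule inf)
    then show "infinite {j \<in> J. \<forall>x\<in>E. mdist m (f j x) (p x) < e \<and> mdist m (g j x) (q x) < e}"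
      by (rule infinite_Collect_mono) auto
  qed (use pq in auto)
qed

lemma pointwise_cluster:
  assumes "compactin (pointwise_topology S (mtopology_of m)) K" "infinite J"
    and "\<And>j. j \<in> J \<Longrightarrow> f j \<in> K"
  shows "\<exists>p\<in>K. \<forall>E e. finite E \<and> E \<subseteq> S \<and> e > 0 \<longrightarrow>
     infinite {j \<in> J. \<forall>x\<in>E. mdist m (f j x) (p x) < e}"
proof -
  have "\<exists>p\<in>K. \<exists>q\<in>K. \<forall>E e. finite E \<and> E \<subseteq> S \<and> e > 0 \<longrightarrow>
     infinite {j \<in> J. \<forall>x\<in>E. mdist m (f j x) (p x) < e \<and> mdist m (f j x) (q x) < e}"
    by (rule pointwise_cluster_pair) (fact assms)+
  then obtain p q where p: "p \<in> K" and inf: "\<forall>E e. finite E \<and> E \<subseteq> S \<and> e > 0 \<longrightarrow>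
     infinite {j \<in> J. \<forall>x\<in>E. mdist m (f j x) (p x) < e \<and> mdist m (f j x) (q x) < e}"
    by (elim bexE)
  show ?thesis
  proof (intro bexI[OF _ p] allI impI)
    fix E :: "'a set" and e :: real assume "finite E \<and> E \<subseteq> S \<and> e > 0"
    from inf[rule_format, OF this] show "infinite {j \<in> J. \<forall>x\<in>E. mdist m (f j x) (p x) < e}"
      by (rule infinite_Collect_mono) simp
  qed
qed

subsection \<open>Lindelof weak topologies and measures\<close>

lemma uncountable_nat_bool: "uncountable (UNIV :: (nat \<Rightarrow> bool) set)"
proof
  assume "countable (UNIV :: (nat \<Rightarrow> bool) set)"
  then obtain f :: "nat \<Rightarrow> nat \<Rightarrow> bool" where f: "range f = UNIV"
    using uncountable_def by blast
  obtain n where "f n = (\<lambda>k. \<not> f k k)"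
    using f by (metis rangeE UNIV_I)
  then have "f n n = (\<not> f n n)"
    by (metis (full_types))
  then show False by simp
qed

text \<open>By \<open>pattern\<close>, each branch of the binary tree has a point
  \<open>w \<alpha>\<close> at which \<open>g s\<close> is near \<open>a\<close> for the initial
  segments \<open>s\<close> of the branch and near \<open>b\<close> for all other words. A cluster
  point \<open>h z\<close> that is near \<open>a\<close> at \<open>w \<alpha>\<close> forces
  infinitely many words of \<open>J z\<close> onto the branch. The open sets \<open>V z\<close>
  together with the complement of the closed set \<open>F\<close> then form a cover without
  countable subcover.\<close>

lemma independent_imp_not_Lindelof:
  fixes g :: "bool list \<Rightarrow> 'x \<Rightarrow> 'b"
  assumes Lind: "Lindelof_space (weak_topology S (mtopology_of m) H)"
    and comp: "compactin (pointwise_topology S (mtopology_of m)) H"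
    and gH: "\<And>s. g s \<in> H"
    and ab: "a \<in> mspace m" "b \<in> mspace m" "2 * r < mdist m a b"
    and pattern: "\<And>\<tau>. \<exists>z\<in>S. \<forall>s. mdist m (g s z) (if \<tau> s then a else b) \<le> r"
  shows False
proof -
  let ?W = "weak_topology S (mtopology_of m) H"
  have Hsub: "h x \<in> mspace m" if "h \<in> H" "x \<in> S" for h x
    using compactin_subset_topspace[OF comp] that by auto
  have cont: "continuous_map ?W (mtopology_of m) h" if "h \<in> H" for h
    using that Hsub by (intro continuous_map_weak_topology) auto
  have const: "continuous_map ?W (mtopology_of m) (\<lambda>x. a)"
    using ab by simp
  \<comment> \<open>This slack satisfies \<open>2 * r + 2 * c = mdist m a b\<close>, which is
    exactly what the strict triangle inequality in \<open>near\<close> contradicts.\<close>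
  define c where "c = (mdist m a b - 2 * r) / 2"
  have c: "c > 0" using ab by (simp add: c_def)
  \<comment> \<open>On \<open>F\<close> the index sets \<open>J z\<close> below are infinite, so that they carry cluster points.\<close>
  define F where "F = {z \<in> S. \<forall>n. \<exists>s. length s = n \<and> mdist m (g s z) a \<le> r}"
  define A where "A = (\<lambda>s. {z \<in> S. mdist m (g s z) a \<le> r})"
  have clA: "closedin ?W (A s)" for s
    using closedin_mdist_le[OF cont[OF gH] const, of s r] by (simp add: A_def)
  have fin: "finite {s :: bool list. length s = n}" for n
    using finite_lists_length_eq[of "UNIV :: bool set" n] by simp
  have clU: "closedin ?W (\<Union>s\<in>{s. length s = n}. A s)" for n
    using fin[of n] clA by (intro closedin_Union) auto
  have "F = (\<Inter>n. \<Union>s\<in>{s. length s = n}. A s)"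
    by (auto simp: F_def A_def)
  also have "closedin ?W \<dots>"
    by (rule closedin_Inter) (use clU in auto)
  finally have clF: "closedin ?W F" .
  define J where "J = (\<lambda>z. {s. mdist m (g s z) a \<le> r})"
  have infJ: "infinite (J z)" if zF: "z \<in> F" for z
  proof
    assume "finite (J z)"
    then have "finite (length ` J z)" by simp
    moreover have "n \<in> length ` J z" for n
    proof -
      obtain s where "length s = n" "s \<in> J z"
        using zF unfolding F_def J_def by blast
      then show ?thesis by blast
    qed
    then have "length ` J z = UNIV" by blast
    ultimately show False by simp
  qed
  define Q where "Q z h \<longleftrightarrow> h \<in> H \<and> (\<forall>E e. finite E \<and> E \<subseteq> S \<and> e > 0 \<longrightarrow>
          infinite {s \<in> J z. \<forall>x\<in>E. mdist m (g s x) (h x) < e})" for z h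
  have "\<exists>h. Q z h" if "z \<in> F" for z
    using pointwise_cluster[OF comp infJ[OF that], of g] gH unfolding Q_def by blast
  then obtain h where h: "\<And>z. z \<in> F \<Longrightarrow> Q z (h z)"
    by metis
  have hH: "h z \<in> H" if "z \<in> F" for z
    using h[OF that] by (simp add: Q_def)
  have hc: "infinite {s \<in> J z. \<forall>x\<in>E. mdist m (g s x) (h z x) < e}"
    if "z \<in> F" "finite E \<and> E \<subseteq> S \<and> e > 0" for z E e
    using h[OF that(1)] that(2) unfolding Q_def by blast
  define V where "V = (\<lambda>z. {w \<in> S. mdist m (h z w) a < r + c})"
  have opV: "openin ?W (V z)" if "z \<in> F" for z
    using openin_mdist_less[OF cont[OF hH[OF that]] const] by (simp add: V_def)
  have zV: "z \<in> V z" if "z \<in> F" for z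
  proof -
    have zS: "z \<in> S" using that by (simp add: F_def)
    have "infinite {s \<in> J z. \<forall>x\<in>{z}. mdist m (g s x) (h z x) < c}"
      using zS c by (intro hc[OF that]) auto
    then obtain s where "s \<in> J z" "mdist m (g s z) (h z z) < c"
      by (auto dest!: not_finite_existsD)
    then have "mdist m (h z z) a < r + c"
      using mdist_triangle[of "h z z" m "g s z" a] Hsub[OF hH[OF that] zS] Hsub[OF gH zS] ab
      by (simp add: J_def mdist_commute)
    then show ?thesis using zS by (simp add: V_def)
  qed
  \<comment> \<open>Distinct branches are almost disjoint, hence \<open>V z\<close> contains at most one of the points \<open>w \<alpha>\<close>.\<close>
  define br :: "(nat \<Rightarrow> bool) \<Rightarrow> bool list \<Rightarrow> bool"
    where "br = (\<lambda>\<alpha> s. s = map \<alpha> [0..<length s])"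
  obtain w where wS: "\<And>\<alpha>. w \<alpha> \<in> S" and
    w: "\<And>\<alpha> s. mdist m (g s (w \<alpha>)) (if br \<alpha> s then a else b) \<le> r"
    using pattern[of "br _"] by metis
  have wF: "w \<alpha> \<in> F" for \<alpha>
  proof -
    have "\<exists>s. length s = n \<and> mdist m (g s (w \<alpha>)) a \<le> r" for n
      using w[of "map \<alpha> [0..<n]" \<alpha>] by (intro exI[of _ "map \<alpha> [0..<n]"]) (simp add: br_def)
    then show ?thesis
      using wS by (simp add: F_def)
  qed
  have one: "\<alpha> = \<beta>" if "z \<in> F" "w \<alpha> \<in> V z" "w \<beta> \<in> V z" for \<alpha> \<beta> z
  proof -
    have inf: "infinite {s \<in> J z. \<forall>x\<in>{w \<alpha>, w \<beta>}. mdist m (g s x) (h z x) < c}"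
      using wS c by (intro hc[OF that(1)]) auto
    have near: "br \<gamma> s" if "w \<gamma> \<in> V z" "mdist m (g s (w \<gamma>)) (h z (w \<gamma>)) < c" for s \<gamma>
    proof (rule ccontr)
      assume "\<not> br \<gamma> s"
      then have "mdist m (g s (w \<gamma>)) b \<le> r" using w[of s \<gamma>] by simp
      moreover have "mdist m (h z (w \<gamma>)) a < r + c" using that by (simp add: V_def)
      moreover have "h z (w \<gamma>) \<in> mspace m" "g s (w \<gamma>) \<in> mspace m"
        using Hsub[OF gH wS] Hsub[OF hH[OF \<open>z \<in> F\<close>] wS] by auto
      ultimately have "mdist m a b < 2 * r + 2 * c"
        using mdist_triangle[of a m "h z (w \<gamma>)" b] mdist_triangle[of "h z (w \<gamma>)" m "g s (w \<gamma>)" b] ab that(2)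
          mdist_commute[of m a "h z (w \<gamma>)"] mdist_commute[of m "g s (w \<gamma>)" "h z (w \<gamma>)"] by linarith
      then show False by (simp add: c_def field_simps)
    qed
    have "\<alpha> n = \<beta> n" for n
    proof -
      \<comment> \<open>Discarding the short words leaves a word longer than \<open>n\<close>. Being
        an initial segment of both branches, it fixes coordinate \<open>n\<close> of each.\<close>
      have "finite {s :: bool list. length s \<le> n}"
        using finite_lists_length_le[of "UNIV :: bool set" n] by simp
      then have "\<not> {s \<in> J z. \<forall>x\<in>{w \<alpha>, w \<beta>}. mdist m (g s x) (h z x) < c} \<subseteq> {s. length s \<le> n}"
        using inf finite_subset by blast
      then obtain s where "s \<in> {s \<in> J z. \<forall>x\<in>{w \<alpha>, w \<beta>}. mdist m (g s x) (h z x) < c}" "\<not> length s \<le> n"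
        by blast
      then have s: "length s > n" "mdist m (g s (w \<alpha>)) (h z (w \<alpha>)) < c"
        "mdist m (g s (w \<beta>)) (h z (w \<beta>)) < c"
        by auto
      have "br \<alpha> s" "br \<beta> s" using near that s by auto
      then have "s ! n = \<alpha> n" "s ! n = \<beta> n"
        using s(1) unfolding br_def by (metis add_0 diff_zero length_upt nth_map nth_upt)+
      then show ?thesis by simp
    qed
    then show ?thesis by blast
  qed
  let ?\<U> = "insert (S - F) (V ` F)"
  have "\<exists>\<V>. countable \<V> \<and> \<V> \<subseteq> ?\<U> \<and> \<Union>\<V> = topspace ?W"
  proof (rule Lindelof_spaceD[OF Lind])
    show "openin ?W U" if "U \<in> ?\<U>" for U
      using that opV openin_diff[OF openin_topspace clF] by auto
    show "\<Union>?\<U> = topspace ?W"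
      using zV by (auto simp: V_def)
  qed
  then obtain \<V> where \<V>: "countable \<V>" "\<V> \<subseteq> ?\<U>" "\<Union>\<V> = S" by auto
  have "\<exists>U\<in>\<V>. w \<alpha> \<in> U \<and> U \<in> V ` F" for \<alpha>
    using \<V>(2,3) wS[of \<alpha>] wF[of \<alpha>] by blast
  then obtain U where U: "\<And>\<alpha>. U \<alpha> \<in> \<V> \<and> w \<alpha> \<in> U \<alpha> \<and> U \<alpha> \<in> V ` F" by metis
  have "inj U"
  proof (rule injI)
    fix \<alpha> \<beta> assume eq: "U \<alpha> = U \<beta>"
    obtain z where "z \<in> F" "U \<alpha> = V z" using U by blast
    then show "\<alpha> = \<beta>" using one[of z \<alpha> \<beta>] U[of \<alpha>] U[of \<beta>] eq by simp
  qed
  moreover have "countable (range U)"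
    using U \<V>(1) by (meson countable_subset image_subsetI)
  ultimately have "countable (UNIV :: (nat \<Rightarrow> bool) set)"
    using countable_image_inj_on by blast
  then show False using uncountable_nat_bool by simp
qed

text \<open>Open sets of \<open>T\<close> need not be measurable, hence the measurable hulls
  \<open>N\<close>. A countable subcover consists of hulls of total measure at most 1/2, chosen at
  the points of \<open>Z\<close>, and of countably many null sets, which is too little for a
  probability space.\<close>

lemma Lindelof_cover_measure:
  assumes Lind: "Lindelof_space T" and top: "topspace T = space M" and "prob_space M" and Z: "countable Z"
    and small: "\<And>z e :: real. z \<in> space M \<Longrightarrow> e > 0 \<Longrightarrow>
        \<exists>V N. openin T V \<and> z \<in> V \<and> V \<subseteq> N \<and> N \<in> sets M \<and> measure M N < e"
    and null: "\<And>u. u \<in> space M \<Longrightarrow> u \<notin> Z \<Longrightarrow> \<exists>V N. openin T V \<and> u \<in> V \<and> V \<subseteq> N \<and> N \<in> null_sets M"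
    and "Z \<subseteq> space M"
  shows False
proof -
  interpret prob_space M by fact
  obtain x0 where x0: "x0 \<in> space M" using not_empty by blast
  \<comment> \<open>The enumeration may repeat points; for empty \<open>Z\<close> it takes an
    arbitrary point, to which \<open>small\<close> applies as well.\<close>
  define z where "z n = (if Z = {} then x0 else from_nat_into Z n)" for n
  have zin: "z n \<in> space M" for n
    using x0 \<open>Z \<subseteq> space M\<close> from_nat_into[of Z n] by (auto simp: z_def)
  have Zz: "Z \<subseteq> range z"
    using subset_range_from_nat_into[OF Z] by (auto simp: z_def)
  \<comment> \<open>The exponent \<open>n+2\<close> makes the series of these bounds sum to
    1/2.\<close>
  have "\<exists>V N. openin T V \<and> z n \<in> V \<and> V \<subseteq> N \<and> N \<in> sets M \<and> measure M N < (1/2)^(n+2)" for n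
    by (rule small[OF zin]) simp
  then obtain V N where V: "\<And>n. openin T (V n)" "\<And>n. z n \<in> V n" and N: "\<And>n. V n \<subseteq> N n"
      "\<And>n. N n \<in> sets M" "\<And>n. measure M (N n) < (1/2)^(n+2)"
    by metis
  obtain V' N' where V': "\<And>u. u \<in> space M - Z \<Longrightarrow> openin T (V' u) \<and> u \<in> V' u \<and> V' u \<subseteq> N' u \<and> N' u \<in> null_sets M"
    using null by (metis DiffE)
  let ?\<U> = "range V \<union> V' ` (space M - Z)"
  have "\<exists>\<V>. countable \<V> \<and> \<V> \<subseteq> ?\<U> \<and> \<Union>\<V> = topspace T"
  proof (rule Lindelof_spaceD[OF Lind])
    show "openin T U" if "U \<in> ?\<U>" for U
      using that V V' by auto
    then have "\<Union>?\<U> \<subseteq> topspace T"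
      using openin_subset by blast
    moreover have "topspace T \<subseteq> \<Union>?\<U>"
    proof
      fix x assume "x \<in> topspace T"
      then consider n where "x = z n" | "x \<in> space M - Z" using Zz top by blast
      then show "x \<in> \<Union>?\<U>"
        by cases (use V(2) V' in blast)+
    qed
    ultimately show "\<Union>?\<U> = topspace T" by blast
  qed
  then obtain \<V> where \<V>: "countable \<V>" "\<V> \<subseteq> ?\<U>" "\<Union>\<V> = space M" using top by auto
  have "countable (\<V> \<inter> V' ` (space M - Z))" using \<V>(1) by (rule countable_Int1)
  then obtain I where I: "countable I" "I \<subseteq> space M - Z" "\<V> \<inter> V' ` (space M - Z) = V' ` I"
    using countable_subset_image[of "\<V> \<inter> V' ` (space M - Z)" V' "space M - Z"] by (metis inf_le2)
  have "space M \<subseteq> (\<Union>n. N n) \<union> (\<Union>u\<in>I. N' u)"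
  proof
    fix x assume "x \<in> space M"
    then obtain U where U: "U \<in> \<V>" "x \<in> U" using \<V> by blast
    have "U \<in> range V \<or> U \<in> \<V> \<inter> V' ` (space M - Z)" using U(1) \<V>(2) by blast
    then consider n where "U = V n" | u where "u \<in> I" "U = V' u" unfolding I(3) by blast
    then show "x \<in> (\<Union>n. N n) \<union> (\<Union>u\<in>I. N' u)"
    proof cases
      case 1
      then show ?thesis using N(1) U by blast
    next
      case 2
      then show ?thesis using V' I(2) U by blast
    qed
  qed
  moreover have null': "(\<Union>u\<in>I. N' u) \<in> null_sets M"
    using V' I by (intro null_sets_UN') auto
  ultimately have "emeasure M (space M) \<le> emeasure M ((\<Union>n. N n) \<union> (\<Union>u\<in>I. N' u))"
    using N(2) by (intro emeasure_mono) auto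
  also have "\<dots> = emeasure M (\<Union>n. N n)"
    using null' N(2) by (intro emeasure_Un_null_set) auto
  also have "\<dots> \<le> (\<Sum>n. emeasure M (N n))"
    using N(2) by (intro emeasure_subadditive_countably) auto
  also have "\<dots> \<le> (\<Sum>n. ennreal ((1/4) * (1/2)^n))"
    using N(3) by (intro suminf_le) (auto simp: emeasure_eq_measure power_add less_imp_le)
  also have "\<dots> = ennreal (1/2)"
    using sums_mult[OF geometric_sums[of "1/2::real"], of "1/4"]
    by (intro suminf_ennreal_eq) auto
  finally have "ennreal 1 \<le> ennreal (1/2)"
    unfolding emeasure_space_1 ennreal_1 .
  then show False
    by (subst (asm) ennreal_le_iff) auto
qed

text \<open>Otherwise there are pairs that agree up to \<open>(1/2)^n\<close> in measure but stay
  \<open>e\<close> apart at \<open>u\<close>. Their joint cluster point \<open>(p, q)\<close> agrees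
  almost everywhere and disagrees at \<open>u\<close>. Since \<open>p\<close> and \<open>q\<close>
  are weakly continuous, the disagreement persists on a weak neighbourhood of \<open>u\<close>,
  which is then null.\<close>

lemma uniform_at_point:
  fixes m :: "'b metric" and M :: "'x measure"
  assumes comp: "compactin (pointwise_topology (space M) (mtopology_of m)) H"
    and "prob_space M" and LH: "L \<subseteq> H"
    and meas: "\<And>l l' r. l \<in> L \<Longrightarrow> l' \<in> L \<Longrightarrow> {v \<in> space M. mdist m (l v) (l' v) > r} \<in> sets M"
    and u: "u \<in> space M"
    and nonnull: "\<And>V N. openin (weak_topology (space M) (mtopology_of m) H) V \<Longrightarrow> u \<in> V \<Longrightarrow> V \<subseteq> N \<Longrightarrow> N \<notin> null_sets M"
    and "e > 0"
  shows "\<exists>n. \<forall>l\<in>L. \<forall>l'\<in>L. measure M {v \<in> space M. mdist m (l v) (l' v) > (1/2)^n} < (1/2)^n \<longrightarrow>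
            mdist m (l u) (l' u) < e"
proof (rule ccontr)
  interpret prob_space M by fact
  let ?W = "weak_topology (space M) (mtopology_of m) H"
  define P where "P n l l' \<longleftrightarrow> l \<in> L \<and> l' \<in> L \<and>
      measure M {v \<in> space M. mdist m (l v) (l' v) > (1/2)^n} < (1/2)^n \<and> mdist m (l u) (l' u) \<ge> e"
    for n :: nat and l l'
  assume "\<not> ?thesis"
  then have "\<forall>n. \<exists>l l'. P n l l'"
    unfolding P_def by (meson not_le)
  then obtain l l' where ll: "\<And>n. P n (l n) (l' n)"
    by metis
  have l: "\<And>n. l n \<in> L" "\<And>n. l' n \<in> L"
    and small: "\<And>n. measure M {v \<in> space M. mdist m (l n v) (l' n v) > (1/2)^n} < (1/2)^n"
    and big: "\<And>n. mdist m (l n u) (l' n u) \<ge> e"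
    using ll unfolding P_def by blast+
  have lH: "l n \<in> H" "l' n \<in> H" for n using l LH by auto
  have Hsub: "h x \<in> mspace m" if "h \<in> H" "x \<in> space M" for h x
    using compactin_subset_topspace[OF comp] that by auto
  have cont: "continuous_map ?W (mtopology_of m) h" if "h \<in> H" for h
    using that Hsub by (intro continuous_map_weak_topology) auto
  define A where "A n = {v \<in> space M. mdist m (l n v) (l' n v) > (1/2)^n}" for n
  \<comment> \<open>Borel-Cantelli: off a null set the two functions are within
    \<open>(1/2)^n\<close> of each other for all large \<open>n\<close>.\<close>
  have null: "limsup A \<in> null_sets M"
  proof (rule borel_cantelli_limsup1)
    show "A n \<in> sets M" for n unfolding A_def using l by (intro meas)
    show "emeasure M (A n) < \<infinity>" for n by (simp add: emeasure_eq_measure)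
    show "summable (\<lambda>n. measure M (A n))"
      using small by (intro summable_comparison_test'[OF summable_geometric[of "1/2::real"], of 0]) 
        (auto simp: A_def less_imp_le)
  qed
  have "\<exists>p\<in>H. \<exists>q\<in>H. \<forall>E e. finite E \<and> E \<subseteq> space M \<and> e > 0 \<longrightarrow>
     infinite {n \<in> UNIV. \<forall>x\<in>E. mdist m (l n x) (p x) < e \<and> mdist m (l' n x) (q x) < e}"
    by (rule pointwise_cluster_pair[OF comp]) (use lH in auto)
  then obtain p q where pq: "p \<in> H" "q \<in> H"
    and inf: "\<And>E e. finite E \<and> E \<subseteq> space M \<and> e > 0 \<Longrightarrow>
     infinite {n \<in> UNIV. \<forall>x\<in>E. mdist m (l n x) (p x) < e \<and> mdist m (l' n x) (q x) < e}"
    by (elim bexE) blast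
  have near: "\<exists>n\<ge>k. mdist m (l n x) (p x) < r \<and> mdist m (l' n x) (q x) < r"
    if "x \<in> space M" "r > 0" for x r k
  proof -
    have "infinite {n \<in> UNIV. \<forall>y\<in>{x}. mdist m (l n y) (p y) < r \<and> mdist m (l' n y) (q y) < r}"
      using that by (intro inf) auto
    then have "\<exists>n\<ge>k. n \<in> {n \<in> UNIV. \<forall>y\<in>{x}. mdist m (l n y) (p y) < r \<and> mdist m (l' n y) (q y) < r}"
      by (meson infinite_nat_iff_unbounded_le)
    then show ?thesis by simp
  qed
  have tri: "mdist m (p x) (q x) \<le> mdist m (l n x) (p x) + mdist m (l n x) (l' n x) + mdist m (l' n x) (q x)"
    "mdist m (l n x) (l' n x) \<le> mdist m (l n x) (p x) + mdist m (p x) (q x) + mdist m (l' n x) (q x)"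
    if "x \<in> space M" for x n
  proof -
    have s: "p x \<in> mspace m" "q x \<in> mspace m" "l n x \<in> mspace m" "l' n x \<in> mspace m"
      using pq lH Hsub that by auto
    show "mdist m (p x) (q x) \<le> mdist m (l n x) (p x) + mdist m (l n x) (l' n x) + mdist m (l' n x) (q x)"
      using mdist_triangle[OF s(1,3,2)] mdist_triangle[OF s(3,4,2)] mdist_commute[of m "p x" "l n x"] by linarith
    show "mdist m (l n x) (l' n x) \<le> mdist m (l n x) (p x) + mdist m (p x) (q x) + mdist m (l' n x) (q x)"
      using mdist_triangle[OF s(3,1,4)] mdist_triangle[OF s(1,2,4)] mdist_commute[of m "q x" "l' n x"] by linarith
  qed
  \<comment> \<open>On \<open>V\<close> each of \<open>p\<close>, \<open>q\<close> varies by less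
    than \<open>e/4\<close> from its value at \<open>u\<close>. Their distance exceeds
    \<open>3*e/4\<close> at \<open>u\<close> and is below \<open>e/4\<close> off
    \<open>limsup A\<close>, so \<open>V\<close> lies in that null set.\<close>
  define V where "V = {v \<in> space M. mdist m (p v) (p u) < e/4} \<inter> {v \<in> space M. mdist m (q v) (q u) < e/4}"
  have cu: "continuous_map ?W (mtopology_of m) (\<lambda>x. h u)" if "h \<in> H" for h
    using Hsub[OF that u] by simp
  have "openin ?W {v \<in> space M. mdist m (h v) (h u) < e/4}" if "h \<in> H" for h
    using openin_mdist_less[OF cont[OF that] cu[OF that], of "e/4"] by (simp only: topspace_weak_topology)
  then have "openin ?W V"
    unfolding V_def using pq by (intro openin_Int)
  moreover have "u \<in> V"
    using u Hsub[OF pq(1) u] Hsub[OF pq(2) u] \<open>e > 0\<close> by (simp add: V_def)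
  moreover have "V \<subseteq> limsup A"
  proof (rule ccontr)
    assume "\<not> V \<subseteq> limsup A"
    then obtain v where v: "v \<in> V" "v \<notin> limsup A" by blast
    have vM: "v \<in> space M" using v by (simp add: V_def)
    obtain k where k: "\<And>n. n \<ge> k \<Longrightarrow> v \<notin> A n"
      using v(2) by (auto simp: limsup_INF_SUP)
    obtain k' where k': "(1/2::real)^k' < e/8"
      using real_arch_pow_inv[of "e/8" "1/2"] \<open>e > 0\<close> by auto
    obtain n where n: "n \<ge> max k k'" "mdist m (l n v) (p v) < e/16" "mdist m (l' n v) (q v) < e/16"
      using near[OF vM, of "e/16"] \<open>e > 0\<close> by (metis divide_pos_pos zero_less_numeral)
    have "mdist m (l n v) (l' n v) \<le> (1/2)^n"
      using k[of n] n(1) vM by (auto simp: A_def)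
    also have "\<dots> \<le> (1/2)^k'" using n(1) by (intro power_decreasing) auto
    finally have 1: "mdist m (p v) (q v) < e/4"
      using tri(1)[OF vM, of n] n k' by linarith
    obtain n where n: "mdist m (l n u) (p u) < e/16" "mdist m (l' n u) (q u) < e/16"
      using near[OF u, of "e/16"] \<open>e > 0\<close> by (metis divide_pos_pos zero_less_numeral)
    have 2: "mdist m (p u) (q u) > 3*e/4"
      using tri(2)[OF u, of n] n big[of n] \<open>e > 0\<close> by linarith
    have s: "p v \<in> mspace m" "q v \<in> mspace m" "p u \<in> mspace m" "q u \<in> mspace m"
      using pq Hsub u vM by auto
    have "mdist m (p u) (q u) \<le> mdist m (p v) (p u) + mdist m (p v) (q v) + mdist m (q v) (q u)"
      using mdist_triangle[OF s(3,1,4)] mdist_triangle[OF s(1,2,4)] mdist_commute[of m "p u" "p v"] by linarith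
    moreover have "mdist m (p v) (p u) < e/4" "mdist m (q v) (q u) < e/4"
      using v by (auto simp: V_def)
    ultimately show False using 1 2 by linarith
  qed
  ultimately show False using nonnull null by blast
qed

text \<open>Compactness gives a finite cover on whose members the finitely many functions in
  \<open>E\<close> oscillate by less than \<open>e\<close>; replacing \<open>l\<close> by its
  approximation on \<open>P\<close> costs another \<open>e\<close> at each end. It converts
  approximation by a finite net of functions into a finite cover by sets of small
  oscillation.\<close>

lemma finite_cover_small:
  fixes T :: "'x topology" and m :: "'b metric"
  assumes "compact_space T" "finite E" and cont: "\<And>l. l \<in> E \<Longrightarrow> continuous_map T (mtopology_of m) l"
    and P: "P \<subseteq> topspace T" and "e > 0"
    and L: "\<And>l x. l \<in> L \<Longrightarrow> x \<in> P \<Longrightarrow> l x \<in> mspace m"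
    and net: "\<And>l. l \<in> L \<Longrightarrow> \<exists>l'\<in>E. \<forall>x\<in>P. mdist m (l x) (l' x) < e"
  shows "\<exists>\<V>. finite \<V> \<and> P \<subseteq> \<Union>\<V> \<and> (\<forall>V\<in>\<V>. \<forall>l\<in>L. \<forall>x\<in>V. \<forall>y\<in>V. mdist m (l x) (l y) < 3 * e)"
proof -
  define B where "B x = topspace T \<inter> \<Inter>((\<lambda>l. {y \<in> topspace T. mdist m (l y) (l x) < e/2}) ` E)" for x
  have sp: "l x \<in> mspace m" if "l \<in> E" "x \<in> topspace T" for l x
    using continuous_map_funspace[OF cont[OF that(1)]] that(2) by auto
  have op: "openin T (B x)" if x: "x \<in> topspace T" for x
    unfolding B_def
  proof (intro openin_Int_Inter)
    show "finite ((\<lambda>l. {y \<in> topspace T. mdist m (l y) (l x) < e/2}) ` E)"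
      using \<open>finite E\<close> by simp
    fix A assume "A \<in> (\<lambda>l. {y \<in> topspace T. mdist m (l y) (l x) < e/2}) ` E"
    then obtain l where l: "l \<in> E" "A = {y \<in> topspace T. mdist m (l y) (l x) < e/2}" by blast
    have "continuous_map T (mtopology_of m) (\<lambda>y. l x)"
      using sp[OF l(1) x] by simp
    then show "openin T A"
      unfolding l(2) by (rule openin_mdist_less[OF cont[OF l(1)]])
  qed simp
  have xB: "x \<in> B x" if "x \<in> topspace T" for x
    using that sp \<open>e > 0\<close> by (auto simp: B_def)
  obtain \<F> where \<F>: "finite \<F>" "\<F> \<subseteq> B ` topspace T" "topspace T \<subseteq> \<Union>\<F>"
    using compactinD[of T "topspace T" "B ` topspace T"] \<open>compact_space T\<close> op xB
    unfolding compact_space_def by blast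
  have "mdist m (l x) (l y) < 3 * e" if V: "V \<in> \<F>" and l: "l \<in> L" and xy: "x \<in> V \<inter> P" "y \<in> V \<inter> P" for V l x y
  proof -
    obtain z where z: "z \<in> topspace T" "V = B z" using V \<F>(2) by blast
    obtain l' where l': "l' \<in> E" "\<forall>x\<in>P. mdist m (l x) (l' x) < e" using net[OF l] by blast
    have t: "x \<in> topspace T" "y \<in> topspace T" using xy P by auto
    have s: "l x \<in> mspace m" "l y \<in> mspace m" "l' x \<in> mspace m" "l' y \<in> mspace m" "l' z \<in> mspace m"
      using L[OF l] xy sp[OF l'(1)] t z(1) by auto
    have d: "mdist m (l' x) (l' z) < e/2" "mdist m (l' y) (l' z) < e/2"
      using xy l'(1) z(2) by (auto simp: B_def)
    have d': "mdist m (l x) (l' x) < e" "mdist m (l y) (l' y) < e"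
      using l'(2) xy by auto
    show ?thesis
      using mdist_triangle[OF s(1,3,2)] mdist_triangle[OF s(3,5,2)] mdist_triangle[OF s(5,4,2)]
        mdist_commute[of m "l' y" "l' z"] mdist_commute[of m "l' y" "l y"] d d' by linarith
  qed
  moreover have "P \<subseteq> \<Union>((\<lambda>V. V \<inter> P) ` \<F>)"
    using \<F>(3) P by auto
  ultimately show ?thesis
    using \<F>(1) by (intro exI[of _ "(\<lambda>V. V \<inter> P) ` \<F>"]) auto
qed

text \<open>\<open>u\<close> is only finitely subadditive; domination by the measure makes the exhaustion argument
  work nevertheless.\<close>

lemma maximal_null_set:
  assumes "finite_measure M"
    and nonneg: "\<And>W. W \<in> sets M \<Longrightarrow> 0 \<le> (u W :: real)"
    and le: "\<And>W. W \<in> sets M \<Longrightarrow> u W \<le> measure M W"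
    and subadd: "\<And>V W. V \<in> sets M \<Longrightarrow> W \<in> sets M \<Longrightarrow> u (V \<union> W) \<le> u V + u W"
  shows "\<exists>N\<in>sets M. u N = 0 \<and> (\<forall>W\<in>sets M. u W = 0 \<and> W \<inter> N = {} \<longrightarrow> measure M W = 0)"
proof -
  interpret finite_measure M by fact
  define \<N> where "\<N> = {N \<in> sets M. u N = 0}"
  have emp: "{} \<in> \<N>"
    using nonneg[of "{}"] le[of "{}"] by (simp add: \<N>_def)
  have un: "V \<union> W \<in> \<N>" if "V \<in> \<N>" "W \<in> \<N>" for V W
    using that subadd[of V W] nonneg[of "V \<union> W"] by (auto simp: \<N>_def)
  define s where "s = (SUP N\<in>\<N>. measure M N)"
  have bdd: "bdd_above (measure M ` \<N>)"
    using bounded_measure by (intro bdd_aboveI[of _ "measure M (space M)"]) auto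
  have "\<exists>N\<in>\<N>. measure M N > s - inverse (real (Suc r))" for r
  proof -
    have "s - inverse (real (Suc r)) < s" by simp
    then show ?thesis unfolding s_def using less_cSUP_iff[OF _ bdd] emp by blast
  qed
  then obtain N where N: "\<And>r. N r \<in> \<N>" "\<And>r. measure M (N r) > s - inverse (real (Suc r))" by metis
  have Nsets: "N r \<in> sets M" for r using N(1)[of r] by (simp add: \<N>_def)
  define C where "C = (\<Union>r. N r)"
  have Csets: "C \<in> sets M" using Nsets by (auto simp: C_def)
  have part: "(\<Union>r<R. N r) \<in> \<N>" for R
    by (induction R) (auto simp: emp lessThan_Suc intro: un N(1))
  have "(\<lambda>R. measure M (\<Union>r<R. N r)) \<longlonglongrightarrow> measure M (\<Union>R. \<Union>r<R. N r)"
    using part by (intro finite_Lim_measure_incseq) (auto simp: \<N>_def incseq_def intro: less_le_trans)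
  moreover have "(\<Union>R. \<Union>r<R. N r) = C" by (auto simp: C_def)
  ultimately have lim: "(\<lambda>R. measure M C - measure M (\<Union>r<R. N r)) \<longlonglongrightarrow> measure M C - measure M C"
    by (intro tendsto_diff tendsto_const) simp
  \<comment> \<open>Only finitely many pieces are split off by subadditivity; the remainder is
    bounded by \<open>le\<close>, and its measure tends to 0.\<close>
  have "u C \<le> measure M C - measure M (\<Union>r<R. N r)" for R
  proof -
    have p: "(\<Union>r<R. N r) \<in> sets M" "u (\<Union>r<R. N r) = 0" using part by (auto simp: \<N>_def)
    have sub: "(\<Union>r<R. N r) \<subseteq> C" by (auto simp: C_def)
    have "u C = u ((\<Union>r<R. N r) \<union> (C - (\<Union>r<R. N r)))" using sub by (simp add: Un_absorb1)
    also have "\<dots> \<le> u (\<Union>r<R. N r) + u (C - (\<Union>r<R. N r))"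
      using p Csets by (intro subadd) auto
    also have "\<dots> \<le> measure M (C - (\<Union>r<R. N r))"
      using p Csets le by auto
    also have "\<dots> = measure M C - measure M (\<Union>r<R. N r)"
      using p Csets sub by (intro finite_measure_Diff) auto
    finally show ?thesis .
  qed
  then have "u C \<le> 0"
    using LIMSEQ_le_const[OF lim] by simp
  then have uC: "u C = 0" using nonneg[OF Csets] by simp
  have sC: "s \<le> measure M C"
  proof (rule field_le_epsilon)
    fix e :: real assume "e > 0"
    then obtain r where r: "inverse (real (Suc r)) < e" using reals_Archimedean by blast
    have "measure M (N r) \<le> measure M C"
      using Csets by (intro finite_measure_mono) (auto simp: C_def)
    then show "s \<le> measure M C + e" using N(2)[of r] r by linarith
  qed
  have "measure M W = 0" if "W \<in> sets M" "u W = 0" "W \<inter> C = {}" for W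
  proof -
    have "C \<union> W \<in> \<N>" using un[of C W] that Csets uC by (auto simp: \<N>_def)
    then have "measure M (C \<union> W) \<le> s" unfolding s_def by (intro cSUP_upper bdd)
    moreover have "measure M (C \<union> W) = measure M C + measure M W"
      using that Csets by (intro finite_measure_Union) auto
    ultimately show ?thesis using sC measure_nonneg[of M W] by linarith
  qed
  then show ?thesis using Csets uC by blast
qed

section \<open>Nets in the range and independent subsequences\<close>

lemma compact_space_finite_net:
  assumes "compact_space T" and cont: "continuous_map T (mtopology_of m) l" and "e > 0"
  shows "\<exists>D. finite D \<and> D \<subseteq> topspace T \<and> (\<forall>v\<in>topspace T. \<exists>x\<in>D. mdist m (l v) (l x) < e)"
proof -
  have sp: "l v \<in> mspace m" if "v \<in> topspace T" for v
    using continuous_map_funspace[OF cont] that by auto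
  define B where "B x = {v \<in> topspace T. mdist m (l v) (l x) < e}" for x
  have op: "openin T (B x)" if "x \<in> topspace T" for x
    unfolding B_def using sp[OF that] by (intro openin_mdist_less[OF cont]) auto
  have xB: "x \<in> B x" if "x \<in> topspace T" for x
    using that sp \<open>e > 0\<close> by (auto simp: B_def)
  obtain \<F> where \<F>: "finite \<F>" "\<F> \<subseteq> B ` topspace T" "topspace T \<subseteq> \<Union>\<F>"
    using compactinD[of T "topspace T" "B ` topspace T"] \<open>compact_space T\<close> op xB
    unfolding compact_space_def by blast
  then obtain D where "finite D" "D \<subseteq> topspace T" "\<F> = B ` D"
    by (meson finite_subset_image)
  then show ?thesis using \<F>(3) by (intro exI[of _ D]) (force simp: B_def)
qed

text \<open>One sequence of centres serves all functions at once: it enumerates the union over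
  \<open>k\<close> of finite nets in the compact images.\<close>

lemma countable_net:
  fixes l :: "nat \<Rightarrow> 'x \<Rightarrow> 'b"
  assumes "compact_space T" and cont: "\<And>k. continuous_map T (mtopology_of m) (l k)"
    and "topspace T \<noteq> {}" "e > 0"
  shows "\<exists>c::nat \<Rightarrow> 'b. (\<forall>i. c i \<in> mspace m) \<and> (\<forall>k. \<forall>v\<in>topspace T. \<exists>i. mdist m (l k v) (c i) < e)"
proof -
  have sp: "l k v \<in> mspace m" if "v \<in> topspace T" for k v
    using continuous_map_funspace[OF cont[of k]] that by auto
  have "\<exists>D. finite D \<and> D \<subseteq> topspace T \<and> (\<forall>v\<in>topspace T. \<exists>x\<in>D. mdist m (l k v) (l k x) < e)" for k
    by (rule compact_space_finite_net[OF \<open>compact_space T\<close> cont \<open>e > 0\<close>])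
  then obtain D where D: "\<And>k. finite (D k) \<and> D k \<subseteq> topspace T \<and> (\<forall>v\<in>topspace T. \<exists>x\<in>D k. mdist m (l k v) (l k x) < e)"
    by metis
  define C where "C = (\<Union>k. l k ` D k)"
  have "countable C" using D by (auto simp: C_def countable_finite)
  moreover have "C \<noteq> {}"
  proof -
    obtain v where "v \<in> topspace T" using \<open>topspace T \<noteq> {}\<close> by blast
    then obtain x where "x \<in> D 0" using D[of 0] by blast
    then have "l 0 x \<in> C" by (auto simp: C_def)
    then show ?thesis by blast
  qed
  ultimately obtain c where c: "range c = C" "\<And>i. c (i::nat) \<in> C"
    by (metis range_from_nat_into from_nat_into)
  have "c i \<in> mspace m" for i
  proof -
    obtain k x where "c i = l k x" "x \<in> D k" using c(2)[of i] by (auto simp: C_def)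
    moreover have "D k \<subseteq> topspace T" using D by blast
    ultimately show ?thesis using sp by auto
  qed
  moreover have "\<exists>i. mdist m (l k v) (c i) < e" if v: "v \<in> topspace T" for k v
  proof -
    obtain x where x: "x \<in> D k" "mdist m (l k v) (l k x) < e" using D v by blast
    then have "l k x \<in> range c" unfolding c(1) C_def by blast
    then show ?thesis using x by auto
  qed
  ultimately show ?thesis by blast
qed

text \<open>The set functions \<open>W \<mapsto> measure M (W \<inter> A k i)\<close>, where \<open>A k i\<close> is the set of points at
  which \<open>l k\<close> is close to the \<open>i\<close>-th centre, have a cluster point \<open>u\<close> by Tychonoff's theorem; it replaces
  weak limits of the indicator functions.  Separation in measure forces two distant centres whose \<open>u\<close> are
  both positive on every non-null subset of some set of positive measure, and there the functions split
  inductively.\<close>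

lemma separated_in_measure_imp_independent:
  fixes M :: "'x measure" and m :: "'b metric" and l :: "nat \<Rightarrow> 'x \<Rightarrow> 'b"
  assumes "prob_space M" and T: "compact_space T" "topspace T = space M"
    and meas: "\<And>C. closedin T C \<Longrightarrow> C \<in> sets M"
    and cont: "\<And>k. continuous_map T (mtopology_of m) (l k)"
    and comp: "compactin (pointwise_topology (space M) (mtopology_of m)) H"
    and lH: "\<And>k. l k \<in> H" and "\<kappa> > 0"
    and far: "\<And>j k. j \<noteq> k \<Longrightarrow> measure M {v \<in> space M. mdist m (l j v) (l k v) > \<kappa>} \<ge> \<kappa>"
  shows "\<exists>a\<in>mspace m. \<exists>b\<in>mspace m. \<exists>r f. 2 * r < mdist m a b \<and>
      (\<forall>\<tau>::nat \<Rightarrow> bool. \<exists>z\<in>space M. \<forall>j. mdist m (l (f j) z) (if \<tau> j then a else b) \<le> r)"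
proof -
  interpret prob_space M by fact
  have sp: "l k v \<in> mspace m" if "v \<in> space M" for k v
    using continuous_map_funspace[OF cont[of k]] that T(2) by auto
  obtain c :: "nat \<Rightarrow> 'b" where c: "\<And>i. c i \<in> mspace m"
    and net: "\<And>k v. v \<in> space M \<Longrightarrow> \<exists>i. mdist m (l k v) (c i) < \<kappa>/32"
  proof -
    have "\<exists>c::nat \<Rightarrow> 'b. (\<forall>i. c i \<in> mspace m) \<and> (\<forall>k. \<forall>v\<in>topspace T. \<exists>i. mdist m (l k v) (c i) < \<kappa>/32)"
      by (rule countable_net) (use T not_empty cont \<open>\<kappa> > 0\<close> in auto)
    then obtain c0 :: "nat \<Rightarrow> 'b" where c0: "\<forall>i. c0 i \<in> mspace m" "\<forall>k. \<forall>v\<in>topspace T. \<exists>i. mdist m (l k v) (c0 i) < \<kappa>/32"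
      by blast
    show ?thesis
      by (rule that[of c0]) (use c0 T(2) in blast)+
  qed
  \<comment> \<open>At points of \<open>Y n\<close> the first \<open>n\<close> centres serve every
    function. These closed sets increase to the whole space, so one of them has measure above
    \<open>1 - \<kappa>/4\<close>, and from there on only finitely many centres matter.\<close>
  define Y where "Y n = {v \<in> space M. \<forall>k. \<exists>i<n. mdist m (l k v) (c i) \<le> \<kappa>/8}" for n
  have cl: "closedin T {v \<in> space M. mdist m (l k v) (c i) \<le> \<kappa>/8}" for k i
    using closedin_mdist_le[OF cont[of k], of "\<lambda>v. c i" "\<kappa>/8"] c T(2) by simp
  have clU: "closedin T (\<Union>i<n. {v \<in> space M. mdist m (l k v) (c i) \<le> \<kappa>/8})" for k n
    using cl by (intro closedin_Union) auto
  have "Y n = (\<Inter>k. \<Union>i<n. {v \<in> space M. mdist m (l k v) (c i) \<le> \<kappa>/8})" for n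
    by (auto simp: Y_def)
  moreover have "closedin T (\<Inter>k. \<Union>i<n. {v \<in> space M. mdist m (l k v) (c i) \<le> \<kappa>/8})" for n
    by (rule closedin_Inter) (use clU in auto)
  ultimately have Ycl: "closedin T (Y n)" for n by simp
  have YU: "(\<Union>n. Y n) = space M"
  proof (rule antisym)
    show "(\<Union>n. Y n) \<subseteq> space M" by (auto simp: Y_def)
    show "space M \<subseteq> (\<Union>n. Y n)"
    proof (rule ccontr)
      assume "\<not> ?thesis"
      then obtain v where v: "v \<in> space M" "\<And>n. v \<notin> Y n" by blast
      have "\<forall>n. \<exists>k. \<forall>i<n. mdist m (l k v) (c i) > \<kappa>/8"
        using v by (auto simp: Y_def not_le)
      then obtain k where k: "\<And>n i. i < n \<Longrightarrow> mdist m (l (k n) v) (c i) > \<kappa>/8" by metis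
      \<comment> \<open>The functions avoiding more and more centres at \<open>v\<close> still
        cluster at some \<open>p v\<close>. One centre \<open>c i\<close> is then within three steps
        of \<open>\<kappa>/32\<close>, hence within \<open>\<kappa>/8\<close>, of infinitely many of
        them, although the \<open>n\<close>-th one avoids every \<open>i < n\<close>.\<close>
      have "\<exists>p\<in>H. \<forall>E e. finite E \<and> E \<subseteq> space M \<and> e > 0 \<longrightarrow>
        infinite {n \<in> UNIV. \<forall>x\<in>E. mdist m (l (k n) x) (p x) < e}"
        by (rule pointwise_cluster[OF comp]) (use lH in auto)
      then obtain p where p: "p \<in> H" and "\<forall>E e. finite E \<and> E \<subseteq> space M \<and> e > 0 \<longrightarrow>
        infinite {n \<in> UNIV. \<forall>x\<in>E. mdist m (l (k n) x) (p x) < e}" by (elim bexE)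
      from this(2)[rule_format, of "{v}" "\<kappa>/32"] v(1) \<open>\<kappa> > 0\<close>
      have inf: "infinite {n. mdist m (l (k n) v) (p v) < \<kappa>/32}" by simp
      have pv: "p v \<in> mspace m" using compactin_subset_topspace[OF comp] p v(1) by auto
      obtain n1 where n1: "mdist m (l (k n1) v) (p v) < \<kappa>/32"
        using inf by (auto dest!: not_finite_existsD)
      obtain i where i: "mdist m (l (k n1) v) (c i) < \<kappa>/32" using net v(1) by blast
      obtain n where n: "n > i" "mdist m (l (k n) v) (p v) < \<kappa>/32"
        using inf unfolding infinite_nat_iff_unbounded by blast
      have "mdist m (l (k n) v) (c i) < 3 * \<kappa>/32"
        using mdist_triangle[OF sp[OF v(1), of "k n"] pv c[of i]] mdist_triangle[OF pv sp[OF v(1), of "k n1"] c[of i]]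
          mdist_commute[of m "p v" "l (k n1) v"] n1 i n by linarith
      then show False using k[OF n(1)] \<open>\<kappa> > 0\<close> by (simp add: field_simps)
    qed
  qed
  have "(\<lambda>n. measure M (Y n)) \<longlonglongrightarrow> measure M (\<Union>n. Y n)"
  proof (rule finite_Lim_measure_incseq)
    show "range Y \<subseteq> sets M" using Ycl meas by auto
    show "incseq Y" unfolding incseq_def Y_def by (blast intro: less_le_trans)
  qed
  then have "(\<lambda>n. measure M (Y n)) \<longlonglongrightarrow> 1" by (simp add: YU prob_space)
  then have "\<forall>\<^sub>F n in sequentially. measure M (Y n) > 1 - \<kappa>/4"
    using \<open>\<kappa> > 0\<close> by (intro order_tendstoD) auto
  then obtain n where n: "measure M (Y n) > 1 - \<kappa>/4"
    using eventually_happens by force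
  define A where "A k i = Y n \<inter> {v \<in> space M. mdist m (l k v) (c i) \<le> \<kappa>/8}" for k i
  have Acl: "closedin T (A k i)" for k i
    unfolding A_def using Ycl cl by (intro closedin_Int)
  have Am: "A k i \<in> sets M" for k i using meas Acl by blast
  have Ym: "Y n \<in> sets M" using meas Ycl by blast
  have cube: "compactin (pointwise_topology UNIV (mtopology_of euclidean_metric))
        (UNIV \<rightarrow>\<^sub>E {0..1::real} :: ('x set \<times> nat \<Rightarrow> real) set)"
    unfolding pointwise_topology_def by (simp add: compactin_PiE)
  \<comment> \<open>The first coordinate ranges over all sets, measurable or not:
    \<open>measure\<close> is total with values in the unit interval here, so the compact cube can
    be a plain power.\<close>
  define \<phi> where "\<phi> k = (\<lambda>(W, i). measure M (W \<inter> A k i))" for k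
  have "\<exists>u\<in>UNIV \<rightarrow>\<^sub>E {0..1::real}. \<forall>E e. finite E \<and> E \<subseteq> UNIV \<and> e > 0 \<longrightarrow>
     infinite {k \<in> UNIV. \<forall>x\<in>E. mdist euclidean_metric (\<phi> k x) (u x) < e}"
    by (rule pointwise_cluster[OF cube]) (auto simp: \<phi>_def)
  then obtain u where u01: "u \<in> UNIV \<rightarrow>\<^sub>E {0..1::real}" and "\<forall>E e. finite E \<and> E \<subseteq> UNIV \<and> e > 0 \<longrightarrow>
     infinite {k \<in> UNIV. \<forall>x\<in>E. mdist euclidean_metric (\<phi> k x) (u x) < e}"
    by (elim bexE)
  then have uinf: "infinite {k. \<forall>x\<in>E. \<bar>\<phi> k x - u x\<bar> < e}" if "finite E" "e > 0" for E e
    using that by (simp add: dist_real_def)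
  have uex: "\<exists>k. \<forall>x\<in>E. \<bar>\<phi> k x - u x\<bar> < e" if "finite E" "e > 0" for E e
    using uinf[OF that] by (auto dest!: not_finite_existsD)
  have u0: "0 \<le> u x" for x using u01 by (auto dest: PiE_mem[of u _ _ x])
  have ule: "u (W, i) \<le> measure M W" if "W \<in> sets M" for W i
  proof (rule field_le_epsilon)
    fix e :: real assume "e > 0"
    then obtain k where "\<forall>x\<in>{(W, i)}. \<bar>\<phi> k x - u x\<bar> < e" using uex[of "{(W,i)}" e] by auto
    moreover have "\<phi> k (W, i) \<le> measure M W"
      unfolding \<phi>_def using that by (auto intro: finite_measure_mono)
    ultimately show "u (W, i) \<le> measure M W + e" by auto
  qed
  have usub: "u (V \<union> W, i) \<le> u (V, i) + u (W, i)" if "V \<in> sets M" "W \<in> sets M" for V W i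
  proof (rule field_le_epsilon)
    fix e :: real assume "e > 0"
    then obtain k where k: "\<forall>x\<in>{(V \<union> W, i), (V, i), (W, i)}. \<bar>\<phi> k x - u x\<bar> < e/3"
      using uex[of "{(V \<union> W, i), (V, i), (W, i)}" "e/3"] by auto
    have "measure M ((V \<inter> A k i) \<union> (W \<inter> A k i)) \<le> measure M (V \<inter> A k i) + measure M (W \<inter> A k i)"
      using that Am by (intro measure_subadditive) auto
    then have "\<phi> k (V \<union> W, i) \<le> \<phi> k (V, i) + \<phi> k (W, i)"
      by (simp add: \<phi>_def Int_Un_distrib2)
    moreover have "\<bar>\<phi> k (V \<union> W, i) - u (V \<union> W, i)\<bar> < e/3" "\<bar>\<phi> k (V, i) - u (V, i)\<bar> < e/3"
        "\<bar>\<phi> k (W, i) - u (W, i)\<bar> < e/3" using k by auto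
    ultimately show "u (V \<union> W, i) \<le> u (V, i) + u (W, i) + e" by linarith
  qed
  have "\<exists>N\<in>sets M. u (N, i) = 0 \<and> (\<forall>W\<in>sets M. u (W, i) = 0 \<and> W \<inter> N = {} \<longrightarrow> measure M W = 0)" for i
    by (rule maximal_null_set[of M "\<lambda>W. u (W, i)"]) (use u0 ule usub finite_measure_axioms in auto)
  then obtain N where N: "\<And>i. N i \<in> sets M" "\<And>i. u (N i, i) = 0"
    and pos: "\<And>i W. W \<in> sets M \<Longrightarrow> u (W, i) = 0 \<Longrightarrow> W \<inter> N i = {} \<Longrightarrow> measure M W = 0"
    by metis
  define S where "S i = Y n - N i" for i
  have Sm: "S i \<in> sets M" for i using Ym N by (auto simp: S_def)
  \<comment> \<open>Otherwise take \<open>j < k\<close> with \<open>\<phi> j\<close> and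
    \<open>\<phi> k\<close> close to \<open>u\<close> at the pairs \<open>(N i, i)\<close>. The
    points where \<open>l j\<close> and \<open>l k\<close> differ by more than
    \<open>\<kappa>\<close> lie outside \<open>Y n\<close>, in one of the small sets
    \<open>N i \<inter> A j i\<close> or \<open>N i \<inter> A k i\<close>, or in the null set
    \<open>D\<close>: measure at most \<open>\<kappa>/2\<close>, against \<open>far\<close>.\<close>
  have "\<exists>i i'. mdist m (c i) (c i') > 3*\<kappa>/4 \<and> measure M (S i \<inter> S i') > 0"
  proof (rule ccontr)
    assume "\<not> ?thesis"
    then have null: "measure M (S i \<inter> S i') = 0" if "mdist m (c i) (c i') > 3*\<kappa>/4" for i i'
      using that measure_nonneg[of M "S i \<inter> S i'"] by (metis less_eq_real_def)
    \<comment> \<open>Chosen so that \<open>n\<close> such errors add up to at most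
      \<open>\<kappa>/8\<close>; the summand 1 excludes division by zero.\<close>
    define \<eta> where "\<eta> = \<kappa> / (8 * (real n + 1))"
    have \<eta>: "\<eta> > 0" using \<open>\<kappa> > 0\<close> by (simp add: \<eta>_def)
    have inf: "infinite {k. \<forall>x\<in>(\<lambda>i. (N i, i)) ` {..<n}. \<bar>\<phi> k x - u x\<bar> < \<eta>}"
      using \<eta> by (intro uinf) auto
    obtain j where j: "j \<in> {k. \<forall>x\<in>(\<lambda>i. (N i, i)) ` {..<n}. \<bar>\<phi> k x - u x\<bar> < \<eta>}"
      using inf not_finite_existsD by fastforce
    obtain k where k: "k > j" "k \<in> {k. \<forall>x\<in>(\<lambda>i. (N i, i)) ` {..<n}. \<bar>\<phi> k x - u x\<bar> < \<eta>}"
      using inf unfolding infinite_nat_iff_unbounded by blast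
    have small: "measure M (\<Union>i<n. N i \<inter> A q i) \<le> real n * \<eta>"
      if "q \<in> {k. \<forall>x\<in>(\<lambda>i. (N i, i)) ` {..<n}. \<bar>\<phi> k x - u x\<bar> < \<eta>}" for q
    proof -
      have "measure M (\<Union>i<n. N i \<inter> A q i) \<le> (\<Sum>i<n. measure M (N i \<inter> A q i))"
        using N Am by (intro finite_measure_subadditive_finite) auto
      also have "\<dots> \<le> (\<Sum>i<n. \<eta>)"
        using that N(2) by (intro sum_mono) (auto simp: \<phi>_def intro: less_imp_le)
      finally show ?thesis by simp
    qed
    define R where "R = {(i, i'). i < n \<and> i' < n \<and> mdist m (c i) (c i') > 3*\<kappa>/4}"
    have finR: "finite R"
      by (rule finite_subset[of _ "{..<n} \<times> {..<n}"]) (auto simp: R_def)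
    define D where "D = (\<Union>(i,i')\<in>R. S i \<inter> S i')"
    have Dm: "D \<in> sets M" unfolding D_def using finR Sm by (intro sets.finite_UN) auto
    have "measure M D \<le> (\<Sum>p\<in>R. measure M (case p of (i,i') \<Rightarrow> S i \<inter> S i'))"
      unfolding D_def using finR Sm by (intro finite_measure_subadditive_finite) auto
    also have "\<dots> = 0"
      using null by (intro sum.neutral) (auto simp: R_def)
    finally have D0: "measure M D \<le> 0" .
    have "{v \<in> space M. mdist m (l j v) (l k v) > \<kappa>} \<subseteq>
      (space M - Y n) \<union> ((\<Union>i<n. N i \<inter> A j i) \<union> ((\<Union>i<n. N i \<inter> A k i) \<union> D))"
    proof
      fix v assume "v \<in> {v \<in> space M. mdist m (l j v) (l k v) > \<kappa>}"
      then have v: "v \<in> space M" "mdist m (l j v) (l k v) > \<kappa>" by auto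
      show "v \<in> (space M - Y n) \<union> ((\<Union>i<n. N i \<inter> A j i) \<union> ((\<Union>i<n. N i \<inter> A k i) \<union> D))"
      proof (cases "v \<in> Y n")
        case True
        then obtain i i' where i: "i < n" "mdist m (l j v) (c i) \<le> \<kappa>/8" "i' < n" "mdist m (l k v) (c i') \<le> \<kappa>/8"
          unfolding Y_def by blast
        then have vA: "v \<in> A j i" "v \<in> A k i'" using True v by (auto simp: A_def)
        \<comment> \<open>The distance exceeds \<open>\<kappa>\<close> at the values and loses
          \<open>\<kappa>/8\<close> at either end.\<close>
        have "mdist m (c i) (c i') > 3*\<kappa>/4"
          using mdist_triangle[OF sp[OF v(1), of j] c[of i] sp[OF v(1), of k]]
            mdist_triangle[OF c[of i] c[of i'] sp[OF v(1), of k]] mdist_commute[of m "c i'" "l k v"] i v(2) by linarith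
        then have "(i, i') \<in> R" using i by (simp add: R_def)
        then have "v \<in> D" if "v \<notin> N i" "v \<notin> N i'" using that True by (force simp: D_def S_def)
        then show ?thesis using vA i by blast
      qed (use v in blast)
    qed
    then have "measure M {v \<in> space M. mdist m (l j v) (l k v) > \<kappa>} \<le>
      measure M ((space M - Y n) \<union> ((\<Union>i<n. N i \<inter> A j i) \<union> ((\<Union>i<n. N i \<inter> A k i) \<union> D)))"
      using Ym N Am Dm by (intro finite_measure_mono) auto
    also have "\<dots> \<le> measure M (space M - Y n) + (measure M (\<Union>i<n. N i \<inter> A j i) + (measure M (\<Union>i<n. N i \<inter> A k i) + measure M D))"
      using Ym N Am Dm
      by (intro order_trans[OF measure_Un_le] add_mono order_refl) auto
    also have "\<dots> \<le> \<kappa>/4 + (real n * \<eta> + (real n * \<eta> + 0))"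
      using n Ym small[OF j] small[OF k(2)] D0 by (intro add_mono) (auto simp: prob_compl)
    also have "\<dots> < \<kappa>"
    proof -
      have "real n * \<eta> \<le> \<kappa>/8"
        using \<open>\<kappa> > 0\<close> by (simp add: \<eta>_def field_simps)
      then show ?thesis using \<open>\<kappa> > 0\<close> by linarith
    qed
    finally show False using far[of j k] k(1) by simp
  qed
  then obtain i i' where ii: "mdist m (c i) (c i') > 3*\<kappa>/4" "measure M (S i \<inter> S i') > 0" by blast
  define W0 where "W0 = S i \<inter> S i'"
  have W0m: "W0 \<in> sets M" using Sm by (auto simp: W0_def)
  have upos: "u (W, i) > 0 \<and> u (W, i') > 0" if "W \<in> sets M" "W \<subseteq> W0" "measure M W > 0" for W
  proof -
    have "W \<inter> N i = {}" "W \<inter> N i' = {}" using that(2) by (auto simp: W0_def S_def)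
    then have "u (W, i) \<noteq> 0" "u (W, i') \<noteq> 0" using pos[of W i] pos[of W i'] that by auto
    then show ?thesis using u0[of "(W, i)"] u0[of "(W, i')"] by linarith
  qed
  define I where "I b = (if b then i else i')" for b
  \<comment> \<open>Points of \<open>W0\<close> that follow the pattern \<open>\<tau>\<close> under
    the first \<open>q\<close> chosen functions. The recursion keeps all these sets non-null, so
    that \<open>u\<close> is positive on them for both \<open>i\<close> and
    \<open>i'\<close>.\<close>
  define Wt where "Wt f \<tau> q = W0 \<inter> (\<Inter>j\<in>{..<q}. A (f j) (I (\<tau> j)))" for f :: "nat \<Rightarrow> nat" and \<tau> :: "nat \<Rightarrow> bool" and q
  have Wtm: "Wt f \<tau> q \<in> sets M" for f \<tau> q
  proof (cases "q = 0")
    case False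
    then have "(\<Inter>j\<in>{..<q}. A (f j) (I (\<tau> j))) \<in> sets M" using Am by (intro sets.finite_INT) auto
    then show ?thesis using W0m by (auto simp: Wt_def)
  qed (use W0m in \<open>simp add: Wt_def\<close>)
  have "\<exists>f. \<forall>q. \<forall>\<tau>. measure M (Wt f \<tau> q \<inter> A (f q) (I (\<tau> q))) > 0"
  proof (rule dependent_wellorder_choice)
    fix q r :: nat and f g :: "nat \<Rightarrow> nat" assume eq: "\<And>y. y < q \<Longrightarrow> f y = g y"
    then have "Wt f \<tau> q = Wt g \<tau> q" for \<tau> by (auto simp: Wt_def)
    then show "(\<forall>\<tau>. measure M (Wt f \<tau> q \<inter> A r (I (\<tau> q))) > 0) = (\<forall>\<tau>. measure M (Wt g \<tau> q \<inter> A r (I (\<tau> q))) > 0)"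
      by simp
  next
    fix q :: nat and f :: "nat \<Rightarrow> nat"
    assume IH: "\<And>y. y < q \<Longrightarrow> \<forall>\<tau>. measure M (Wt f \<tau> y \<inter> A (f y) (I (\<tau> y))) > 0"
    have p: "measure M (Wt f \<tau> q) > 0" for \<tau>
    proof (cases q)
      case 0
      then show ?thesis using ii by (simp add: Wt_def W0_def)
    next
      case (Suc y)
      have "Wt f \<tau> q = Wt f \<tau> y \<inter> A (f y) (I (\<tau> y))"
        unfolding Wt_def Suc by (auto simp: lessThan_Suc)
      then show ?thesis using IH[of y] Suc by simp
    qed
    \<comment> \<open>Only the first \<open>q\<close> values of \<open>\<tau>\<close> matter, so
      there are finitely many such sets and a single \<open>k\<close> can approximate
      \<open>u\<close> on all of them.\<close>
    define \<W> where "\<W> = (\<lambda>\<tau>. Wt f \<tau> q) ` UNIV"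
    have "\<W> \<subseteq> (\<lambda>X. W0 \<inter> (\<Inter>j\<in>{..<q}. A (f j) (I (j \<in> X)))) ` Pow {..<q}"
    proof
      fix W assume "W \<in> \<W>"
      then obtain \<tau> where "W = Wt f \<tau> q" by (auto simp: \<W>_def)
      then have "W = W0 \<inter> (\<Inter>j\<in>{..<q}. A (f j) (I (j \<in> {j. j < q \<and> \<tau> j})))"
        by (auto simp: Wt_def)
      then show "W \<in> (\<lambda>X. W0 \<inter> (\<Inter>j\<in>{..<q}. A (f j) (I (j \<in> X)))) ` Pow {..<q}" by blast
    qed
    then have fin: "finite \<W>" by (rule finite_subset) simp
    define E where "E = \<W> \<times> {i, i'}"
    have finE: "finite E" using fin by (simp add: E_def)
    have upE: "u x > 0" if "x \<in> E" for x
      using that p upos[OF Wtm] by (auto simp: E_def \<W>_def) (auto simp: Wt_def)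
    \<comment> \<open>An error below the least value of \<open>u\<close> on \<open>E\<close> leaves
      \<open>\<phi> k\<close> positive there; inserting 1 spares a nonemptiness argument.\<close>
    define e where "e = Min (insert 1 (u ` E))"
    have "e > 0" unfolding e_def using finE upE by (subst Min_gr_iff) auto
    then obtain k where k: "\<forall>x\<in>E. \<bar>\<phi> k x - u x\<bar> < e" using uex[OF finE] by blast
    have "measure M (Wt f \<tau> q \<inter> A k (I (\<tau> q))) > 0" for \<tau>
    proof -
      have x: "(Wt f \<tau> q, I (\<tau> q)) \<in> E" by (simp add: E_def \<W>_def I_def)
      then have "e \<le> u (Wt f \<tau> q, I (\<tau> q))" unfolding e_def using finE by (intro Min_le) auto
      moreover have "\<bar>\<phi> k (Wt f \<tau> q, I (\<tau> q)) - u (Wt f \<tau> q, I (\<tau> q))\<bar> < e" using k x by blast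
      ultimately have "\<phi> k (Wt f \<tau> q, I (\<tau> q)) > 0" by linarith
      then show ?thesis by (simp add: \<phi>_def)
    qed
    then show "\<exists>r. \<forall>\<tau>. measure M (Wt f \<tau> q \<inter> A r (I (\<tau> q))) > 0" by blast
  qed
  then obtain f where f: "\<And>q \<tau>. measure M (Wt f \<tau> q \<inter> A (f q) (I (\<tau> q))) > 0" by blast
  have "\<exists>z\<in>space M. \<forall>j. mdist m (l (f j) z) (if \<tau> j then c i else c i') \<le> \<kappa>/8" for \<tau>
  proof -
    \<comment> \<open>The finite stages are non-null, hence nonempty. As the sets
      \<open>A k i\<close> are closed, compactness provides one point that realises the whole
      pattern.\<close>
    define C where "C q = (\<Inter>j\<in>{..q}. A (f j) (I (\<tau> j)))" for q
    have "(\<Inter>q. C q) \<noteq> {}"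
    proof (rule compact_space_imp_nest[OF T(1)])
      show "closedin T (C q)" for q unfolding C_def using Acl by (intro closedin_Inter) auto
      show "C q \<noteq> {}" for q
      proof
        assume "C q = {}"
        moreover have "Wt f \<tau> q \<inter> A (f q) (I (\<tau> q)) \<subseteq> C q"
          unfolding Wt_def C_def by (auto simp: le_less)
        ultimately have "Wt f \<tau> q \<inter> A (f q) (I (\<tau> q)) = {}" by blast
        then show False using f[of \<tau> q] by simp
      qed
      show "decseq C" by (auto simp: decseq_def C_def)
    qed
    then obtain z where z: "\<And>q. z \<in> C q" by blast
    have "z \<in> A (f j) (I (\<tau> j))" for j using z[of j] by (auto simp: C_def)
    then have "z \<in> space M \<and> mdist m (l (f j) z) (c (I (\<tau> j))) \<le> \<kappa>/8" for j by (auto simp: A_def)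
    then show ?thesis by (intro bexI[of _ z]) (auto simp: I_def if_distrib split: if_splits)
  qed
  moreover have "2 * (\<kappa>/8) < mdist m (c i) (c i')" using ii(1) \<open>\<kappa> > 0\<close> by linarith
  ultimately show ?thesis using c by blast
qed

section \<open>The Cantor space with the fair coin measure\<close>

lemma compact_space_Cantor: "compact_space (euclidean :: (nat \<Rightarrow> bool) topology)"
proof -
  have "compact_space (euclidean :: bool topology)"
    by (simp add: compact_space_def finite_imp_compact)
  then have "compact_space (product_topology (\<lambda>_::nat. euclidean :: bool topology) UNIV)"
    by (simp add: compact_space_product_topology)
  then show ?thesis by (simp add: euclidean_product_topology)
qed

text \<open>With this instance the product sigma-algebra on \<open>nat \<Rightarrow> bool\<close>
  can be identified with the Borel sets of the product topology.\<close>

instance bool :: second_countable_topology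
proof
  show "\<exists>B :: bool set set. countable B \<and> open = generate_topology B"
    by (intro exI[of _ UNIV]) (auto simp: fun_eq_iff open_discrete intro: generate_topology.Basis)
qed

lemma coin_measure_exists:
  "\<exists>M :: (nat \<Rightarrow> bool) measure. prob_space M \<and> sets M = sets borel \<and> (\<forall>z. measure M {z} = 0)"
proof -
  define p where "p = uniform_count_measure (UNIV :: bool set)"
  have "prob_space p" unfolding p_def by (intro prob_space_uniform_count_measure) auto
  then interpret p: prob_space p .
  interpret sequence_space p by unfold_locales
  have sp: "sets p = sets borel"
    by (auto simp: p_def sets_uniform_count_measure intro!: borel_open open_discrete)
  have "sets (PiM UNIV (\<lambda>_::nat. p)) = sets (PiM UNIV (\<lambda>_::nat. borel :: bool measure))"
    using sp by (intro sets_PiM_cong) auto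
  then have 1: "sets (PiM UNIV (\<lambda>_::nat. p)) = sets borel"
    by (simp add: sets_PiM_equal_borel)
  have "measure (PiM UNIV (\<lambda>_::nat. p)) {z} = 0" for z
  proof -
    have pz: "measure p {b} = 1/2" for b
      unfolding p_def by (subst measure_uniform_count_measure) auto
    have "(\<lambda>n. \<Prod>i\<le>n. measure p {z i}) \<longlonglongrightarrow> measure (PiM UNIV (\<lambda>_::nat. p)) (Pi UNIV (\<lambda>i. {z i}))"
      by (rule measure_PiM_countable) (simp add: p_def sets_uniform_count_measure)
    moreover have "(\<lambda>n. \<Prod>i\<le>n. measure p {z i}) = (\<lambda>n. (1/2)^Suc n)"
      by (simp add: pz)
    moreover have "(\<lambda>n. (1/2)^Suc n) \<longlonglongrightarrow> (0::real)"
      by (intro LIMSEQ_Suc LIMSEQ_power_zero) auto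
    moreover have "Pi UNIV (\<lambda>i. {z i}) = {z}" by (auto simp: fun_eq_iff)
    ultimately show ?thesis using LIMSEQ_unique by metis
  qed
  then show ?thesis
    using 1 P.prob_space_axioms by blast
qed

text \<open>Total boundedness in measure is the dividing line. If it fails, a greedy choice gives a
  sequence separated in measure. If it holds, finite nets in measure become uniform nets on the sets
  \<open>Zn n\<close>, and \<open>sep\<close> then makes these sets finite.\<close>

theorem Cantor_separated_imp_not_Lindelof:
  fixes l :: "nat \<Rightarrow> (nat \<Rightarrow> bool) \<Rightarrow> 'b" and m :: "'b metric"
  assumes cont: "\<And>k. continuous_map euclidean (mtopology_of m) (l k)"
    and comp: "compactin (pointwise_topology UNIV (mtopology_of m)) H"
    and lH: "\<And>k. l k \<in> H"
    and Lind: "Lindelof_space (weak_topology UNIV (mtopology_of m) H)"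
    and "e > 0" and sep: "\<And>u v. u \<noteq> v \<Longrightarrow> \<exists>k. mdist m (l k u) (l k v) \<ge> e"
  shows False
proof -
  obtain M :: "(nat \<Rightarrow> bool) measure" where "prob_space M" and sM: "sets M = sets borel"
    and atom: "\<And>z. measure M {z} = 0" using coin_measure_exists by blast
  interpret prob_space M by fact
  have spM: "space M = UNIV" using sets_eq_imp_space_eq[OF sM] by simp
  let ?W = "weak_topology UNIV (mtopology_of m) H"
  let ?T = "euclidean :: (nat \<Rightarrow> bool) topology"
  let ?far = "\<lambda>l l' r. {v. mdist m (l v) (l' v) > r}"
  have cT: "compact_space ?T" by (rule compact_space_Cantor)
  have Hsub: "h x \<in> mspace m" if "h \<in> H" for h x
    using compactin_subset_topspace[OF comp] that by auto
  have farm: "?far (l j) (l k) r \<in> sets M" for j k r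
    using openin_mdist_greater[OF cont cont, of r j k] by (simp add: sM)
  have closedm: "C \<in> sets M" if "closedin ?T C" for C using that by (simp add: sM)
  have tot: "\<exists>E. finite E \<and> (\<forall>k. \<exists>j\<in>E. measure M (?far (l k) (l j) \<kappa>) < \<kappa>)" if "\<kappa> > 0" for \<kappa>
  proof (rule ccontr)
    assume no: "\<not> ?thesis"
    \<comment> \<open>Greedy choice: no finite set of earlier functions is a net, so a next one is
      far in measure from all of them.\<close>
    have "\<exists>f::nat \<Rightarrow> nat. \<forall>q. \<forall>j<q. \<not> measure M (?far (l (f q)) (l (f j)) \<kappa>) < \<kappa>"
    proof (rule dependent_wellorder_choice[where P = "\<lambda>f q r. \<forall>j<q. \<not> measure M (?far (l r) (l (f j)) \<kappa>) < \<kappa>"])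
      fix q :: nat and f :: "nat \<Rightarrow> nat"
      have "finite (f ` {..<q})" by simp
      then have "\<not> (\<forall>k. \<exists>j\<in>f ` {..<q}. measure M (?far (l k) (l j) \<kappa>) < \<kappa>)"
        using no[unfolded not_ex, THEN spec, of "f ` {..<q}"] by simp
      then show "\<exists>r. \<forall>j<q. \<not> measure M (?far (l r) (l (f j)) \<kappa>) < \<kappa>" by auto
    qed auto
    then obtain f :: "nat \<Rightarrow> nat" where f0: "\<forall>q. \<forall>j<q. \<not> measure M (?far (l (f q)) (l (f j)) \<kappa>) < \<kappa>"
      by (elim exE)
    then have f: "measure M (?far (l (f q)) (l (f j)) \<kappa>) \<ge> \<kappa>" if "j < q" for q j
      using that by (simp add: not_less)
    have far: "measure M {v \<in> space M. mdist m (l (f j) v) (l (f k) v) > \<kappa>} \<ge> \<kappa>" if "j \<noteq> k" for j k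
    proof -
      have eq: "?far (l (f j)) (l (f k)) \<kappa> = ?far (l (f k)) (l (f j)) \<kappa>" by (simp only: mdist_commute)
      consider "j < k" | "k < j" using \<open>j \<noteq> k\<close> by linarith
      then show ?thesis using f[of j k] f[of k j] eq by cases (simp_all add: spM)
    qed
    have "\<exists>a\<in>mspace m. \<exists>b\<in>mspace m. \<exists>r g. 2 * r < mdist m a b \<and>
      (\<forall>\<tau>::nat \<Rightarrow> bool. \<exists>z\<in>space M. \<forall>j. mdist m (l (f (g j)) z) (if \<tau> j then a else b) \<le> r)"
      by (rule separated_in_measure_imp_independent[where T = ?T and H = H and \<kappa> = \<kappa> and l = "\<lambda>j. l (f j)"])
        (use \<open>prob_space M\<close> cT spM closedm cont comp lH that far in auto)
    then obtain a b r g where ab: "a \<in> mspace m" "b \<in> mspace m" "2 * r < mdist m a b"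
      and pat: "\<And>\<tau>::nat \<Rightarrow> bool. \<exists>z. \<forall>j. mdist m (l (f (g j)) z) (if \<tau> j then a else b) \<le> r"
      by (auto simp: spM)
    show False
    proof (rule independent_imp_not_Lindelof[OF Lind comp _ ab])
      show "l (f (g (to_nat s))) \<in> H" for s :: "bool list" by (rule lH)
      show "\<exists>z\<in>UNIV. \<forall>s. mdist m (l (f (g (to_nat s))) z) (if \<tau> s then a else b) \<le> r" for \<tau> :: "bool list \<Rightarrow> bool"
      proof -
        obtain z where z: "\<And>j. mdist m (l (f (g j)) z) (if \<tau> (from_nat j) then a else b) \<le> r"
          using pat[of "\<lambda>j. \<tau> (from_nat j)"] by blast
        have "mdist m (l (f (g (to_nat s))) z) (if \<tau> s then a else b) \<le> r" for s
          using z[of "to_nat s"] by simp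
        then show ?thesis by blast
      qed
    qed
  qed
  \<comment> \<open>Weakly open sets need not be Borel, so being non-null means not being contained
    in any measurable null set.\<close>
  define Z where "Z = {u. \<forall>V N. openin ?W V \<longrightarrow> u \<in> V \<longrightarrow> V \<subseteq> N \<longrightarrow> N \<notin> null_sets M}"
  define Zn where "Zn n = {u. \<forall>j k. measure M (?far (l j) (l k) ((1/2)^n)) < (1/2)^n \<longrightarrow>
      mdist m (l j u) (l k u) < e/3}" for n :: nat
  have "Z \<subseteq> (\<Union>n. Zn n)"
  proof
    fix u assume u: "u \<in> Z"
    have "\<exists>n. \<forall>l1\<in>range l. \<forall>l2\<in>range l. measure M {v \<in> space M. mdist m (l1 v) (l2 v) > (1/2)^n} < (1/2)^n \<longrightarrow>
            mdist m (l1 u) (l2 u) < e/3"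
      by (rule uniform_at_point[where H = H])
        (use \<open>prob_space M\<close> comp lH farm u \<open>e > 0\<close> in \<open>auto simp: spM Z_def\<close>)
    then show "u \<in> (\<Union>n. Zn n)" by (auto simp: spM Zn_def)
  qed
  moreover have "finite (Zn n)" for n
  proof -
    obtain E where E: "finite E" "\<And>k. \<exists>j\<in>E. measure M (?far (l k) (l j) ((1/2)^n)) < (1/2)^n"
      using tot[of "(1/2)^n"] by auto
    \<comment> \<open>By definition of \<open>Zn n\<close>, closeness in measure implies closeness
      within \<open>e/3\<close> at all its points. The factor 3 restores \<open>e\<close>, and a set
      on which all \<open>l k\<close> oscillate by less than \<open>e\<close> has at most one
      point.\<close>
    have "\<exists>\<V>. finite \<V> \<and> Zn n \<subseteq> \<Union>\<V> \<and> (\<forall>V\<in>\<V>. \<forall>h\<in>range l. \<forall>x\<in>V. \<forall>y\<in>V. mdist m (h x) (h y) < 3 * (e/3))"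
    proof (rule finite_cover_small[OF cT, of "l ` E"])
      show "\<exists>l'\<in>l ` E. \<forall>x\<in>Zn n. mdist m (h x) (l' x) < e/3" if h: "h \<in> range l" for h
      proof -
        obtain k where k: "h = l k" using h by blast
        obtain j where "j \<in> E" "measure M (?far (l k) (l j) ((1/2)^n)) < (1/2)^n" using E(2) by blast
        then show ?thesis unfolding k by (intro bexI[of _ "l j"]) (auto simp: Zn_def)
      qed
    qed (use E(1) cont \<open>e > 0\<close> lH Hsub in auto)
    then obtain \<V> where \<V>: "finite \<V>" "Zn n \<subseteq> \<Union>\<V>"
      and sm: "\<And>V k x y. V \<in> \<V> \<Longrightarrow> x \<in> V \<Longrightarrow> y \<in> V \<Longrightarrow> mdist m (l k x) (l k y) < e"
      by auto
    have "finite V" if "V \<in> \<V>" for V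
    proof (rule ccontr)
      assume inf: "infinite V"
      then obtain x where x: "x \<in> V" by fastforce
      have "infinite (V - {x})" using inf by simp
      then have "V - {x} \<noteq> {}" by (metis finite.emptyI)
      then obtain y where y: "y \<in> V" "x \<noteq> y" by blast
      obtain k where "mdist m (l k x) (l k y) \<ge> e" using sep y(2) by blast
      then show False using sm[OF that x y(1), of k] by linarith
    qed
    then show ?thesis using \<V> finite_subset by blast
  qed
  ultimately have cZ: "countable Z"
    by (meson countable_UN countable_finite countable_subset countableI_type)
  show False
  proof (rule Lindelof_cover_measure[OF Lind _ \<open>prob_space M\<close> cZ])
    fix z :: "nat \<Rightarrow> bool" and \<delta> :: real assume "\<delta> > 0"
    \<comment> \<open>Growing finite sets of functions and shrinking radii make these sets decrease
      to \<open>{z}\<close>, which is null; so their measures tend to 0.\<close>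
    define B where "B n = (\<Inter>k\<in>{..<n}. {w. mdist m (l k w) (l k z) < inverse (real (Suc n))})" for n
    have zB: "z \<in> B n" for n using Hsub[OF lH] by (auto simp: B_def)
    \<comment> \<open>Stated for any topology in which the \<open>l k\<close> are continuous: the
      product topology gives measurability, the weak one the open neighbourhood.\<close>
    have Bop: "openin T (B n)" if "topspace T = UNIV" "\<And>k. continuous_map T (mtopology_of m) (l k)" for T n
    proof -
      have "openin T {w. mdist m (l k w) (l k z) < inverse (real (Suc n))}" for k
        using openin_mdist_less[OF that(2)[of k], of "\<lambda>_. l k z" "inverse (real (Suc n))"] that(1) Hsub[OF lH] by simp
      then have "openin T (topspace T \<inter> \<Inter>((\<lambda>k. {w. mdist m (l k w) (l k z) < inverse (real (Suc n))}) ` {..<n}))"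
        by (intro openin_Int_Inter) auto
      then show ?thesis by (simp add: B_def that(1))
    qed
    have Bm: "B n \<in> sets M" for n
      using Bop[of ?T n] cont by (simp add: sM)
    have "(\<Inter>n. B n) = {z}"
    proof -
      have "w = z" if w: "\<And>n. w \<in> B n" for w
      proof (rule ccontr)
        assume "w \<noteq> z"
        then obtain k where k: "mdist m (l k w) (l k z) \<ge> e" using sep by blast
        obtain n where n: "inverse (real (Suc n)) < e" using reals_Archimedean \<open>e > 0\<close> by blast
        have "mdist m (l k w) (l k z) < inverse (real (Suc (max (Suc k) n)))"
          using w[of "max (Suc k) n"] by (auto simp: B_def)
        also have "\<dots> \<le> inverse (real (Suc n))" by (intro le_imp_inverse_le) auto
        finally show False using k n by linarith
      qed
      then show ?thesis using zB by blast
    qed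
    moreover have "decseq B"
    proof (rule decseq_SucI)
      fix n
      have "inverse (real (Suc (Suc n))) \<le> inverse (real (Suc n))" by (intro le_imp_inverse_le) auto
      then show "B (Suc n) \<subseteq> B n" unfolding B_def by (auto simp: lessThan_Suc intro: less_le_trans)
    qed
    ultimately have "(\<lambda>n. measure M (B n)) \<longlonglongrightarrow> 0"
      using finite_Lim_measure_decseq[of B] Bm atom by (metis image_subsetI)
    then obtain n where n: "measure M (B n) < \<delta>"
      using order_tendstoD(2)[OF _ \<open>\<delta> > 0\<close>] eventually_happens by (metis trivial_limit_sequentially)
    have "openin ?W (B n)"
      using Hsub lH by (intro Bop continuous_map_weak_topology) auto
    then show "\<exists>V N. openin ?W V \<and> z \<in> V \<and> V \<subseteq> N \<and> N \<in> sets M \<and> measure M N < \<delta>"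
      using zB Bm n by blast
  next
    fix u assume "u \<notin> Z"
    then show "\<exists>V N. openin ?W V \<and> u \<in> V \<and> V \<subseteq> N \<and> N \<in> null_sets M"
      unfolding Z_def by blast
  qed (auto simp: spM)
qed

subsection \<open>Separability of the supremum pseudometric\<close>

lemma mdiameter_less_imp:
  assumes "mdiameter m S < ennreal e" "x \<in> S" "y \<in> S"
  shows "mdist m x y < e"
proof -
  have "ennreal (mdist m x y) \<le> mdiameter m S"
    unfolding mdiameter_def using assms(2,3) by (intro SUP_upper2[of "(x, y)"]) auto
  then have "ennreal (mdist m x y) < ennreal e"
    using assms(1) by (rule le_less_trans)
  then show ?thesis
    by (simp add: ennreal_less_iff)
qed

lemma mdiameter_less:
  assumes "\<And>x y. x \<in> S \<Longrightarrow> y \<in> S \<Longrightarrow> mdist m x y \<le> d" "0 < e" "d < e"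
  shows "mdiameter m S < ennreal e"
proof -
  have "mdiameter m S \<le> ennreal (max 0 d)"
    unfolding mdiameter_def using assms(1) by (intro SUP_least) (auto intro!: ennreal_leI simp: max.coboundedI2)
  also have "\<dots> < ennreal e"
    using assms by (intro ennreal_lessI) auto
  finally show ?thesis .
qed

section \<open>Hereditary almost equicontinuity and fragmentation\<close>

lemma restrict_functions_restrict:
  "A \<subseteq> F \<Longrightarrow> restrict_functions (restrict_functions L F) A = restrict_functions L A"
  by (auto simp: restrict_functions_def image_image Int_absorb1 Int_absorb2 restrict_restrict)

lemma equicontinuity_point_mono:
  assumes "equicontinuity_point T m G x" "L \<subseteq> G"
  shows "equicontinuity_point T m L x"
  unfolding equicontinuity_point_def
proof (intro conjI allI impI)
  show "x \<in> topspace T"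
    using assms(1)[unfolded equicontinuity_point_def] by (rule conjunct1)
  fix e :: real assume "e > 0"
  from assms(1)[unfolded equicontinuity_point_def, THEN conjunct2, rule_format, OF this]
  obtain U where "openin T U \<and> x \<in> U \<and> (\<forall>g\<in>G. mdiameter m (g ` U) < ennreal e)" ..
  then show "\<exists>U. openin T U \<and> x \<in> U \<and> (\<forall>g\<in>L. mdiameter m (g ` U) < ennreal e)"
    using assms(2) by (intro exI[of _ U]) auto
qed

lemma hereditarily_almost_equicontinuous_restrict:
  assumes "hereditarily_almost_equicontinuous X m G" "closedin X F" "L \<subseteq> G"
  shows "hereditarily_almost_equicontinuous (subtopology X F) m (restrict_functions L F)"
  unfolding hereditarily_almost_equicontinuous_def
proof (intro allI impI)
  fix A assume A: "closedin (subtopology X F) A \<and> A \<noteq> {}"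
  have AF: "A \<subseteq> F" "closedin X A"
    using A assms(2) closedin_closed_subtopology by blast+
  let ?T = "subtopology X A"
  have eq: "subtopology (subtopology X F) A = ?T"
    using AF(1) by (simp add: subtopology_subtopology Int_absorb1)
  have sub: "{x. equicontinuity_point ?T m (restrict_functions G A) x} \<subseteq>
        {x. equicontinuity_point ?T m (restrict_functions L A) x}"
  proof -
    have "restrict_functions L A \<subseteq> restrict_functions G A"
      using assms(3) unfolding restrict_functions_def by (rule image_mono)
    then show ?thesis
      using equicontinuity_point_mono by (intro Collect_mono impI)
  qed
  have "?T closure_of {x. equicontinuity_point ?T m (restrict_functions G A) x} = topspace ?T"
    using assms(1) AF(2) A unfolding hereditarily_almost_equicontinuous_def almost_equicontinuous_def by blast
  then have "?T closure_of {x. equicontinuity_point ?T m (restrict_functions L A) x} = topspace ?T"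
    using closure_of_mono[OF sub, of ?T] closure_of_subset_topspace[of ?T] by (metis subset_antisym)
  then show "almost_equicontinuous (subtopology (subtopology X F) A) m (restrict_functions (restrict_functions L F) A)"
    unfolding eq restrict_functions_restrict[OF AF(1)] almost_equicontinuous_def .
qed

text \<open>This is fragmentation by the supremum pseudometric: a dense set of equicontinuity points
  in a nonempty space contains at least one point, and a neighbourhood of it is the required
  piece.\<close>

lemma hereditarily_almost_equicontinuous_small:
  assumes "hereditarily_almost_equicontinuous T m L" "closedin T A" "A \<noteq> {}" "e > 0"
  shows "\<exists>W. openin T W \<and> W \<inter> A \<noteq> {} \<and> (\<forall>l\<in>L. \<forall>x\<in>W \<inter> A. \<forall>y\<in>W \<inter> A. mdist m (l x) (l y) < e)"
proof -
  let ?T = "subtopology T A"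
  have top: "topspace ?T = A"
    using closedin_subset[OF assms(2)] by auto
  have "almost_equicontinuous ?T m (restrict_functions L A)"
    using assms(1-3) unfolding hereditarily_almost_equicontinuous_def by simp
  then have "?T closure_of {x. equicontinuity_point ?T m (restrict_functions L A) x} = A"
    unfolding almost_equicontinuous_def by (simp only: top)
  then have "{x. equicontinuity_point ?T m (restrict_functions L A) x} \<noteq> {}"
    using assms(3) by (metis closure_of_empty)
  then obtain x where x: "equicontinuity_point ?T m (restrict_functions L A) x"
    by blast
  from x[unfolded equicontinuity_point_def, THEN conjunct2, rule_format, OF assms(4)]
  obtain U where U': "openin ?T U \<and> x \<in> U \<and> (\<forall>g\<in>restrict_functions L A. mdiameter m (g ` U) < ennreal e)" ..
  then have U: "openin ?T U" "x \<in> U"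
    and d: "\<And>g. g \<in> restrict_functions L A \<Longrightarrow> mdiameter m (g ` U) < ennreal e"
    by simp_all
  obtain W where W: "openin T W" "U = W \<inter> A"
    using U(1) by (auto simp: openin_subtopology)
  have "mdist m (l x) (l y) < e" if "l \<in> L" "x \<in> U" "y \<in> U" for l x y
  proof -
    have "mdiameter m (restrict l A ` U) < ennreal e"
      using that(1) by (intro d) (auto simp: restrict_functions_def)
    then have "mdist m (restrict l A x) (restrict l A y) < e"
      by (rule mdiameter_less_imp) (use that in auto)
    then show ?thesis using that W by simp
  qed
  then show ?thesis using W U by blast
qed

text \<open>Separability for the supremum pseudometric, phrased through covers so that no supremum,
  possibly infinite, has to be formed. Members of the cover may leave \<open>S\<close>; where values
  outside \<open>S\<close> are not controlled they are cut down to \<open>S\<close>.\<close>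

definition countably_small :: "'b metric \<Rightarrow> ('x \<Rightarrow> 'b) set \<Rightarrow> 'x set \<Rightarrow> bool" where
  "countably_small m L S \<longleftrightarrow> (\<forall>e>0. \<exists>\<V>. countable \<V> \<and> S \<subseteq> \<Union>\<V> \<and>
     (\<forall>V\<in>\<V>. \<forall>l\<in>L. \<forall>x\<in>V. \<forall>y\<in>V. mdist m (l x) (l y) < e))"

lemma countably_smallD:
  assumes "countably_small m L S" "e > 0"
  obtains \<V> where "countable \<V>" "S \<subseteq> \<Union>\<V>" 
    "\<And>V l x y. V \<in> \<V> \<Longrightarrow> l \<in> L \<Longrightarrow> x \<in> V \<Longrightarrow> y \<in> V \<Longrightarrow> mdist m (l x) (l y) < e"
  using assms unfolding countably_small_def by meson

lemma countably_small_cong: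
  assumes "countably_small m L S" and "\<And>k. k \<in> K \<Longrightarrow> \<exists>l\<in>L. \<forall>x\<in>S. l x = k x"
  shows "countably_small m K S"
  unfolding countably_small_def
proof (intro allI impI)
  fix e :: real assume "e > 0"
  then obtain \<V> where \<V>: "countable \<V>" "S \<subseteq> \<Union>\<V>"
    "\<And>V l x y. V \<in> \<V> \<Longrightarrow> l \<in> L \<Longrightarrow> x \<in> V \<Longrightarrow> y \<in> V \<Longrightarrow> mdist m (l x) (l y) < e"
    using assms(1) countably_smallD by metis
  have "mdist m (k x) (k y) < e" if V: "V \<in> \<V>" and k: "k \<in> K" and xy: "x \<in> V \<inter> S" "y \<in> V \<inter> S" for V k x y
  proof -
    obtain l where l: "l \<in> L" "\<forall>x\<in>S. l x = k x" using assms(2)[OF k] by blast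
    then show ?thesis using \<V>(3)[OF V l(1), of x y] xy by simp
  qed
  then show "\<exists>\<V>. countable \<V> \<and> S \<subseteq> \<Union>\<V> \<and> (\<forall>V\<in>\<V>. \<forall>l\<in>K. \<forall>x\<in>V. \<forall>y\<in>V. mdist m (l x) (l y) < e)"
    using \<V>(1,2) by (intro exI[of _ "(\<lambda>V. V \<inter> S) ` \<V>"]) auto
qed

lemma countably_small_restrict_functions:
  "countably_small m (restrict_functions L S) S \<longleftrightarrow> countably_small m L S"
proof
  assume "countably_small m (restrict_functions L S) S"
  then show "countably_small m L S"
    by (rule countably_small_cong) (auto simp: restrict_functions_def)
next
  assume "countably_small m L S"
  then show "countably_small m (restrict_functions L S) S"
    by (rule countably_small_cong) (auto simp: restrict_functions_def)
qed

text \<open>Oscillation involves two points at a time, so pointwise approximation at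
  \<open>{x, y}\<close> carries the bound over; the three terms \<open>e/3\<close> keep the
  inequality strict.\<close>

lemma countably_small_closure:
  assumes "countably_small m L S" "S \<subseteq> X" and L: "\<And>l x. l \<in> L \<Longrightarrow> x \<in> X \<Longrightarrow> l x \<in> mspace m"
  shows "countably_small m (pointwise_closure X (mtopology_of m) L) S"
  unfolding countably_small_def
proof (intro allI impI)
  fix e :: real assume "e > 0"
  then have "e/3 > 0" by simp
  then obtain \<V> where \<V>: "countable \<V>" "S \<subseteq> \<Union>\<V>"
    "\<And>V l x y. V \<in> \<V> \<Longrightarrow> l \<in> L \<Longrightarrow> x \<in> V \<Longrightarrow> y \<in> V \<Longrightarrow> mdist m (l x) (l y) < e/3"
    using assms(1) countably_smallD by metis
  have "mdist m (h x) (h y) < e"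
    if h: "h \<in> pointwise_closure X (mtopology_of m) L" and V: "V \<in> \<V>" "x \<in> V \<inter> S" "y \<in> V \<inter> S" for V h x y
  proof -
    have xy: "x \<in> X" "y \<in> X" using V assms(2) by auto
    obtain l where l: "l \<in> L" "mdist m (l x) (h x) < e/3" "mdist m (l y) (h y) < e/3"
      using pointwise_closure_approx[OF h, of "{x, y}" "e/3"] xy \<open>e/3 > 0\<close> by auto
    have hs: "h x \<in> mspace m" "h y \<in> mspace m"
      using h xy by (auto simp: pointwise_closure_def in_closure_of)
    have "mdist m (l x) (l y) < e/3" using \<V>(3) V l(1) by auto
    then show ?thesis
      using mdist_triangle[OF hs(1) L[OF l(1) xy(1)] hs(2)] mdist_triangle[OF L[OF l(1) xy(1)] L[OF l(1) xy(2)] hs(2)]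
        mdist_commute[of m "h x" "l x"] l by linarith
  qed
  then show "\<exists>\<V>. countable \<V> \<and> S \<subseteq> \<Union>\<V> \<and>
      (\<forall>V\<in>\<V>. \<forall>l\<in>pointwise_closure X (mtopology_of m) L. \<forall>x\<in>V. \<forall>y\<in>V. mdist m (l x) (l y) < e)"
    using \<V>(1,2) by (intro exI[of _ "(\<lambda>V. V \<inter> S) ` \<V>"]) auto
qed

text \<open>Weakly open sets are open for the supremum pseudometric: a subbasic set constrains one
  function near one value, and finite intersections and unions preserve the property.\<close>

lemma weak_topology_uniform_nbhd:
  assumes "openin (weak_topology S (mtopology_of m) H) U" "x \<in> U"
    and H: "\<And>h x. h \<in> H \<Longrightarrow> x \<in> S \<Longrightarrow> h x \<in> mspace m"
  shows "\<exists>e>0. \<forall>y\<in>S. (\<forall>h\<in>H. mdist m (h x) (h y) < e) \<longrightarrow> y \<in> U"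
proof -
  have "generate_topology_on (insert S {h -` U \<inter> S |h U. h \<in> H \<and> openin (mtopology_of m) U}) U"
    using assms(1) unfolding weak_topology_def by (rule openin_topology_generated_by)
  then show ?thesis using \<open>x \<in> U\<close>
  proof (induction arbitrary: x)
    case (Int a b)
    obtain e1 e2 where e: "e1 > 0" "\<forall>y\<in>S. (\<forall>h\<in>H. mdist m (h x) (h y) < e1) \<longrightarrow> y \<in> a"
      "e2 > 0" "\<forall>y\<in>S. (\<forall>h\<in>H. mdist m (h x) (h y) < e2) \<longrightarrow> y \<in> b"
      using Int.IH(1)[of x] Int.IH(2)[of x] Int.prems by auto
    show ?case
      by (rule exI[of _ "min e1 e2"]) (use e in auto)
  next
    case (UN K)
    then obtain k where k: "k \<in> K" "x \<in> k" by blast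
    obtain e where "e > 0" "\<forall>y\<in>S. (\<forall>h\<in>H. mdist m (h x) (h y) < e) \<longrightarrow> y \<in> k"
      using UN.IH[OF k] by blast
    then show ?case using k by blast
  next
    case (Basis s)
    then consider "s = S" | h V where "h \<in> H" "openin (mtopology_of m) V" "s = h -` V \<inter> S" by blast
    then show ?case
    proof cases
      case 1
      then show ?thesis by (intro exI[of _ 1]) auto
    next
      case 2
      then have hx: "h x \<in> V" using Basis by blast
      have "\<exists>r>0. Metric_space.mball (mspace m) (mdist m) (h x) r \<subseteq> V"
        using 2(2) hx Metric_space.openin_mtopology[OF Metric_space_mspace_mdist, of m V]
        unfolding mtopology_of_def by blast
      then obtain r where r: "r > 0" "Metric_space.mball (mspace m) (mdist m) (h x) r \<subseteq> V" by blast
      have "y \<in> s" if y: "y \<in> S" "\<forall>h\<in>H. mdist m (h x) (h y) < r" for y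
      proof -
        have "h x \<in> mspace m" using H 2 Basis by blast
        then have "h y \<in> Metric_space.mball (mspace m) (mdist m) (h x) r"
          using y 2(1) H by (simp add: Metric_space.in_mball)
        then show ?thesis using r(2) y(1) 2(3) by blast
      qed
      then show ?thesis using r(1) by blast
    qed
  qed simp
qed

text \<open>The pieces that fit into some member of the cover are countable in number. They exhaust
  \<open>S\<close>, because a small enough piece around a point fits; choosing one member for each
  piece gives the subcover.\<close>

lemma countably_small_imp_Lindelof:
  assumes "countably_small m H S" and H: "\<And>h x. h \<in> H \<Longrightarrow> x \<in> S \<Longrightarrow> h x \<in> mspace m"
  shows "Lindelof_space (weak_topology S (mtopology_of m) H)"
  unfolding Lindelof_space_def topspace_weak_topology
proof (intro allI impI)
  fix \<U> assume \<U>: "(\<forall>U\<in>\<U>. openin (weak_topology S (mtopology_of m) H) U) \<and> \<Union>\<U> = S"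
  define P where "P n \<V> \<longleftrightarrow> countable \<V> \<and> S \<subseteq> \<Union>\<V> \<and>
     (\<forall>V\<in>\<V>. \<forall>l\<in>H. \<forall>x\<in>V. \<forall>y\<in>V. mdist m (l x) (l y) < inverse (real (Suc n)))" for n \<V>
  have "\<exists>\<V>. P n \<V>" for n
    using assms(1) unfolding countably_small_def P_def by simp
  then obtain \<V> where "\<And>n. P n (\<V> n)" by metis
  then have \<V>: "countable (\<V> n)" "S \<subseteq> \<Union>(\<V> n)"
    "V \<in> \<V> n \<Longrightarrow> l \<in> H \<Longrightarrow> x \<in> V \<Longrightarrow> y \<in> V \<Longrightarrow> mdist m (l x) (l y) < inverse (real (Suc n))" for n V l x y
    unfolding P_def by blast+
  define \<S> where "\<S> = {V \<in> (\<Union>n. \<V> n). \<exists>U\<in>\<U>. V \<inter> S \<subseteq> U}"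
  have cS: "countable \<S>"
    by (rule countable_subset[of _ "\<Union>n. \<V> n"]) (use \<V>(1) in \<open>auto simp: \<S>_def\<close>)
  have "\<forall>V\<in>\<S>. \<exists>U. U \<in> \<U> \<and> V \<inter> S \<subseteq> U"
    by (auto simp: \<S>_def)
  then obtain u where u0: "\<forall>V\<in>\<S>. u V \<in> \<U> \<and> V \<inter> S \<subseteq> u V"
    by (elim bchoice[THEN exE])
  then have u: "u V \<in> \<U> \<and> V \<inter> S \<subseteq> u V" if "V \<in> \<S>" for V
    using that by simp
  have "S \<subseteq> \<Union>(u ` \<S>)"
  proof
    fix x assume x: "x \<in> S"
    then obtain U where U: "U \<in> \<U>" "x \<in> U" using \<U> by blast
    have "\<exists>e>0. \<forall>y\<in>S. (\<forall>h\<in>H. mdist m (h x) (h y) < e) \<longrightarrow> y \<in> U"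
      by (rule weak_topology_uniform_nbhd) (use \<U> U H in auto)
    then obtain e where e: "e > 0" "\<forall>y\<in>S. (\<forall>h\<in>H. mdist m (h x) (h y) < e) \<longrightarrow> y \<in> U" by blast
    obtain n where n: "inverse (real (Suc n)) < e" using reals_Archimedean e(1) by blast
    obtain V where V: "V \<in> \<V> n" "x \<in> V" using \<V>(2)[of n] x by blast
    have "V \<inter> S \<subseteq> U"
      using e(2) \<V>(3)[OF V(1) _ V(2)] n by (meson IntD1 IntD2 less_trans subsetI)
    then have "V \<in> \<S>" using V U by (auto simp: \<S>_def)
    then show "x \<in> \<Union>(u ` \<S>)" using u[of V] V x by blast
  qed
  moreover have "\<Union>(u ` \<S>) \<subseteq> S" using u \<U> by blast
  ultimately show "\<exists>\<V>. countable \<V> \<and> \<V> \<subseteq> \<U> \<and> \<Union>\<V> = S"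
    using u cS by (intro exI[of _ "u ` \<S>"]) auto
qed

section \<open>Countable covers and metrizability of the restricted closure\<close>

lemma continuous_map_restrict_pointwise:
  assumes "D \<subseteq> S"
  shows "continuous_map (pointwise_topology S Y) (pointwise_topology D Y) (\<lambda>h. restrict h D)"
  unfolding pointwise_topology_def
proof (subst continuous_map_componentwise, intro conjI ballI)
  show "(\<lambda>h. restrict h D) ` topspace (product_topology (\<lambda>_. Y) S) \<subseteq> extensional D"
    by auto
  fix k assume k: "k \<in> D"
  then have "continuous_map (product_topology (\<lambda>_. Y) S) Y (\<lambda>h. h k)"
    using assms by (intro continuous_map_product_projection) auto
  then show "continuous_map (product_topology (\<lambda>_. Y) S) Y (\<lambda>h. restrict h D k)"
    using k by simp
qed

text \<open>One point from each piece yields a countable set \<open>D\<close> that is dense in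
  \<open>F\<close> for the supremum pseudometric. Restriction to \<open>D\<close> is injective on
  the compact set of restrictions, hence embeds it in a countable product of metrizable
  spaces.\<close>

lemma countably_small_imp_metrizable:
  assumes small: "countably_small m H F" and "F \<subseteq> X"
    and comp: "compactin (pointwise_topology X (mtopology_of m)) H"
  shows "metrizable_space (subtopology (pointwise_topology F (mtopology_of m)) (restrict_functions H F))"
proof -
  let ?Y = "mtopology_of m"
  have Hs: "h x \<in> mspace m" if "h \<in> H" "x \<in> F" for h x
    using compactin_subset_topspace[OF comp] that \<open>F \<subseteq> X\<close> by auto
  have compF: "compactin (pointwise_topology F ?Y) (restrict_functions H F)"
    unfolding restrict_functions_def
    by (rule image_compactin[OF comp continuous_map_restrict_pointwise[OF \<open>F \<subseteq> X\<close>]])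
  define P where "P n \<V> \<longleftrightarrow> countable \<V> \<and> F \<subseteq> \<Union>\<V> \<and>
     (\<forall>V\<in>\<V>. \<forall>l\<in>H. \<forall>x\<in>V. \<forall>y\<in>V. mdist m (l x) (l y) < inverse (real (Suc n)))" for n \<V>
  have "\<exists>\<V>. P n \<V>" for n
    using small unfolding countably_small_def P_def by simp
  then obtain \<V> where "\<And>n. P n (\<V> n)" by metis
  then have \<V>: "countable (\<V> n)" "F \<subseteq> \<Union>(\<V> n)"
    "V \<in> \<V> n \<Longrightarrow> l \<in> H \<Longrightarrow> x \<in> V \<Longrightarrow> y \<in> V \<Longrightarrow> mdist m (l x) (l y) < inverse (real (Suc n))" for n V l x y
    unfolding P_def by blast+
  define \<W> where "\<W> = {V \<in> (\<Union>n. \<V> n). V \<inter> F \<noteq> {}}"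
  define p where "p V = (SOME x. x \<in> V \<inter> F)" for V
  have p: "p V \<in> V \<inter> F" if "V \<in> \<W>" for V
    using that unfolding p_def some_in_eq \<W>_def by simp
  define D where "D = p ` \<W>"
  have "countable \<W>" 
    by (rule countable_subset[of _ "\<Union>n. \<V> n"]) (use \<V>(1) in \<open>auto simp: \<W>_def\<close>)
  then have cD: "countable D" by (simp add: D_def)
  have DF: "D \<subseteq> F" using p by (auto simp: D_def)
  have "metrizable_space ?Y"
    unfolding mtopology_of_def by (simp add: Metric_space.metrizable_space_mtopology)
  then have metD: "metrizable_space (pointwise_topology D ?Y)"
    unfolding pointwise_topology_def metrizable_space_product_topology
    using countable_subset[OF _ cD] by (intro disjI2) auto
  let ?K = "subtopology (pointwise_topology F ?Y) (restrict_functions H F)"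
  have topK: "topspace ?K = restrict_functions H F"
    using compactin_subset_topspace[OF compF] by auto
  have inj: "inj_on (\<lambda>h. restrict h D) (topspace ?K)"
    unfolding topK
  proof (rule inj_onI)
    fix f g assume f: "f \<in> restrict_functions H F" and g: "g \<in> restrict_functions H F"
      and eq: "restrict f D = restrict g D"
    obtain f' g' where f': "f' \<in> H" "f = restrict f' F" and g': "g' \<in> H" "g = restrict g' F"
      using f g by (auto simp: restrict_functions_def)
    have eqD: "f' c = g' c" if "c \<in> D" for c
      using fun_cong[OF eq, of c] that DF f' g' by (auto split: if_splits)
    have "f' x = g' x" if x: "x \<in> F" for x
    proof -
      have "mdist m (f' x) (g' x) \<le> 0"
      proof (rule field_le_epsilon)
        fix e :: real assume "e > 0"
        then have "e/2 > 0" by simp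
        then obtain n where n: "inverse (real (Suc n)) < e/2" using reals_Archimedean by blast
        obtain V where V: "V \<in> \<V> n" "x \<in> V" using \<V>(2)[of n] x by blast
        then have "V \<in> \<W>" using x by (auto simp: \<W>_def)
        then have c: "p V \<in> V" "p V \<in> F" "p V \<in> D" using p[of V] by (auto simp: D_def)
        have "mdist m (f' x) (f' (p V)) < e/2" "mdist m (g' (p V)) (g' x) < e/2"
          using \<V>(3)[OF V(1) f'(1) V(2) c(1)] \<V>(3)[OF V(1) g'(1) c(1) V(2)] n by linarith+
        then show "mdist m (f' x) (g' x) \<le> 0 + e"
          using mdist_triangle[OF Hs[OF f'(1) x] Hs[OF f'(1) c(2)] Hs[OF g'(1) x]] eqD[OF c(3)] by simp
      qed
      then have "mdist m (f' x) (g' x) = 0" using mdist_nonneg[of m "f' x" "g' x"] by linarith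
      then show ?thesis using mdist_zero[OF Hs[OF f'(1) x] Hs[OF g'(1) x]] by blast
    qed
    then show "f = g" using f' g' by (auto simp: fun_eq_iff)
  qed
  have "embedding_map ?K (pointwise_topology D ?Y) (\<lambda>h. restrict h D)"
  proof (rule continuous_imp_embedding_map)
    show "continuous_map ?K (pointwise_topology D ?Y) (\<lambda>h. restrict h D)"
      by (intro continuous_map_from_subtopology continuous_map_restrict_pointwise DF)
    show "compact_space ?K" using compF by (rule compact_space_subtopology)
    show "Hausdorff_space (pointwise_topology D ?Y)"
      using metD by (rule metrizable_imp_Hausdorff_space)
    show "inj_on (\<lambda>h. restrict h D) (topspace ?K)" by (rule inj)
  qed
  then have "?K homeomorphic_space (subtopology (pointwise_topology D ?Y) ((\<lambda>h. restrict h D) ` topspace ?K))"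
    by (rule embedding_map_imp_homeomorphic_space)
  then show ?thesis
    using homeomorphic_metrizable_space metrizable_space_subtopology[OF metD] by blast
qed

text \<open>On a compact metric space of functions every evaluation is uniformly continuous. Sorting
  the points of \<open>F\<close> by their modulus of continuity gives countably many sets
  \<open>P n\<close>, on each of which a finite net of functions is a uniform net.\<close>

lemma metrizable_imp_countably_small:
  assumes F: "compactin X F"
    and L: "L \<subseteq> continuous_functions X (mtopology_of m)"
    and comp: "compactin (pointwise_topology (topspace X) (mtopology_of m)) (pointwise_closure (topspace X) (mtopology_of m) L)"
    and met: "metrizable_space (subtopology (pointwise_topology F (mtopology_of m))
        (restrict_functions (pointwise_closure (topspace X) (mtopology_of m) L) F))"
  shows "countably_small m L F"
proof -
  let ?Y = "mtopology_of m"
  define H where "H = restrict_functions (pointwise_closure (topspace X) ?Y L) F"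
  let ?PF = "pointwise_topology F ?Y"
  let ?K = "subtopology ?PF H"
  have FX: "F \<subseteq> topspace X" using compactin_subset_topspace[OF F] .
  have compF: "compactin ?PF H"
    unfolding restrict_functions_def H_def
    by (rule image_compactin[OF comp continuous_map_restrict_pointwise[OF FX]])
  have HP: "H \<subseteq> topspace ?PF" using compactin_subset_topspace[OF compF] .
  have topK: "topspace ?K = H" using HP by auto
  obtain M d where Md: "Metric_space M d" and K: "?K = Metric_space.mtopology M d"
    using met unfolding metrizable_space_def H_def by blast
  interpret MS: Metric_space M d by (rule Md)
  have MH: "M = H" using K topK by (metis MS.topspace_mtopology)
  let ?mm = "metric (M, d)"
  have Kmm: "mtopology_of ?mm = ?K" using K by simp
  have Lc: "continuous_map X ?Y l" "l \<in> extensional (topspace X)" if "l \<in> L" for l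
    using subsetD[OF L that] by (simp_all add: continuous_functions_def)
  have Ls: "l x \<in> mspace m" if "l \<in> L" "x \<in> topspace X" for l x
    using continuous_map_funspace[OF Lc(1)[OF that(1)]] that(2) by auto
  have LH: "restrict l F \<in> H" if "l \<in> L" for l
  proof -
    have "L \<subseteq> topspace (pointwise_topology (topspace X) ?Y)"
      using Lc(2) Ls by (simp add: PiE_iff subset_iff)
    then have "l \<in> pointwise_closure (topspace X) ?Y L"
      unfolding pointwise_closure_def using closure_of_subset that by blast
    then show ?thesis by (auto simp: H_def restrict_functions_def)
  qed
  have dense: "H \<subseteq> ?PF closure_of ((\<lambda>l. restrict l F) ` L)"
    using continuous_map_image_closure_subset[OF continuous_map_restrict_pointwise[OF FX], of ?Y L]
    unfolding H_def restrict_functions_def pointwise_closure_def .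
  show ?thesis
    unfolding countably_small_def
  proof (intro allI impI)
    fix e :: real assume "e > 0"
    \<comment> \<open>At all points of \<open>P n\<close> the same \<open>\<delta> = 1/(n+1)\<close>
      works for the tolerance \<open>e/3\<close>.\<close>
    define P where "P n = {x \<in> F. \<forall>f\<in>H. \<forall>g\<in>H. d g f < inverse (real (Suc n)) \<longrightarrow> mdist m (g x) (f x) < e/3}" for n
    have FP: "F \<subseteq> (\<Union>n. P n)"
    proof
      fix x assume x: "x \<in> F"
      have "continuous_map ?PF ?Y (\<lambda>h. h x)"
        unfolding pointwise_topology_def using x by (intro continuous_map_product_projection)
      then have "continuous_map (mtopology_of ?mm) ?Y (\<lambda>h. h x)"
        unfolding Kmm by (rule continuous_map_from_subtopology)
      moreover have "compact_space (mtopology_of ?mm)"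
        unfolding Kmm using compF by (rule compact_space_subtopology)
      ultimately have "uniformly_continuous_map ?mm m (\<lambda>h. h x)"
        using continuous_eq_uniformly_continuous_map by blast
      then have "\<forall>\<epsilon>>0. \<exists>\<delta>>0. \<forall>f\<in>H. \<forall>g\<in>H. d g f < \<delta> \<longrightarrow> mdist m (g x) (f x) < \<epsilon>"
        unfolding uniformly_continuous_map_def MS.mspace_metric MS.mdist_metric
        unfolding MH by (rule conjunct2)
      from this[rule_format, of "e/3"] \<open>e > 0\<close>
      obtain \<delta> where \<delta>: "\<delta> > 0" "\<forall>f\<in>H. \<forall>g\<in>H. d g f < \<delta> \<longrightarrow> mdist m (g x) (f x) < e/3" by auto
      obtain n where "inverse (real (Suc n)) < \<delta>" using reals_Archimedean \<delta>(1) by blast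
      then have "x \<in> P n" using x \<delta>(2) by (fastforce simp: P_def)
      then show "x \<in> (\<Union>n. P n)" by blast
    qed
    have "\<exists>\<V>. finite \<V> \<and> P n \<subseteq> \<Union>\<V> \<and> (\<forall>V\<in>\<V>. \<forall>l\<in>L. \<forall>x\<in>V. \<forall>y\<in>V. mdist m (l x) (l y) < 3 * (e/3))" for n
    proof -
      define r where "r = inverse (real (Suc n))"
      have r: "r > 0" by (simp add: r_def)
      \<comment> \<open>The centres are taken from the dense set of restrictions of
        \<open>L\<close>, since members of the closure need not be continuous on \<open>F\<close>,
        as the covering argument demands of the net.\<close>
      have "\<exists>E. finite E \<and> E \<subseteq> L \<and> H \<subseteq> (\<Union>l\<in>E. MS.mball (restrict l F) r)"
      proof -
        have cov: "H \<subseteq> \<Union>((\<lambda>l. MS.mball (restrict l F) r) ` L)"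
        proof
          fix h assume h: "h \<in> H"
          have "openin ?K (MS.mball h r)" unfolding K by simp
          then obtain U where U: "openin ?PF U" "MS.mball h r = U \<inter> H" by (auto simp: openin_subtopology)
          have "h \<in> U" using U(2) h r MS.centre_in_mball_iff MH by blast
          have "h \<in> ?PF closure_of ((\<lambda>l. restrict l F) ` L)" using dense h by blast
          from this[unfolded in_closure_of, THEN conjunct2, rule_format, OF conjI[OF \<open>h \<in> U\<close> U(1)]]
          obtain l where l: "l \<in> L" "restrict l F \<in> U" by blast
          then have "restrict l F \<in> MS.mball h r" using U(2) LH by blast
          then have "h \<in> MS.mball (restrict l F) r" by (simp add: MS.commute)
          then show "h \<in> \<Union>((\<lambda>l. MS.mball (restrict l F) r) ` L)" using l by blast
        qed
        have "compactin ?K H" using compF by simp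
        then obtain \<F> where "finite \<F>" "\<F> \<subseteq> (\<lambda>l. MS.mball (restrict l F) r) ` L" "H \<subseteq> \<Union>\<F>"
          using compactinD[of ?K H "(\<lambda>l. MS.mball (restrict l F) r) ` L"] cov K by auto
        then obtain E where "E \<subseteq> L" "finite E" "\<F> = (\<lambda>l. MS.mball (restrict l F) r) ` E"
          using finite_subset_image[of \<F> "\<lambda>l. MS.mball (restrict l F) r" L] by blast
        then show ?thesis using \<open>H \<subseteq> \<Union>\<F>\<close> by blast
      qed
      then obtain E where E: "finite E" "E \<subseteq> L" "H \<subseteq> (\<Union>l\<in>E. MS.mball (restrict l F) r)" by blast
      show ?thesis
      proof (rule finite_cover_small[of "subtopology X F" E])
        show "compact_space (subtopology X F)" using F by (rule compact_space_subtopology)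
        show "continuous_map (subtopology X F) ?Y l" if "l \<in> E" for l
          using that E(2) L by (auto simp: continuous_functions_def intro: continuous_map_from_subtopology)
        show "P n \<subseteq> topspace (subtopology X F)" using FX by (auto simp: P_def)
        show "l x \<in> mspace m" if "l \<in> L" "x \<in> P n" for l x using that Ls FX by (auto simp: P_def)
        show "\<exists>l'\<in>E. \<forall>x\<in>P n. mdist m (l x) (l' x) < e/3" if l: "l \<in> L" for l
        proof -
          obtain l' where l': "l' \<in> E" "restrict l F \<in> MS.mball (restrict l' F) r" using E(3) LH[OF l] by blast
          have "mdist m (l x) (l' x) < e/3" if x: "x \<in> P n" for x
          proof -
            have "d (restrict l F) (restrict l' F) < r" using l'(2) by (simp add: MS.commute)
            then have "mdist m (restrict l F x) (restrict l' F x) < e/3"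
              using x LH[OF l] LH[of l'] l'(1) E(2) unfolding P_def r_def by blast
            then show ?thesis using x by (simp add: P_def)
          qed
          then show ?thesis using l'(1) by blast
        qed
      qed (use E(1) \<open>e > 0\<close> in auto)
    qed
    then have "\<forall>n. \<exists>\<V>. finite \<V> \<and> P n \<subseteq> \<Union>\<V> \<and> (\<forall>V\<in>\<V>. \<forall>l\<in>L. \<forall>x\<in>V. \<forall>y\<in>V. mdist m (l x) (l y) < e)" by simp
    then obtain \<V> where \<V>: "\<forall>n. finite (\<V> n) \<and> P n \<subseteq> \<Union>(\<V> n) \<and> (\<forall>V\<in>\<V> n. \<forall>l\<in>L. \<forall>x\<in>V. \<forall>y\<in>V. mdist m (l x) (l y) < e)"
      by (elim choice[THEN exE])
    have "P n \<subseteq> \<Union>(\<V> n)" for n using \<V> by simp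
    have "F \<subseteq> \<Union>(\<Union>n. \<V> n)"
    proof
      fix x assume "x \<in> F"
      then obtain n where "x \<in> P n" using FP by auto
      then have "x \<in> \<Union>(\<V> n)" using \<open>\<And>n. P n \<subseteq> \<Union>(\<V> n)\<close> by auto
      then show "x \<in> \<Union>(\<Union>n. \<V> n)" by auto
    qed
    moreover have "countable (\<Union>n. \<V> n)" using \<V> by (auto intro: countable_finite)
    ultimately show "\<exists>\<V>. countable \<V> \<and> F \<subseteq> \<Union>\<V> \<and> (\<forall>V\<in>\<V>. \<forall>l\<in>L. \<forall>x\<in>V. \<forall>y\<in>V. mdist m (l x) (l y) < e)"
      using \<V> by (intro exI[of _ "\<Union>n. \<V> n"]) blast
  qed
qed

text \<open>Removing all weak base sets that admit a countable cover leaves a set \<open>S'\<close>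
  with large oscillation in every weak neighbourhood. A small piece open in \<open>T\<close> does
  not contradict this by itself. The closed set \<open>A\<close> is therefore chosen minimal, so
  that a \<open>T\<close>-open piece of it contains the trace of a weak neighbourhood of a point of
  \<open>S'\<close>.\<close>

lemma hereditarily_almost_equicontinuous_imp_countably_small:
  assumes "compact_space T" and "countable L"
    and cont: "\<And>l. l \<in> L \<Longrightarrow> continuous_map T (mtopology_of m) l"
    and hae: "hereditarily_almost_equicontinuous T m L"
  shows "countably_small m L (topspace T)"
proof (rule ccontr)
  let ?X = "topspace T"
  have Ls: "l x \<in> mspace m" if "l \<in> L" "x \<in> ?X" for l x
    using continuous_map_funspace[OF cont[OF that(1)]] that(2) by auto
  assume "\<not> countably_small m L ?X"
  then obtain e where "e > 0" and no: "\<not> (\<exists>\<V>. countable \<V> \<and> ?X \<subseteq> \<Union>\<V> \<and>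
     (\<forall>V\<in>\<V>. \<forall>l\<in>L. \<forall>x\<in>V. \<forall>y\<in>V. mdist m (l x) (l y) < e))"
    unfolding countably_small_def by blast
  \<comment> \<open>For the fixed \<open>e\<close> these sets form a sigma-ideal that does not
    contain the whole space.\<close>
  define cov where "cov B \<longleftrightarrow> (\<exists>\<V>. countable \<V> \<and> B \<subseteq> \<Union>\<V> \<and>
     (\<forall>V\<in>\<V>. \<forall>l\<in>L. \<forall>x\<in>V. \<forall>y\<in>V. mdist m (l x) (l y) < e))" for B
  have noX: "\<not> cov ?X" using no by (simp add: cov_def)
  have covsub: "cov B" if "cov C" "B \<subseteq> C" for B C
    using that unfolding cov_def by (meson order_trans)
  have covUn: "cov (\<Union>\<B>)" if "countable \<B>" and covB: "\<And>B. B \<in> \<B> \<Longrightarrow> cov B" for \<B>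
  proof -
    have "\<forall>B\<in>\<B>. \<exists>\<V>. countable \<V> \<and> B \<subseteq> \<Union>\<V> \<and>
     (\<forall>V\<in>\<V>. \<forall>l\<in>L. \<forall>x\<in>V. \<forall>y\<in>V. mdist m (l x) (l y) < e)"
      using covB by (simp add: cov_def)
    then obtain \<V> where \<V>: "\<forall>B\<in>\<B>. countable (\<V> B) \<and> B \<subseteq> \<Union>(\<V> B) \<and>
     (\<forall>V\<in>\<V> B. \<forall>l\<in>L. \<forall>x\<in>V. \<forall>y\<in>V. mdist m (l x) (l y) < e)"
      by (elim bchoice[THEN exE])
    have "countable (\<Union>(\<V> ` \<B>))" using \<V> \<open>countable \<B>\<close> by auto
    moreover have "B \<subseteq> \<Union>(\<V> B)" if "B \<in> \<B>" for B using \<V> that by simp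
    then have "\<Union>\<B> \<subseteq> \<Union>(\<Union>(\<V> ` \<B>))" by blast
    moreover have "\<forall>V\<in>\<Union>(\<V> ` \<B>). \<forall>l\<in>L. \<forall>x\<in>V. \<forall>y\<in>V. mdist m (l x) (l y) < e" using \<V> by blast
    ultimately show ?thesis unfolding cov_def by blast
  qed
  have "\<exists>N. finite N \<and> N \<subseteq> ?X \<and> (\<forall>x\<in>?X. \<exists>c\<in>N. mdist m (l x) (l c) < inverse (real (Suc n)))"
    if l: "l \<in> L" for l n
    by (rule compact_space_finite_net[OF \<open>compact_space T\<close> cont[OF l]]) simp
  then have "\<forall>l\<in>L. \<forall>n. \<exists>N. finite N \<and> N \<subseteq> ?X \<and> (\<forall>x\<in>?X. \<exists>c\<in>N. mdist m (l x) (l c) < inverse (real (Suc n)))"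
    by blast
  then obtain N where N: "\<And>l n. l \<in> L \<Longrightarrow> finite (N l n) \<and> N l n \<subseteq> ?X \<and>
      (\<forall>x\<in>?X. \<exists>c\<in>N l n. mdist m (l x) (l c) < inverse (real (Suc n)))"
    by metis
  \<comment> \<open>Codes of weak balls with centres in finite nets and radii
    \<open>1/(n+1)\<close>. There are countably many, and their finite intersections refine every
    weak neighbourhood.\<close>
  define I where "I = (SIGMA l:L. SIGMA n:UNIV. N l n)"
  have cI: "countable I"
    unfolding I_def using \<open>countable L\<close> N by (intro countable_SIGMA) (auto intro: countable_finite)
  define ball where "ball = (\<lambda>(l, n, c). {x \<in> ?X. mdist m (l x) (l c) < inverse (real (Suc n))})"
  define \<B> where "\<B> = (\<lambda>S. ?X \<inter> \<Inter>(ball ` S)) ` {S. finite S \<and> S \<subseteq> I}"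
  have cB: "countable \<B>"
    unfolding \<B>_def using countable_Collect_finite_subset[OF cI] by (intro countable_image)
  have base: "\<exists>B\<in>\<B>. s \<in> B \<and> (\<forall>y\<in>B. \<forall>l\<in>E. mdist m (l y) (l s) < r)"
    if s: "s \<in> ?X" and E: "finite E" "E \<subseteq> L" and r: "r > 0" for s E r
  proof -
    have "r/2 > 0" using r by simp
    then obtain n where n: "inverse (real (Suc n)) < r/2" using reals_Archimedean by blast
    have "\<forall>l\<in>E. \<exists>c. c \<in> N l n \<and> mdist m (l s) (l c) < inverse (real (Suc n))"
      using N s E by blast
    then obtain c where c: "\<forall>l\<in>E. c l \<in> N l n \<and> mdist m (l s) (l (c l)) < inverse (real (Suc n))"
      by (elim bchoice[THEN exE])
    define S where "S = (\<lambda>l. (l, n, c l)) ` E"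
    have S: "finite S" "S \<subseteq> I" using E c by (auto simp: S_def I_def)
    have "mdist m (l y) (l s) < r" if y: "y \<in> ?X \<inter> \<Inter>(ball ` S)" and l: "l \<in> E" for y l
    proof -
      have "y \<in> ball (l, n, c l)" using y l by (auto simp: S_def)
      then have 1: "y \<in> ?X" "mdist m (l y) (l (c l)) < inverse (real (Suc n))" by (auto simp: ball_def)
      have 2: "mdist m (l s) (l (c l)) < inverse (real (Suc n))" using c l by blast
      have lL: "l \<in> L" using l E by blast
      have "c l \<in> ?X" using c l N[OF lL, of n] by blast
      then show ?thesis
        using mdist_triangle[OF Ls[OF lL 1(1)] Ls[OF lL, of "c l"] Ls[OF lL s]] mdist_commute[of m "l (c l)" "l s"] 1 2 n
        by linarith
    qed
    moreover have "s \<in> ?X \<inter> \<Inter>(ball ` S)" using s c by (auto simp: S_def ball_def)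
    ultimately show ?thesis
      using S unfolding \<B>_def by (intro bexI[of _ "?X \<inter> \<Inter>(ball ` S)"]) blast+
  qed
  define O' where "O' = \<Union>{B \<in> \<B>. cov B}"
  \<comment> \<open>No weakly open set around a point of \<open>S'\<close> meets \<open>S'\<close> in a set of small oscillation.\<close>
  define S' where "S' = ?X - O'"
  have covO: "cov O'"
    unfolding O'_def
  proof (rule covUn)
    show "countable {B \<in> \<B>. cov B}" by (rule countable_subset[OF _ cB]) blast
  qed blast
  have S'ne: "S' \<noteq> {}"
    using covsub[OF covO, of ?X] noX by (auto simp: S'_def)
  have key: "\<exists>x\<in>S'. \<exists>y\<in>S'. \<exists>l\<in>L. mdist m (l x) (l y) \<ge> e \<and>
      (\<forall>k\<in>E. mdist m (k x) (k s) < r) \<and> (\<forall>k\<in>E. mdist m (k y) (k s) < r)"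
    if s: "s \<in> S'" and E: "finite E" "E \<subseteq> L" and r: "r > 0" for s E r
  proof (rule ccontr)
    assume contra: "\<not> ?thesis"
    obtain B where B: "B \<in> \<B>" "s \<in> B" "\<forall>y\<in>B. \<forall>l\<in>E. mdist m (l y) (l s) < r"
      using base[OF _ E r, of s] s unfolding S'_def by blast
    have "mdist m (l x) (l y) < e" if "l \<in> L" "x \<in> B \<inter> S'" "y \<in> B \<inter> S'" for l x y
      using contra B(3) that by (meson IntD1 IntD2 not_le)
    \<comment> \<open>\<open>B \<inter> S'\<close> would be a single admissible piece and the rest
      of \<open>B\<close> lies in \<open>O'\<close>. So \<open>B\<close> itself would be in the
      ideal and would have been removed together with \<open>s\<close>.\<close>
    then have "cov (B \<inter> S')"
      unfolding cov_def by (intro exI[of _ "{B \<inter> S'}"]) blast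
    then have "cov (\<Union>{B \<inter> S', O'})" using covO by (intro covUn) auto
    moreover have "B \<subseteq> \<Union>{B \<inter> S', O'}"
      using B(1) by (auto simp: S'_def \<B>_def)
    ultimately have "cov B" by (rule covsub)
    then have "s \<in> O'" using B unfolding O'_def by blast
    then show False using s by (simp add: S'_def)
  qed
  \<comment> \<open>Closed weak neighbourhoods of points of \<open>S'\<close>. By compactness, a
    closed set that meets all of them meets every fibre over \<open>S'\<close> of the map
    identifying points not separated by \<open>L\<close>.\<close>
  define C where "C E s r = ?X \<inter> \<Inter>((\<lambda>l. {x \<in> ?X. mdist m (l x) (l s) \<le> r}) ` E)" for E s r
  define \<C> where "\<C> = {C E s r |E s r. finite E \<and> E \<subseteq> L \<and> s \<in> S' \<and> r > 0}"
  have SX: "S' \<subseteq> ?X" by (auto simp: S'_def)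
  have Cne: "s \<in> C E s r" if "E \<subseteq> L" "s \<in> S'" "r > 0" for E s r
    using that SX Ls by (auto simp: C_def subset_iff less_imp_le)
  have Ccl: "closedin T (C E s r)" if E: "E \<subseteq> L" and s: "s \<in> S'" for E s r
  proof -
    have "closedin T {x \<in> ?X. mdist m (l x) (l s) \<le> r}" if "l \<in> E" for l
    proof (rule closedin_mdist_le)
      show "continuous_map T (mtopology_of m) l" using \<open>l \<in> E\<close> E cont by blast
      have "l s \<in> mspace m" using \<open>l \<in> E\<close> E s SX Ls by blast
      then show "continuous_map T (mtopology_of m) (\<lambda>x. l s)" by simp
    qed
    then have "closedin T (\<Inter>(insert ?X ((\<lambda>l. {x \<in> ?X. mdist m (l x) (l s) \<le> r}) ` E)))"
      by (intro closedin_Inter) auto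
    then show ?thesis by (simp add: C_def)
  qed
  \<comment> \<open>The complement of a maximal such \<open>U\<close> is a minimal closed set meeting every member of \<open>\<C>\<close>;
    therefore each relatively open part of it contains the trace of a member of \<open>\<C>\<close>.\<close>
  define \<A> where "\<A> = {U. openin T U \<and> (\<forall>K\<in>\<C>. \<not> K \<subseteq> U)}"
  have "\<exists>U\<in>\<A>. \<forall>V\<in>\<A>. U \<subseteq> V \<longrightarrow> V = U"
  proof (rule subset_Zorn_nonempty)
    have "K \<noteq> {}" if "K \<in> \<C>" for K using that Cne unfolding \<C>_def by blast
    then have "{} \<in> \<A>" unfolding \<A>_def by simp
    then show "\<A> \<noteq> {}" by blast
    fix \<K> assume ne: "\<K> \<noteq> {}" and ch: "subset.chain \<A> \<K>"
    then have KA: "\<K> \<subseteq> \<A>" by (simp add: subset_chain_def)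
    \<comment> \<open>Members of \<open>\<C>\<close> are compact, so one that is covered by the
      union of a chain is already covered by a single element of it.\<close>
    have "\<not> K \<subseteq> \<Union>\<K>" if K: "K \<in> \<C>" for K
    proof
      assume sub: "K \<subseteq> \<Union>\<K>"
      have "closedin T K" using K Ccl unfolding \<C>_def by blast
      then have "compactin T K" using \<open>compact_space T\<close> closedin_compact_space by blast
      then obtain \<F> where \<F>: "finite \<F>" "\<F> \<subseteq> \<K>" "K \<subseteq> \<Union>\<F>"
        using compactinD[of T K \<K>] sub KA unfolding \<A>_def by blast
      have "K \<noteq> {}" using K Cne unfolding \<C>_def by blast
      then have Fne: "\<F> \<noteq> {}" using \<F>(3) by blast
      have "X \<subseteq> Y \<or> Y \<subseteq> X" if "X \<in> \<K>" "Y \<in> \<K>" for X Y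
        using ch that unfolding subset_chain_def by simp
      then have chF: "subset.chain \<A> \<F>"
        unfolding subset_chain_def using \<F>(2) KA by (intro conjI ballI) auto
      have "\<Union>\<F> \<in> \<F>"
        using Union_in_chain[OF \<F>(1) Fne chF] .
      then show False using \<F> K KA unfolding \<A>_def by blast
    qed
    moreover have "openin T (\<Union>\<K>)" using KA unfolding \<A>_def by blast
    ultimately show "\<Union>\<K> \<in> \<A>" unfolding \<A>_def by blast
  qed
  then obtain U where U: "U \<in> \<A>" and Umax: "\<And>V. V \<in> \<A> \<Longrightarrow> U \<subseteq> V \<Longrightarrow> V = U" by blast
  have Uop: "openin T U" and UC: "\<And>K. K \<in> \<C> \<Longrightarrow> \<not> K \<subseteq> U" using U by (auto simp: \<A>_def)
  define A where "A = ?X - U"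
  have Acl: "closedin T A" unfolding A_def using Uop by (intro closedin_diff) auto
  obtain s0 where s0: "s0 \<in> S'" using S'ne by blast
  have "C {} s0 1 \<in> \<C>" unfolding \<C>_def using s0 by (auto intro!: exI[of _ "{}"] exI[of _ s0] exI[of _ 1])
  then have "A \<noteq> {}" using UC[of "C {} s0 1"] by (auto simp: A_def C_def)
  then obtain W where W: "openin T W" "W \<inter> A \<noteq> {}"
    "\<forall>l\<in>L. \<forall>x\<in>W \<inter> A. \<forall>y\<in>W \<inter> A. mdist m (l x) (l y) < e/2"
    using hereditarily_almost_equicontinuous_small[OF hae Acl, of "e/2"] \<open>e > 0\<close> by auto
  have "U \<union> W \<notin> \<A>"
    using Umax[of "U \<union> W"] W(2) by (auto simp: A_def)
  then obtain E s r where Er: "finite E" "E \<subseteq> L" "s \<in> S'" "r > 0" "C E s r \<subseteq> U \<union> W"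
    using Uop W(1) unfolding \<A>_def \<C>_def by blast
  have "r/2 > 0" using Er by simp
  from key[OF Er(3,1,2) this] obtain x y l where xyl: "x \<in> S'" "y \<in> S'" "l \<in> L" "mdist m (l x) (l y) \<ge> e"
    and xE: "\<forall>k\<in>E. mdist m (k x) (k s) < r/2" and yE: "\<forall>k\<in>E. mdist m (k y) (k s) < r/2"
    by blast
  \<comment> \<open>The bound \<open>r/2\<close> keeps the new points inside \<open>C E s r\<close>;
    the bound \<open>e/8\<close> leaves a distance of at least \<open>3*e/4 > e/2\<close> between
    them under \<open>l\<close>.\<close>
  define r' where "r' = min (r/2) (e/8)"
  have r': "r' > 0" "r' \<le> r/2" "r' \<le> e/8" using Er \<open>e > 0\<close> by (auto simp: r'_def)
  have step: "\<exists>x'\<in>W \<inter> A. mdist m (l x') (l x) \<le> e/8"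
    if x: "x \<in> S'" and xE: "\<forall>k\<in>E. mdist m (k x) (k s) < r/2" for x
  proof -
    have "C (insert l E) x r' \<in> \<C>"
      unfolding \<C>_def using Er xyl(3) x r'(1) by blast
    then obtain x' where x': "x' \<in> C (insert l E) x r'" "x' \<notin> U" using UC by blast
    have x'X: "x' \<in> ?X" using x'(1) by (simp add: C_def)
    have "mdist m (k x') (k s) \<le> r" if k: "k \<in> E" for k
    proof -
      have "mdist m (k x') (k x) \<le> r'" using x'(1) k by (auto simp: C_def)
      moreover have "mdist m (k x) (k s) < r/2" using xE k by blast
      moreover have kL: "k \<in> L" using k Er by blast
      ultimately show ?thesis
        using mdist_triangle[OF Ls[OF kL x'X] Ls[OF kL, of x] Ls[OF kL, of s]] x Er(3) SX r'(2) by force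
    qed
    then have "x' \<in> C E s r" using x'X by (auto simp: C_def)
    then have "x' \<in> W \<inter> A" using Er(5) x'(2) x'X by (auto simp: A_def)
    moreover have "mdist m (l x') (l x) \<le> e/8" using x'(1) r'(3) by (auto simp: C_def)
    ultimately show ?thesis by blast
  qed
  obtain x' where x': "x' \<in> W \<inter> A" "mdist m (l x') (l x) \<le> e/8" using step[OF xyl(1) xE] by blast
  obtain y' where y': "y' \<in> W \<inter> A" "mdist m (l y') (l y) \<le> e/8" using step[OF xyl(2) yE] by blast
  have X: "x \<in> ?X" "y \<in> ?X" "x' \<in> ?X" "y' \<in> ?X" using xyl x' y' SX by (auto simp: A_def)
  note s = Ls[OF xyl(3) X(1)] Ls[OF xyl(3) X(2)] Ls[OF xyl(3) X(3)] Ls[OF xyl(3) X(4)]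
  have "mdist m (l x') (l y') < e/2" using W(3) xyl(3) x'(1) y'(1) by blast
  then show False
    using mdist_triangle[OF s(1,3,2)] mdist_triangle[OF s(3,4,2)] mdist_commute[of m "l x" "l x'"] x' y' xyl(4) \<open>e > 0\<close>
    by linarith
qed

subsection \<open>Cech-complete spaces and Cantor schemes\<close>

lemma regular_space_shrink:
  assumes "regular_space X" "openin X W" "x \<in> W"
  shows "\<exists>U. openin X U \<and> x \<in> U \<and> X closure_of U \<subseteq> W"
proof -
  have "neighbourhood_base_of (closedin X) X"
    using assms(1) neighbourhood_base_of_closedin by blast
  then obtain U V where "openin X U" "closedin X V" "x \<in> U" "U \<subseteq> V" "V \<subseteq> W"
    using assms(2,3) unfolding neighbourhood_base_of by meson
  then show ?thesis
    using closure_of_minimal[of U V X] by blast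
qed

text \<open>This is the internal form of Cech-completeness. If the image is the intersection of open
  sets \<open>W n\<close>, let the \<open>n\<close>-th cover consist of open sets whose images lie
  in closed subsets of \<open>W n\<close>. Finite subcovers at every level confine the closure of
  the image of \<open>D\<close> to all \<open>W n\<close>, hence to the image of
  \<open>X\<close>.\<close>

lemma Cech_complete_compact_cover:
  assumes "Cech_complete_space X"
  shows "\<exists>\<U>::nat \<Rightarrow> 'a set set. (\<forall>n. \<forall>U\<in>\<U> n. openin X U) \<and> (\<forall>n. topspace X \<subseteq> \<Union>(\<U> n)) \<and>
    (\<forall>D. closedin X D \<and> (\<forall>n. \<exists>\<V>. finite \<V> \<and> \<V> \<subseteq> \<U> n \<and> D \<subseteq> \<Union>\<V>) \<longrightarrow> compactin X D)"
proof -
  let ?B = "Stone_Cech X" and ?e = "Stone_Cech_map X"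
  let ?E = "?e ` topspace X"
  have emb: "embedding_map X ?B ?e"
    using assms Stone_Cech_map_embedding unfolding Cech_complete_space_def by blast
  have reg: "regular_space ?B"
    using compact_space_Stone_Cech Hausdorff_space_Stone_Cech compact_Hausdorff_imp_regular_space by blast
  have cont: "continuous_map X ?B ?e"
    using homeomorphic_imp_continuous_map[OF emb[unfolded embedding_map_def]]
    unfolding continuous_map_in_subtopology by (rule conjunct1)
  have EB: "?E \<subseteq> topspace ?B"
    using continuous_map_image_subset_topspace[OF cont] .
  have "(countable intersection_of openin ?B) ?E"
    using assms unfolding Cech_complete_space_def gdelta_in_alt by blast
  then obtain \<W> where \<W>: "countable \<W>" "\<And>S. S \<in> \<W> \<Longrightarrow> openin ?B S" "\<Inter>\<W> = ?E"
    unfolding intersection_of_def by blast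
  \<comment> \<open>Inserting the whole space makes the family nonempty, hence enumerable, without
    changing the intersection.\<close>
  define W where "W = from_nat_into (insert (topspace ?B) \<W>)"
  have rW: "range W = insert (topspace ?B) \<W>"
    unfolding W_def using \<W>(1) by (intro range_from_nat_into) auto
  have Wop: "openin ?B (W n)" for n
  proof -
    have "W n \<in> insert (topspace ?B) \<W>" using rW by blast
    then show ?thesis using \<W>(2) by auto
  qed
  have Wint: "(\<Inter>n. W n) = ?E"
    unfolding rW using \<W>(3) EB by auto
  define \<U> where "\<U> n = {U. openin X U \<and> (\<exists>K. closedin ?B K \<and> ?e ` U \<subseteq> K \<and> K \<subseteq> W n)}" for n
  have cover: "topspace X \<subseteq> \<Union>(\<U> n)" for n
  proof
    fix x assume x: "x \<in> topspace X"
    then have "?e x \<in> W n" using Wint by blast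
    then obtain V where V: "openin ?B V" "?e x \<in> V" "?B closure_of V \<subseteq> W n"
      using regular_space_shrink[OF reg Wop] by blast
    have "openin X {y \<in> topspace X. ?e y \<in> V}"
      using openin_continuous_map_preimage[OF cont V(1)] .
    moreover have "?e ` {y \<in> topspace X. ?e y \<in> V} \<subseteq> ?B closure_of V"
      using closure_of_subset[OF openin_subset[OF V(1)]] by blast
    ultimately have "{y \<in> topspace X. ?e y \<in> V} \<in> \<U> n"
      unfolding \<U>_def using V(3) closedin_closure_of by blast
    then show "x \<in> \<Union>(\<U> n)" using x V(2) by blast
  qed
  have comp: "compactin X D"
    if D: "closedin X D" and fin: "\<And>n. \<exists>\<V>. finite \<V> \<and> \<V> \<subseteq> \<U> n \<and> D \<subseteq> \<Union>\<V>" for D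
  proof -
    have DX: "D \<subseteq> topspace X" using closedin_subset[OF D] .
    have hom: "homeomorphic_map X (subtopology ?B ?E) ?e"
      using emb unfolding embedding_map_def .
    have sub: "?B closure_of (?e ` D) \<subseteq> W n" for n
    proof -
      obtain \<V> where \<V>: "finite \<V>" "\<V> \<subseteq> \<U> n" "D \<subseteq> \<Union>\<V>" using fin[of n] by (elim exE conjE)
      have "\<forall>V\<in>\<V>. \<exists>K. closedin ?B K \<and> ?e ` V \<subseteq> K \<and> K \<subseteq> W n"
        using \<V>(2) unfolding \<U>_def by blast
      then obtain K where K: "\<forall>V\<in>\<V>. closedin ?B (K V) \<and> ?e ` V \<subseteq> K V \<and> K V \<subseteq> W n"
        by (elim bchoice[THEN exE])
      have "closedin ?B (\<Union>(K ` \<V>))" using \<V>(1) K by (intro closedin_Union) auto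
      moreover have "?e ` D \<subseteq> \<Union>(K ` \<V>)" using \<V>(3) K by blast
      ultimately have "?B closure_of (?e ` D) \<subseteq> \<Union>(K ` \<V>)" by (intro closure_of_minimal)
      then show ?thesis using K by blast
    qed
    then have sub: "?B closure_of (?e ` D) \<subseteq> ?E" using Wint by blast
    have "closedin (subtopology ?B ?E) (?e ` D)"
      using homeomorphic_map_closedness[OF hom DX] D by blast
    then obtain K where K: "closedin ?B K" "?e ` D = K \<inter> ?E"
      by (auto simp: closedin_subtopology)
    have "?B closure_of (?e ` D) \<subseteq> K" using K by (intro closure_of_minimal) auto
    then have "?B closure_of (?e ` D) \<subseteq> ?e ` D" using sub K(2) by blast
    then have "closedin ?B (?e ` D)"
      using DX EB closure_of_subset_eq[of "?e ` D" ?B] by blast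
    then have "compactin ?B (?e ` D)"
      using closedin_compact_space compact_space_Stone_Cech by blast
    then have "compactin (subtopology ?B ?E) (?e ` D)"
      using DX by (simp add: compactin_subtopology image_mono)
    then show ?thesis
      using homeomorphic_map_compactness[OF hom DX] by blast
  qed
  show ?thesis
    by (intro exI[of _ \<U>] conjI allI impI) (use cover comp in \<open>auto simp: \<U>_def\<close>)
qed

lemma finite_oscillation_nbhd:
  assumes "finite E" and cont: "\<And>h. h \<in> E \<Longrightarrow> continuous_map X (mtopology_of m) h"
    and x: "x \<in> topspace X" and "r > 0"
  shows "\<exists>W. openin X W \<and> x \<in> W \<and> (\<forall>h\<in>E. \<forall>y\<in>W. mdist m (h y) (h x) < r)"
proof -
  have sp: "h x \<in> mspace m" if "h \<in> E" for h
    using continuous_map_funspace[OF cont[OF that]] x by auto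
  let ?W = "topspace X \<inter> \<Inter>((\<lambda>h. {y \<in> topspace X. mdist m (h y) (h x) < r}) ` E)"
  have "openin X {y \<in> topspace X. mdist m (h y) (h x) < r}" if "h \<in> E" for h
    using sp[OF that] by (intro openin_mdist_less[OF cont[OF that]]) auto
  then have "openin X ?W"
    using \<open>finite E\<close> by (intro openin_Int_Inter) auto
  moreover have "x \<in> ?W" using x sp \<open>r > 0\<close> by auto
  ultimately show ?thesis by (intro exI[of _ ?W]) auto
qed

text \<open>\<open>\<psi>\<close> is continuous only after composition with the \<open>g k\<close>,
  so its image is enlarged to the set \<open>K\<close> of points that the \<open>g k\<close> cannot
  tell from an image point. \<open>K\<close> is weakly closed, hence Lindelof, and maps continuously
  onto the Cantor space through the left inverse \<open>\<phi>\<close> of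
  \<open>\<psi>\<close>.\<close>

lemma Cantor_map_imp_not_Lindelof:
  fixes g :: "nat \<Rightarrow> 'a \<Rightarrow> 'b" and \<psi> :: "(nat \<Rightarrow> bool) \<Rightarrow> 'a"
  assumes comp: "compactin (pointwise_topology F (mtopology_of m)) H"
    and gH: "\<And>k. g k \<in> H"
    and approx: "\<And>h E e::real. h \<in> H \<Longrightarrow> finite E \<Longrightarrow> E \<subseteq> F \<Longrightarrow> e > 0 \<Longrightarrow> \<exists>k. \<forall>x\<in>E. mdist m (g k x) (h x) < e"
    and \<psi>F: "\<And>u. \<psi> u \<in> F"
    and cont: "\<And>k. continuous_map euclidean (mtopology_of m) (\<lambda>u. g k (\<psi> u))"
    and "e > 0" and sep: "\<And>u v. u \<noteq> v \<Longrightarrow> \<exists>k. mdist m (g k (\<psi> u)) (g k (\<psi> v)) \<ge> e"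
    and Lind: "Lindelof_space (weak_topology F (mtopology_of m) H)"
  shows False
proof -
  let ?Y = "mtopology_of m"
  let ?W = "weak_topology F ?Y H"
  have Hs: "h x \<in> mspace m" if "h \<in> H" "x \<in> F" for h x
    using compactin_subset_topspace[OF comp] that by auto
  have contH: "continuous_map ?W ?Y h" if "h \<in> H" for h
    using that Hs by (intro continuous_map_weak_topology) auto
  define K where "K = {x \<in> F. \<exists>u. \<forall>k. g k x = g k (\<psi> u)}"
  have Kcl: "closedin ?W K"
  proof -
    have "openin ?W (F - K)"
    proof (subst openin_subopen, intro ballI)
      fix x assume x: "x \<in> F - K"
      then have "\<forall>u. \<exists>k. g k x \<noteq> g k (\<psi> u)" by (auto simp: K_def)
      then obtain k where k: "\<And>u. g (k u) x \<noteq> g (k u) (\<psi> u)" by metis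
      \<comment> \<open>At half the distance, the balls around the two values are disjoint. Finitely
        many \<open>u\<close> cover the Cantor space, and their conditions cut out a weak
        neighbourhood of \<open>x\<close> that misses \<open>K\<close>.\<close>
      define r where "r u = mdist m (g (k u) x) (g (k u) (\<psi> u)) / 2" for u
      have r: "r u > 0" for u
        using k[of u] mdist_nonneg[of m "g (k u) x" "g (k u) (\<psi> u)"] Hs[OF gH, of x] Hs[OF gH \<psi>F] x
        by (auto simp: r_def less_le)
      define B where "B u = {v. mdist m (g (k u) (\<psi> v)) (g (k u) (\<psi> u)) < r u}" for u
      have op: "openin euclidean (B u)" for u
        using openin_mdist_less[OF cont[of "k u"], of "\<lambda>_. g (k u) (\<psi> u)" "r u"] Hs[OF gH \<psi>F]
        by (simp add: B_def)
      have uB: "u \<in> B u" for u using r Hs[OF gH \<psi>F] by (simp add: B_def)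
      have "compactin (euclidean :: (nat \<Rightarrow> bool) topology) UNIV"
        using compact_space_Cantor by (simp add: compact_space_def)
      then obtain \<F> where \<F>: "finite \<F>" "\<F> \<subseteq> range B" "UNIV \<subseteq> \<Union>\<F>"
        using compactinD[of euclidean UNIV "range B"] op uB by blast
      then obtain D where D: "finite D" "\<F> = B ` D" by (meson finite_subset_image)
      define N where "N = F \<inter> \<Inter>((\<lambda>u. {y \<in> F. mdist m (g (k u) y) (g (k u) x) < r u}) ` D)"
      have "openin ?W {y \<in> F. mdist m (g (k u) y) (g (k u) x) < r u}" for u
        using openin_mdist_less[OF contH[OF gH], of "\<lambda>_. g (k u) x"] Hs[OF gH, of x] x by simp
      then have "openin ?W N"
        unfolding N_def using D(1) openin_topspace[of ?W] by (intro openin_Int_Inter) auto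
      moreover have "x \<in> N" using x r Hs[OF gH, of x] by (auto simp: N_def)
      moreover have "N \<subseteq> F - K"
      proof
        fix y assume y: "y \<in> N"
        have yF: "y \<in> F" using y by (simp add: N_def)
        have "y \<notin> K"
        proof
          assume "y \<in> K"
          then obtain v where v: "\<And>j. g j y = g j (\<psi> v)" by (auto simp: K_def)
          obtain u where u: "u \<in> D" "v \<in> B u" using \<F>(3) D(2) by blast
          have 1: "mdist m (g (k u) (\<psi> v)) (g (k u) (\<psi> u)) < r u" using u(2) by (simp add: B_def)
          have 2: "mdist m (g (k u) (\<psi> v)) (g (k u) x) < r u" using y u(1) v by (auto simp: N_def)
          have "x \<in> F" using x by blast
          then show False
            using mdist_triangle[OF Hs[OF gH[of "k u"], of x] Hs[OF gH[of "k u"] \<psi>F[of v]] Hs[OF gH[of "k u"] \<psi>F[of u]]] 1 2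
              mdist_commute[of m "g (k u) x" "g (k u) (\<psi> v)"] by (simp add: r_def)
        qed
        then show "y \<in> F - K" using yF by blast
      qed
      ultimately show "\<exists>T. openin ?W T \<and> x \<in> T \<and> T \<subseteq> F - K" by blast
    qed
    then show ?thesis unfolding closedin_def by (auto simp: K_def)
  qed
  define \<phi> where "\<phi> x = (SOME u. \<forall>k. g k x = g k (\<psi> u))" for x
  have \<phi>: "g k x = g k (\<psi> (\<phi> x))" if "x \<in> K" for x k
  proof -
    have "\<exists>u. \<forall>k. g k x = g k (\<psi> u)" using that by (simp add: K_def)
    then have "\<forall>k. g k x = g k (\<psi> (\<phi> x))" unfolding \<phi>_def by (rule someI_ex)
    then show ?thesis by blast
  qed
  have \<psi>K: "\<psi> u \<in> K" for u using \<psi>F by (auto simp: K_def)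
  have \<phi>\<psi>: "\<phi> (\<psi> u) = u" for u
  proof (rule ccontr)
    assume "\<phi> (\<psi> u) \<noteq> u"
    then obtain k where "mdist m (g k (\<psi> (\<phi> (\<psi> u)))) (g k (\<psi> u)) \<ge> e" using sep by blast
    then show False using \<phi>[OF \<psi>K[of u], of k] Hs[OF gH \<psi>F] \<open>e > 0\<close> by simp
  qed
  \<comment> \<open>A single \<open>g k\<close> approximates \<open>h\<close> at both points, and
    \<open>g k\<close> takes equal values there.\<close>
  have h\<phi>: "h x = h (\<psi> (\<phi> x))" if h: "h \<in> H" and x: "x \<in> K" for h x
  proof -
    have xF: "x \<in> F" using x by (simp add: K_def)
    have "mdist m (h x) (h (\<psi> (\<phi> x))) \<le> 0"
    proof (rule field_le_epsilon)
      fix d :: real assume "d > 0"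
      then have "\<exists>k. \<forall>y\<in>{x, \<psi> (\<phi> x)}. mdist m (g k y) (h y) < d/2"
        using h xF \<psi>F by (intro approx) auto
      then obtain k where "mdist m (g k x) (h x) < d/2" "mdist m (g k x) (h (\<psi> (\<phi> x))) < d/2"
        using \<phi>[OF x] by auto
      then show "mdist m (h x) (h (\<psi> (\<phi> x))) \<le> 0 + d"
        using mdist_triangle[OF Hs[OF h xF] Hs[OF gH[of k] xF] Hs[OF h \<psi>F[of "\<phi> x"]]] mdist_commute[of m "h x" "g k x"] by linarith
    qed
    then have "mdist m (h x) (h (\<psi> (\<phi> x))) = 0" using mdist_nonneg[of m "h x" "h (\<psi> (\<phi> x))"] by linarith
    then show ?thesis using mdist_zero[OF Hs[OF h xF] Hs[OF h \<psi>F]] by blast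
  qed
  define H' where "H' = (\<lambda>h u. h (\<psi> u)) ` H"
  let ?W' = "weak_topology UNIV ?Y H'"
  have KF: "K \<subseteq> F" by (auto simp: K_def)
  have cont\<phi>: "continuous_map (subtopology ?W K) ?W' \<phi>"
    unfolding weak_topology_def[of UNIV]
  proof (rule continuous_on_generated_topo)
    fix U assume "U \<in> insert UNIV {h -` U \<inter> UNIV |h U. h \<in> H' \<and> openin ?Y U}"
    then consider "U = UNIV" | h V where "h \<in> H" "openin ?Y V" "U = (\<lambda>u. h (\<psi> u)) -` V"
      unfolding H'_def by auto
    then show "openin (subtopology ?W K) (\<phi> -` U \<inter> topspace (subtopology ?W K))"
    proof cases
      case 1
      then show ?thesis using openin_topspace[of "subtopology ?W K"] by simp
    next
      case 2
      have "openin ?W {x \<in> F. h x \<in> V}"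
        using openin_continuous_map_preimage[OF contH[OF 2(1)] 2(2)] by simp
      moreover have "\<phi> -` U \<inter> topspace (subtopology ?W K) = {x \<in> F. h x \<in> V} \<inter> K"
        using h\<phi>[OF 2(1)] KF unfolding 2(3) by auto
      ultimately show ?thesis unfolding openin_subtopology by blast
    qed
  qed auto
  have LW': "Lindelof_space ?W'"
  proof (rule Lindelof_space_continuous_map_image[OF _ cont\<phi>])
    show "Lindelof_space (subtopology ?W K)" using Lind Kcl by (rule Lindelof_space_closedin_subtopology)
    have "u \<in> \<phi> ` (F \<inter> K)" for u using \<phi>\<psi>[of u] \<psi>K[of u] KF by force
    then show "\<phi> ` topspace (subtopology ?W K) = topspace ?W'" by auto
  qed
  have "continuous_map (pointwise_topology F ?Y) (pointwise_topology UNIV ?Y) (\<lambda>h u. h (\<psi> u))"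
    unfolding pointwise_topology_def continuous_map_componentwise_UNIV
    using \<psi>F by (auto intro: continuous_map_product_projection)
  then have comp': "compactin (pointwise_topology UNIV ?Y) H'"
    unfolding H'_def by (rule image_compactin[OF comp])
  show False
    by (rule Cantor_separated_imp_not_Lindelof[where l = "\<lambda>k u. g k (\<psi> u)" and H = H' and e = e and m = m])
      (use cont comp' gH LW' \<open>e > 0\<close> sep in \<open>auto simp: H'_def\<close>)
qed

text \<open>A Baire category argument: if small pieces could always be found, nested open sets with
  oscillation tending to 0, whose closures refine the covers \<open>\<U> n\<close>, would meet in an
  equicontinuity point inside any prescribed open set.\<close>

lemma not_hereditarily_almost_equicontinuous_oscillation:
  assumes reg: "regular_space X" and haus: "Hausdorff_space X"
    and Uop: "\<And>n U. U \<in> \<U> n \<Longrightarrow> openin X U" and Ucov: "\<And>n::nat. topspace X \<subseteq> \<Union>(\<U> n)"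
    and Ucomp: "\<And>D. closedin X D \<Longrightarrow> (\<And>n. \<exists>\<V>. finite \<V> \<and> \<V> \<subseteq> \<U> n \<and> D \<subseteq> \<Union>\<V>) \<Longrightarrow> compactin X D"
    and not_hae: "\<not> hereditarily_almost_equicontinuous X m G"
  shows "\<exists>A V e. closedin X A \<and> openin X V \<and> V \<inter> A \<noteq> {} \<and> e > 0 \<and>
     (\<forall>W. openin X W \<longrightarrow> W \<subseteq> V \<longrightarrow> W \<inter> A \<noteq> {} \<longrightarrow>
        (\<exists>g\<in>G. \<exists>x\<in>W \<inter> A. \<exists>y\<in>W \<inter> A. mdist m (g x) (g y) \<ge> e))"
proof (rule ccontr)
  assume no: "\<not> ?thesis"
  define osc where "osc W A e \<longleftrightarrow> (\<exists>g\<in>G. \<exists>x\<in>W \<inter> A. \<exists>y\<in>W \<inter> A. mdist m (g x) (g y) \<ge> e)" for W A e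
  have no_osc: "\<not> (\<exists>A V e. closedin X A \<and> openin X V \<and> V \<inter> A \<noteq> {} \<and> e > 0 \<and>
     (\<forall>W. openin X W \<longrightarrow> W \<subseteq> V \<longrightarrow> W \<inter> A \<noteq> {} \<longrightarrow> osc W A e))"
    using no unfolding osc_def .
  have small: "\<exists>W. openin X W \<and> W \<subseteq> V \<and> W \<inter> A \<noteq> {} \<and> (\<forall>g\<in>G. \<forall>x\<in>W \<inter> A. \<forall>y\<in>W \<inter> A. mdist m (g x) (g y) < e)"
    if AV: "closedin X A" "openin X V" "V \<inter> A \<noteq> {}" "e > 0" for A V e
  proof -
    have "\<not> (\<forall>W. openin X W \<longrightarrow> W \<subseteq> V \<longrightarrow> W \<inter> A \<noteq> {} \<longrightarrow> osc W A e)"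
    proof
      assume "\<forall>W. openin X W \<longrightarrow> W \<subseteq> V \<longrightarrow> W \<inter> A \<noteq> {} \<longrightarrow> osc W A e"
      with AV have "closedin X A \<and> openin X V \<and> V \<inter> A \<noteq> {} \<and> e > 0 \<and>
          (\<forall>W. openin X W \<longrightarrow> W \<subseteq> V \<longrightarrow> W \<inter> A \<noteq> {} \<longrightarrow> osc W A e)" by (intro conjI)
      then have "\<exists>A V e. closedin X A \<and> openin X V \<and> V \<inter> A \<noteq> {} \<and> e > 0 \<and>
          (\<forall>W. openin X W \<longrightarrow> W \<subseteq> V \<longrightarrow> W \<inter> A \<noteq> {} \<longrightarrow> osc W A e)" by (intro exI)
      with no_osc show False by contradiction
    qed
    then obtain W where W: "openin X W" "W \<subseteq> V" "W \<inter> A \<noteq> {}" "\<not> osc W A e" by auto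
    have "\<forall>g\<in>G. \<forall>x\<in>W \<inter> A. \<forall>y\<in>W \<inter> A. mdist m (g x) (g y) < e"
      using W(4) unfolding osc_def by (simp add: not_le)
    then show ?thesis using W by (intro exI[of _ W] conjI)
  qed
  have finite_closed: "closedin X S" if "finite S" "S \<subseteq> topspace X" for S
    using Hausdorff_imp_t1_space[OF haus] that by (simp add: t1_space_closedin_finite)
  have dense: "\<exists>y\<in>V. equicontinuity_point (subtopology X A) m (restrict_functions G A) y"
    if A: "closedin X A" and V: "openin X V" "V \<inter> A \<noteq> {}" for A V
  proof -
    have AX: "A \<subseteq> topspace X" using closedin_subset[OF A] .
    define P where "P n W \<longleftrightarrow> openin X W \<and> W \<inter> A \<noteq> {} \<and> W \<subseteq> V" for n :: nat and W
    define Q where "Q n W W' \<longleftrightarrow> X closure_of W' \<subseteq> W \<and> (\<exists>U\<in>\<U> n. X closure_of W' \<subseteq> U) \<and>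
       (\<forall>g\<in>G. \<forall>x\<in>W' \<inter> A. \<forall>y\<in>W' \<inter> A. mdist m (g x) (g y) < inverse (real (Suc n)))" for n W W'
    have "\<exists>f. \<forall>n. P n (f n) \<and> Q n (f n) (f (Suc n))"
    proof (rule dependent_nat_choice)
      show "\<exists>W. P 0 W" using V unfolding P_def by blast
      fix W n assume W: "P n W"
      then obtain x where x: "x \<in> W" "x \<in> A" "openin X W" by (auto simp: P_def)
      obtain U where U: "U \<in> \<U> n" "x \<in> U" using Ucov[of n] x AX by blast
      have "openin X (W \<inter> U)" using x(3) Uop[OF U(1)] by (rule openin_Int)
      then obtain W1 where W1: "openin X W1" "x \<in> W1" "X closure_of W1 \<subseteq> W \<inter> U"
        using regular_space_shrink[OF reg, of "W \<inter> U" x] x U by auto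
      have "W1 \<inter> A \<noteq> {}" using W1 x by blast
      from small[OF A W1(1) this, of "inverse (real (Suc n))"]
      obtain W2 where W2: "openin X W2" "W2 \<subseteq> W1" "W2 \<inter> A \<noteq> {}"
        "\<forall>g\<in>G. \<forall>x\<in>W2 \<inter> A. \<forall>y\<in>W2 \<inter> A. mdist m (g x) (g y) < inverse (real (Suc n))" by auto
      have cl: "X closure_of W2 \<subseteq> W \<inter> U" using closure_of_mono[OF W2(2), of X] W1(3) by blast
      have "W2 \<subseteq> W" using cl closure_of_subset[OF openin_subset[OF W2(1)]] by blast
      then have "P (Suc n) W2" using W W2(1,3) by (auto simp: P_def)
      moreover have "Q n W W2" unfolding Q_def
        using cl U(1) W2(4) by (intro conjI bexI[of _ U]) auto
      ultimately show "\<exists>W'. P (Suc n) W' \<and> Q n W W'" by (intro exI[of _ W2] conjI)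
    qed
    then obtain f where f: "\<And>n. P n (f n)" "\<And>n. Q n (f n) (f (Suc n))" by blast
    have fop: "openin X (f n)" and fA: "f n \<inter> A \<noteq> {}" and fV: "f n \<subseteq> V" for n
      using f(1)[of n] by (auto simp: P_def)
    have fcl: "X closure_of f (Suc n) \<subseteq> f n" and fU: "\<exists>U\<in>\<U> n. X closure_of f (Suc n) \<subseteq> U"
      and fs: "\<forall>g\<in>G. \<forall>x\<in>f (Suc n) \<inter> A. \<forall>y\<in>f (Suc n) \<inter> A. mdist m (g x) (g y) < inverse (real (Suc n))" for n
      using f(2)[of n] by (auto simp: Q_def)
    have sub: "f n \<subseteq> X closure_of f n" for n
      using closure_of_subset[OF openin_subset[OF fop]] .
    have "decseq f"
      by (rule decseq_SucI) (use fcl sub in blast)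
    then have dec: "f k \<subseteq> f n" if "n \<le> k" for n k
      using that unfolding decseq_def by blast
    have "\<forall>n. \<exists>y. y \<in> f n \<inter> A" using fA by blast
    then obtain x where "\<forall>n. x n \<in> f n \<inter> A" by (elim choice[THEN exE])
    then have x: "x n \<in> f n \<inter> A" for n by (rule spec)
    \<comment> \<open>A closure of \<open>f n\<close> is finitely covered at some levels only, so
      the compact set is built from one point of each \<open>f n\<close>: at level \<open>n\<close>
      all but finitely many of them lie in one member of the cover.\<close>
    define D where "D = X closure_of (range x)"
    have rX: "range x \<subseteq> topspace X" using x AX by blast
    have DA: "D \<subseteq> A" unfolding D_def using x A by (intro closure_of_minimal) auto
    have xD: "x n \<in> D" for n unfolding D_def using closure_of_subset[OF rX] by blast
    have Dcl: "closedin X D" by (simp add: D_def)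
    have comp: "compactin X D"
    proof (rule Ucomp[OF Dcl])
      fix n
      have "\<forall>k. \<exists>U. U \<in> \<U> n \<and> x k \<in> U" using Ucov[of n] rX by blast
      then obtain u where u: "\<forall>k. u k \<in> \<U> n \<and> x k \<in> u k" by (elim choice[THEN exE])
      obtain U where U: "U \<in> \<U> n" "X closure_of f (Suc n) \<subseteq> U" using fU by blast
      have "closedin X (x ` {..n} \<union> X closure_of f (Suc n))"
        using rX by (intro closedin_Un finite_closed closedin_closure_of) auto
      moreover have "range x \<subseteq> x ` {..n} \<union> X closure_of f (Suc n)"
      proof
        fix y assume "y \<in> range x"
        then obtain k where k: "y = x k" by blast
        show "y \<in> x ` {..n} \<union> X closure_of f (Suc n)"
        proof (cases "k \<le> n")
          case False
          then have "x k \<in> f (Suc n)" using x[of k] dec[of "Suc n" k] by auto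
          then show ?thesis using sub k by blast
        qed (use k in auto)
      qed
      ultimately have "D \<subseteq> x ` {..n} \<union> X closure_of f (Suc n)"
        unfolding D_def by (intro closure_of_minimal)
      also have "\<dots> \<subseteq> \<Union>(insert U (u ` {..n}))" using U u by auto
      finally show "\<exists>\<V>. finite \<V> \<and> \<V> \<subseteq> \<U> n \<and> D \<subseteq> \<Union>\<V>"
        using U u by (intro exI[of _ "insert U (u ` {..n})"]) auto
    qed
    define C where "C k = X closure_of f (Suc k) \<inter> D" for k
    have "(\<Inter>k. C k) \<noteq> {}"
    proof (rule compact_space_imp_nest)
      show "compact_space (subtopology X D)" using comp by (rule compact_space_subtopology)
      show "closedin (subtopology X D) (C k)" for k
        unfolding C_def closedin_subtopology by (rule exI[of _ "X closure_of f (Suc k)"]) simp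
      show "C k \<noteq> {}" for k using x[of "Suc k"] sub[of "Suc k"] xD[of "Suc k"] by (auto simp: C_def)
      show "decseq C"
      proof (rule decseq_SucI)
        fix k
        show "C (Suc k) \<subseteq> C k"
          unfolding C_def using closure_of_mono[OF dec[of "Suc k" "Suc (Suc k)"], of X] by auto
      qed
    qed
    then obtain y where y: "\<And>k. y \<in> C k" by blast
    have yf: "y \<in> f n" for n using y[of n] fcl[of n] by (auto simp: C_def)
    have yA: "y \<in> A" using y[of 0] DA by (auto simp: C_def)
    have "equicontinuity_point (subtopology X A) m (restrict_functions G A) y"
      unfolding equicontinuity_point_def
    proof (intro conjI allI impI)
      show "y \<in> topspace (subtopology X A)" using yA AX by auto
      fix \<epsilon> :: real assume "\<epsilon> > 0"
      obtain n where n: "inverse (real (Suc n)) < \<epsilon>" using reals_Archimedean \<open>\<epsilon> > 0\<close> by blast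
      have "mdiameter m (g ` (f (Suc n) \<inter> A)) < ennreal \<epsilon>" if g: "g \<in> restrict_functions G A" for g
      proof (rule mdiameter_less[OF _ \<open>\<epsilon> > 0\<close> n])
        fix a b assume ab: "a \<in> g ` (f (Suc n) \<inter> A)" "b \<in> g ` (f (Suc n) \<inter> A)"
        obtain g' where g': "g' \<in> G" "g = restrict g' A" using g by (auto simp: restrict_functions_def)
        obtain c d where cd: "c \<in> f (Suc n) \<inter> A" "a = g' c" "d \<in> f (Suc n) \<inter> A" "b = g' d"
          using ab g' by auto
        then show "mdist m a b \<le> inverse (real (Suc n))" using fs[of n] g'(1) by (simp add: less_imp_le)
      qed
      moreover have "openin (subtopology X A) (f (Suc n) \<inter> A)"
        using fop unfolding openin_subtopology by blast
      ultimately show "\<exists>U. openin (subtopology X A) U \<and> y \<in> U \<and>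
          (\<forall>g\<in>restrict_functions G A. mdiameter m (g ` U) < ennreal \<epsilon>)"
        using yf yA by (intro exI[of _ "f (Suc n) \<inter> A"]) auto
    qed
    then show ?thesis using yf[of 0] fV by blast
  qed
  have "hereditarily_almost_equicontinuous X m G"
    unfolding hereditarily_almost_equicontinuous_def almost_equicontinuous_def
  proof (intro allI impI)
    fix A assume A: "closedin X A \<and> A \<noteq> {}"
    let ?T = "subtopology X A"
    let ?E = "{x. equicontinuity_point ?T m (restrict_functions G A) x}"
    have top: "topspace ?T = A" using closedin_subset A by fastforce
    have "x \<in> ?T closure_of ?E" if x: "x \<in> A" for x
      unfolding in_closure_of
    proof (intro conjI allI impI)
      show "x \<in> topspace ?T" using x top by simp
      fix W assume W: "x \<in> W \<and> openin ?T W"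
      then obtain V where V: "openin X V" "W = V \<inter> A" by (auto simp: openin_subtopology)
      have "V \<inter> A \<noteq> {}" using W V by auto
      then obtain y where y: "y \<in> V" "equicontinuity_point ?T m (restrict_functions G A) y"
        using dense[of A V] A V(1) by auto
      then have "y \<in> topspace ?T" unfolding equicontinuity_point_def by (rule_tac conjunct1)
      then show "\<exists>y. y \<in> ?E \<and> y \<in> W" using y V top by auto
    qed
    then show "?T closure_of ?E = topspace ?T"
      using closure_of_subset_topspace[of ?T ?E] top by auto
  qed
  then show False using not_hae by contradiction
qed

text \<open>The recursion treats all words of one length together, because on the children of
  \<open>s\<close> every earlier \<open>g t\<close> must oscillate little, not only those along the
  path to \<open>s\<close>. This makes each \<open>g t\<close> continuous along the resulting Cantor
  set.\<close>

lemma Cantor_scheme: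
  fixes G :: "('a \<Rightarrow> 'b) set" and \<U> :: "nat \<Rightarrow> 'a set set"
  assumes reg: "regular_space X"
    and Uop: "\<And>n U. U \<in> \<U> n \<Longrightarrow> openin X U" and Ucov: "\<And>n. topspace X \<subseteq> \<Union>(\<U> n)"
    and G: "\<And>g. g \<in> G \<Longrightarrow> continuous_map X (mtopology_of m) g"
    and A: "closedin X A" and V: "openin X V" "V \<inter> A \<noteq> {}" and "e > 0"
    and osc: "\<And>W. openin X W \<Longrightarrow> W \<subseteq> V \<Longrightarrow> W \<inter> A \<noteq> {} \<Longrightarrow>
        \<exists>g\<in>G. \<exists>x\<in>W \<inter> A. \<exists>y\<in>W \<inter> A. mdist m (g x) (g y) \<ge> e"
  shows "\<exists>(U :: bool list \<Rightarrow> 'a set) g.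
     (\<forall>s. openin X (U s) \<and> U s \<inter> A \<noteq> {} \<and> g s \<in> G) \<and>
     (\<forall>s b. X closure_of U (s @ [b]) \<subseteq> U s \<and> (\<exists>M\<in>\<U> (length s). X closure_of U (s @ [b]) \<subseteq> M)) \<and>
     (\<forall>s. \<forall>x\<in>U (s @ [False]) \<inter> A. \<forall>y\<in>U (s @ [True]) \<inter> A. mdist m (g s x) (g s y) \<ge> e/2) \<and>
     (\<forall>s b t. length t \<le> length s \<longrightarrow> (\<forall>x\<in>U (s @ [b]) \<inter> A. \<forall>y\<in>U (s @ [b]) \<inter> A.
         mdist m (g t x) (g t y) \<le> inverse (real (Suc (length s)))))"
proof -
  have AX: "A \<subseteq> topspace X" using closedin_subset[OF A] .
  have Gs: "g x \<in> mspace m" if "g \<in> G" "x \<in> topspace X" for g x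
    using continuous_map_funspace[OF G[OF that(1)]] that(2) by auto
  \<comment> \<open>A state assigns data to all words, but stage \<open>n\<close> constrains only
    the sets at words of length \<open>n\<close> and the functions at shorter words.\<close>
  define P :: "nat \<Rightarrow> (bool list \<Rightarrow> 'a set) \<times> (bool list \<Rightarrow> 'a \<Rightarrow> 'b) \<Rightarrow> bool"
    where "P n st \<longleftrightarrow> (\<forall>s. length s = n \<longrightarrow> openin X (fst st s) \<and> fst st s \<subseteq> V \<and> fst st s \<inter> A \<noteq> {}) \<and>
      (\<forall>t. length t < n \<longrightarrow> snd st t \<in> G)" for n st
  define R1 :: "nat \<Rightarrow> bool list \<Rightarrow> 'a set \<Rightarrow> 'a set \<Rightarrow> (bool list \<Rightarrow> 'a \<Rightarrow> 'b) \<Rightarrow> bool"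
    where "R1 n s W W' g \<longleftrightarrow> X closure_of W' \<subseteq> W \<and> (\<exists>M\<in>\<U> n. X closure_of W' \<subseteq> M) \<and>
      (\<forall>t. length t \<le> n \<longrightarrow> (\<forall>x\<in>W' \<inter> A. \<forall>y\<in>W' \<inter> A. mdist m (g t x) (g t y) \<le> inverse (real (Suc n))))"
    for n s W W' g
  define R2 :: "'a set \<Rightarrow> 'a set \<Rightarrow> ('a \<Rightarrow> 'b) \<Rightarrow> bool"
    where "R2 W0 W1 g \<longleftrightarrow> (\<forall>x\<in>W0 \<inter> A. \<forall>y\<in>W1 \<inter> A. mdist m (g x) (g y) \<ge> e/2)" for W0 W1 g
  define R :: "nat \<Rightarrow> (bool list \<Rightarrow> 'a set) \<times> (bool list \<Rightarrow> 'a \<Rightarrow> 'b) \<Rightarrow> (bool list \<Rightarrow> 'a set) \<times> (bool list \<Rightarrow> 'a \<Rightarrow> 'b) \<Rightarrow> bool"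
    where "R n st st' \<longleftrightarrow> (\<forall>t. length t < n \<longrightarrow> snd st' t = snd st t) \<and>
      (\<forall>s. length s = n \<longrightarrow> (\<forall>b. R1 n s (fst st s) (fst st' (s @ [b])) (snd st')) \<and>
          R2 (fst st' (s @ [False])) (fst st' (s @ [True])) (snd st' s))" for n st st'
  have "\<exists>f. \<forall>n. P n (f n) \<and> R n (f n) (f (Suc n))"
  proof (rule dependent_nat_choice)
    \<comment> \<open>No word is shorter than 0, so the initial functions are arbitrary.\<close>
    show "\<exists>st. P 0 st"
      using V by (intro exI[of _ "(\<lambda>_. V, \<lambda>_. undefined)"]) (simp add: P_def)
    fix st n assume st: "P n st"
    define Z where "Z s g x y \<longleftrightarrow> g \<in> G \<and> x \<in> fst st s \<inter> A \<and> y \<in> fst st s \<inter> A \<and> mdist m (g x) (g y) \<ge> e" for s g x y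
    have "\<forall>s. \<exists>g x y. length s = n \<longrightarrow> Z s g x y"
    proof
      fix s
      show "\<exists>g x y. length s = n \<longrightarrow> Z s g x y"
      proof (cases "length s = n")
        case True
        then show ?thesis using osc[of "fst st s"] st unfolding P_def Z_def by blast
      qed simp
    qed
    then obtain h x0 x1 where h: "\<And>s. length s = n \<Longrightarrow> Z s (h s) (x0 s) (x1 s)" by metis
    define pt where "pt s b = (if b then x1 s else x0 s)" for s and b :: bool
    have pt: "pt s b \<in> fst st s \<inter> A" if "length s = n" for s b
      using h[OF that] by (auto simp: Z_def pt_def)
    define g' where "g' t = (if length t = n then h t else snd st t)" for t
    have g'G: "g' t \<in> G" if "length t \<le> n" for t
      using that h[of t] st by (auto simp: g'_def Z_def P_def)
    define E where "E = g' ` {t. length t \<le> n}"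
    have finE: "finite E"
      unfolding E_def using finite_lists_length_le[of "UNIV :: bool set" n] by simp
    \<comment> \<open>The two bounds serve separation, \<open>e - 2 * r \<ge> e/2\<close>, and
      oscillation, \<open>2 * r \<le> 1/(n+1)\<close>.\<close>
    define r where "r = min (e/4) (inverse (real (Suc n)) / 2)"
    have r: "r > 0" "r \<le> e/4" "2 * r \<le> inverse (real (Suc n))" using \<open>e > 0\<close> by (auto simp: r_def)
    define Y where "Y s b W \<longleftrightarrow> openin X W \<and> pt s b \<in> W \<and> X closure_of W \<subseteq> fst st s \<and> (\<exists>M\<in>\<U> n. X closure_of W \<subseteq> M) \<and>
        (\<forall>k\<in>E. \<forall>y\<in>W. mdist m (k y) (k (pt s b)) < r)" for s b W
    have ex: "\<exists>W. length s = n \<longrightarrow> Y s b W" for s b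
    proof (cases "length s = n")
      case True
      have ptX: "pt s b \<in> topspace X" using pt[OF True] AX by blast
      obtain O1 where O1: "openin X O1" "pt s b \<in> O1" "\<forall>k\<in>E. \<forall>y\<in>O1. mdist m (k y) (k (pt s b)) < r"
        using finite_oscillation_nbhd[OF finE, of X m "pt s b" r] G g'G ptX r(1) by (auto simp: E_def)
      obtain M where M: "M \<in> \<U> n" "pt s b \<in> M" using Ucov[of n] ptX by blast
      have sop: "openin X (fst st s)" using st True by (simp add: P_def)
      have "openin X (O1 \<inter> (M \<inter> fst st s))" using O1(1) Uop[OF M(1)] sop by (intro openin_Int)
      then obtain W where W: "openin X W" "pt s b \<in> W" "X closure_of W \<subseteq> O1 \<inter> (M \<inter> fst st s)"
        using regular_space_shrink[OF reg, of "O1 \<inter> (M \<inter> fst st s)" "pt s b"] O1(2) M(2) pt[OF True] by auto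
      have "W \<subseteq> O1" using W(3) closure_of_subset[OF openin_subset[OF W(1)]] by blast
      then have "Y s b W" unfolding Y_def using W O1(3) M(1) by blast
      then show ?thesis by blast
    qed simp
    then obtain N where N: "\<And>s b. length s = n \<Longrightarrow> Y s b (N s b)" by metis
    define U' where "U' u = N (butlast u) (last u)" for u :: "bool list"
    have U': "U' (s @ [b]) = N s b" for s b by (simp add: U'_def)
    have NW: "N s b \<subseteq> X closure_of N s b" if "length s = n" for s b
    proof -
      have "openin X (N s b)" using N[OF that, of b] by (simp add: Y_def)
      then show ?thesis by (intro closure_of_subset openin_subset)
    qed
    have NX: "N s b \<subseteq> topspace X" if "length s = n" for s b
      using N[OF that] openin_subset unfolding Y_def by blast
    have near: "mdist m (g' t y) (g' t (pt s b)) < r" if "length s = n" "length t \<le> n" "y \<in> N s b" for s t b y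
      using N[OF that(1)] that(2,3) unfolding Y_def E_def by blast
    have "P (Suc n) (U', g')"
      unfolding P_def
    proof (intro conjI allI impI)
      fix s :: "bool list" assume "length s = Suc n"
      then obtain s' b where s: "s = s' @ [b]" "length s' = n"
        by (metis append_butlast_last_id diff_Suc_1 length_butlast length_greater_0_conv zero_less_Suc)
      note Y' = N[OF s(2), of b, unfolded Y_def]
      show "openin X (fst (U', g') s)" using Y' s U' by simp
      have "fst st s' \<subseteq> V" using st s(2) by (simp add: P_def)
      then show "fst (U', g') s \<subseteq> V" using Y' NW[OF s(2), of b] s(1) U' by auto
      show "fst (U', g') s \<inter> A \<noteq> {}" using Y' pt[OF s(2), of b] s(1) U' by auto
    next
      fix t :: "bool list" assume "length t < Suc n"
      then show "snd (U', g') t \<in> G" using g'G by simp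
    qed
    moreover have "R n st (U', g')"
      unfolding R_def
    proof (intro conjI allI impI)
      fix t :: "bool list" assume "length t < n"
      then show "snd (U', g') t = snd st t" by (simp add: g'_def)
    next
      fix s :: "bool list" and b assume s: "length s = n"
      have "mdist m (g' t x) (g' t y) \<le> inverse (real (Suc n))"
        if t: "length t \<le> n" and xy: "x \<in> N s b" "y \<in> N s b" for t x y
      proof -
        have X: "x \<in> topspace X" "y \<in> topspace X" "pt s b \<in> topspace X"
          using NX[OF s, of b] xy pt[OF s, of b] AX by auto
        have "mdist m (g' t x) (g' t (pt s b)) < r" "mdist m (g' t y) (g' t (pt s b)) < r"
          using near[OF s t] xy by auto
        then show ?thesis
          using mdist_triangle[OF Gs[OF g'G[OF t] X(1)] Gs[OF g'G[OF t] X(3)] Gs[OF g'G[OF t] X(2)]]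
            mdist_commute[of m "g' t y" "g' t (pt s b)"] r(3) by linarith
      qed
      then show "R1 n s (fst st s) (fst (U', g') (s @ [b])) (snd (U', g'))"
        using N[OF s, of b] unfolding R1_def Y_def by (simp add: U')
    next
      fix s :: "bool list" assume s: "length s = n"
      have "mdist m (g' s x) (g' s y) \<ge> e/2" if xy: "x \<in> N s False" "y \<in> N s True" for x y
      proof -
        have sn: "length s \<le> n" using s by simp
        have X: "x \<in> topspace X" "y \<in> topspace X" "x0 s \<in> topspace X" "x1 s \<in> topspace X"
          using NX[OF s] xy pt[OF s, of False] pt[OF s, of True] AX by (auto simp: pt_def)
        have a: "mdist m (g' s x) (g' s (x0 s)) < r" "mdist m (g' s y) (g' s (x1 s)) < r"
          using near[OF s sn xy(1)] near[OF s sn xy(2)] by (auto simp: pt_def)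
        have b: "mdist m (g' s (x0 s)) (g' s (x1 s)) \<ge> e" using h[OF s] s by (simp add: Z_def g'_def)
        note q = Gs[OF g'G[OF sn] X(1)] Gs[OF g'G[OF sn] X(2)] Gs[OF g'G[OF sn] X(3)] Gs[OF g'G[OF sn] X(4)]
        show ?thesis
          using mdist_triangle[OF q(3,1,4)] mdist_triangle[OF q(1,2,4)] a b r(2)
            mdist_commute[of m "g' s x" "g' s (x0 s)"] by linarith
      qed
      then show "R2 (fst (U', g') (s @ [False])) (fst (U', g') (s @ [True])) (snd (U', g') s)"
        unfolding R2_def by (simp add: U')
    qed
    ultimately show "\<exists>st'. P (Suc n) st' \<and> R n st st'" by blast
  qed
  then obtain f where f: "\<And>n. P n (f n)" "\<And>n. R n (f n) (f (Suc n))" by blast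
  \<comment> \<open>Sets are read off at the stage of their own level and functions one stage later,
    when they are first chosen; later stages keep the functions, by \<open>cons\<close>.\<close>
  define U where "U s = fst (f (length s)) s" for s
  define g where "g t = snd (f (Suc (length t))) t" for t
  have cons: "snd (f n) t = g t" if "length t < n" for n t
    using that
  proof (induction n)
    case (Suc n)
    show ?case
    proof (cases "length t = n")
      case False
      then have "length t < n" using Suc.prems by simp
      then show ?thesis using f(2)[of n] Suc.IH unfolding R_def by metis
    qed (simp add: g_def)
  qed simp
  have rel: "R1 (length s) s (U s) (U (s @ [b])) (snd (f (Suc (length s))))"
    "R2 (U (s @ [False])) (U (s @ [True])) (g s)" for s b
    using f(2)[of "length s"] by (simp_all add: R_def U_def g_def)
  show ?thesis
  proof (intro exI[of _ U] exI[of _ g] conjI allI)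
    fix s
    show "openin X (U s)" "U s \<inter> A \<noteq> {}" using f(1)[of "length s"] by (simp_all add: P_def U_def)
    show "g s \<in> G" using f(1)[of "Suc (length s)"] by (simp add: P_def g_def)
    show "\<forall>x\<in>U (s @ [False]) \<inter> A. \<forall>y\<in>U (s @ [True]) \<inter> A. mdist m (g s x) (g s y) \<ge> e/2"
      using rel(2)[of s] by (simp only: R2_def)
    fix b
    show "X closure_of U (s @ [b]) \<subseteq> U s" "\<exists>M\<in>\<U> (length s). X closure_of U (s @ [b]) \<subseteq> M"
      using rel(1)[of s b] by (simp_all add: R1_def)
    fix t
    show "length t \<le> length s \<longrightarrow> (\<forall>x\<in>U (s @ [b]) \<inter> A. \<forall>y\<in>U (s @ [b]) \<inter> A.
         mdist m (g t x) (g t y) \<le> inverse (real (Suc (length s))))"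
    proof
      assume t: "length t \<le> length s"
      then have "snd (f (Suc (length s))) t = g t" by (intro cons) simp
      then show "\<forall>x\<in>U (s @ [b]) \<inter> A. \<forall>y\<in>U (s @ [b]) \<inter> A.
         mdist m (g t x) (g t y) \<le> inverse (real (Suc (length s)))"
        using rel(1)[of s b] t unfolding R1_def by metis
    qed
  qed
qed

section \<open>From the Lindelof property back to hereditary almost equicontinuity\<close>

lemma open_cylinder: "open {v :: nat \<Rightarrow> bool. map v [0..<n] = map u [0..<n]}"
proof -
  have "{v :: nat \<Rightarrow> bool. map v [0..<n] = map u [0..<n]} = (\<Inter>i\<in>{..<n}. (\<lambda>v. v i) -` {u i})"
    by (auto simp: list_eq_iff_nth_eq)
  also have "open \<dots>"
    by (intro open_INT ballI open_vimage open_discrete continuous_on_product_coordinates) auto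
  finally show ?thesis .
qed

lemma pointwise_closure_mono_compact:
  assumes "compactin (pointwise_topology S Y) (pointwise_closure S Y G)" "L \<subseteq> G"
  shows "compactin (pointwise_topology S Y) (pointwise_closure S Y L)"
  using assms closed_compactin[OF assms(1) closure_of_mono[OF assms(2), of "pointwise_topology S Y", folded pointwise_closure_def]]
  by (simp add: pointwise_closure_def)

text \<open>One point in each set of the scheme suffices: the closure of these countably many points
  is separable by construction, compact by the cover criterion, and contains a point on every
  branch.\<close>

lemma Lindelof_imp_hereditarily_almost_equicontinuous:
  fixes X :: "'a topology" and m :: "'b metric" and G :: "('a \<Rightarrow> 'b) set"
  assumes Cech: "Cech_complete_space X"
    and G: "G \<subseteq> continuous_functions X (mtopology_of m)"
    and comp: "compactin (pointwise_topology (topspace X) (mtopology_of m)) (pointwise_closure (topspace X) (mtopology_of m) G)"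
    and Lind: "\<And>L F. L \<subseteq> G \<Longrightarrow> countable L \<Longrightarrow> compactin X F \<Longrightarrow> separable_space (subtopology X F) \<Longrightarrow>
        Lindelof_space (weak_topology F (mtopology_of m)
           (restrict_functions (pointwise_closure (topspace X) (mtopology_of m) L) F))"
  shows "hereditarily_almost_equicontinuous X m G"
proof (rule ccontr)
  let ?Y = "mtopology_of m"
  assume not_hae: "\<not> ?thesis"
  have haus: "Hausdorff_space X" and reg: "regular_space X"
    using Cech completely_regular_imp_regular_space unfolding Cech_complete_space_def by auto
  have finite_closed: "closedin X S" if "finite S" "S \<subseteq> topspace X" for S
    using Hausdorff_imp_t1_space[OF haus] that by (simp add: t1_space_closedin_finite)
  obtain \<U> :: "nat \<Rightarrow> 'a set set" where \<U>: "\<forall>n. \<forall>U\<in>\<U> n. openin X U" "\<forall>n. topspace X \<subseteq> \<Union>(\<U> n)"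
    "\<forall>D. closedin X D \<and> (\<forall>n. \<exists>\<V>. finite \<V> \<and> \<V> \<subseteq> \<U> n \<and> D \<subseteq> \<Union>\<V>) \<longrightarrow> compactin X D"
    using Cech_complete_compact_cover[OF Cech] by (elim exE conjE)
  have "\<exists>A V e. closedin X A \<and> openin X V \<and> V \<inter> A \<noteq> {} \<and> e > 0 \<and>
     (\<forall>W. openin X W \<longrightarrow> W \<subseteq> V \<longrightarrow> W \<inter> A \<noteq> {} \<longrightarrow>
        (\<exists>g\<in>G. \<exists>x\<in>W \<inter> A. \<exists>y\<in>W \<inter> A. mdist m (g x) (g y) \<ge> e))"
    by (rule not_hereditarily_almost_equicontinuous_oscillation[OF reg haus _ _ _ not_hae, of \<U>]) (use \<U> in auto)
  then obtain A V e where A: "closedin X A" and V: "openin X V" "V \<inter> A \<noteq> {}" and "e > 0" and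
    osc: "\<forall>W. openin X W \<longrightarrow> W \<subseteq> V \<longrightarrow> W \<inter> A \<noteq> {} \<longrightarrow>
        (\<exists>g\<in>G. \<exists>x\<in>W \<inter> A. \<exists>y\<in>W \<inter> A. mdist m (g x) (g y) \<ge> e)"
    by (elim exE conjE)
  have AX: "A \<subseteq> topspace X" using closedin_subset[OF A] .
  have Gc: "continuous_map X ?Y g" "g \<in> extensional (topspace X)" if "g \<in> G" for g
    using subsetD[OF G that] by (simp_all add: continuous_functions_def)
  have Gs: "g x \<in> mspace m" if "g \<in> G" "x \<in> topspace X" for g x
    using continuous_map_funspace[OF Gc(1)[OF that(1)]] that(2) by auto
  obtain U :: "bool list \<Rightarrow> 'a set" and g where
    US: "\<forall>s. openin X (U s) \<and> U s \<inter> A \<noteq> {} \<and> g s \<in> G" and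
    Ucl: "\<forall>s b. X closure_of U (s @ [b]) \<subseteq> U s \<and> (\<exists>M\<in>\<U> (length s). X closure_of U (s @ [b]) \<subseteq> M)" and
    Usep: "\<forall>s. \<forall>x\<in>U (s @ [False]) \<inter> A. \<forall>y\<in>U (s @ [True]) \<inter> A. mdist m (g s x) (g s y) \<ge> e/2" and
    Uosc: "\<forall>s b t. length t \<le> length s \<longrightarrow> (\<forall>x\<in>U (s @ [b]) \<inter> A. \<forall>y\<in>U (s @ [b]) \<inter> A.
         mdist m (g t x) (g t y) \<le> inverse (real (Suc (length s))))"
  proof -
    have "\<exists>g\<in>G. \<exists>x\<in>W \<inter> A. \<exists>y\<in>W \<inter> A. mdist m (g x) (g y) \<ge> e"
      if "openin X W" "W \<subseteq> V" "W \<inter> A \<noteq> {}" for W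
      using osc that by simp
    note scheme = Cantor_scheme[where \<U> = \<U> and G = G and m = m and e = e and V = V,
        OF reg _ _ _ A V \<open>e > 0\<close> this]
    show ?thesis
      by (rule exE[OF scheme]) (use \<U>(1,2) Gc(1) in blast, use \<U>(1,2) Gc(1) in blast, use Gc(1) in blast,
        assumption, assumption, assumption, elim exE conjE, erule (3) that)
  qed
  have gG: "g s \<in> G" and Uop: "openin X (U s)" for s using US by auto
  have Usub: "U s \<subseteq> X closure_of U s" for s
    using closure_of_subset[OF openin_subset[OF Uop]] .
  have mono: "U (s @ t) \<subseteq> U s" for s t
  proof (induction t rule: rev_induct)
    case (snoc b t)
    then show ?case using Ucl[rule_format, of "s @ t" b] Usub[of "s @ t @ [b]"] by auto
  qed simp
  have "\<forall>s. \<exists>x. x \<in> U s \<inter> A" using US by blast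
  then obtain x where x: "\<forall>s. x s \<in> U s \<inter> A" by (elim choice[THEN exE])
  have rA: "range x \<subseteq> A" using x by blast
  then have rX: "range x \<subseteq> topspace X" using AX by blast
  define F where "F = X closure_of (range x)"
  have FA: "F \<subseteq> A" unfolding F_def using rA A by (rule closure_of_minimal)
  have Fcl: "closedin X F" by (simp add: F_def)
  have xF: "x s \<in> F" for s unfolding F_def using closure_of_subset[OF rX] by blast
  have FX: "F \<subseteq> topspace X" using closedin_subset[OF Fcl] .
  have Fcomp: "compactin X F"
  proof (rule \<U>(3)[rule_format], intro conjI allI)
    show "closedin X F" by (rule Fcl)
    fix n
    have "\<forall>s. \<exists>M. M \<in> \<U> n \<and> x s \<in> M" using \<U>(2) rX by blast
    then obtain u where u: "\<forall>s. u s \<in> \<U> n \<and> x s \<in> u s" by (elim choice[THEN exE])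
    \<comment> \<open>Level \<open>Suc n\<close> is the first whose closures lie in members of
      \<open>\<U> n\<close>. It captures all points belonging to longer words, while the shorter
      words contribute finitely many points.\<close>
    have "\<forall>s. \<exists>M. length s = Suc n \<longrightarrow> M \<in> \<U> n \<and> X closure_of U s \<subseteq> M"
    proof
      fix s :: "bool list"
      show "\<exists>M. length s = Suc n \<longrightarrow> M \<in> \<U> n \<and> X closure_of U s \<subseteq> M"
      proof (cases "length s = Suc n")
        case True
        then obtain s' b where "s = s' @ [b]" "length s' = n"
          by (metis append_butlast_last_id diff_Suc_1 length_butlast length_greater_0_conv zero_less_Suc)
        then show ?thesis using Ucl[rule_format, of s' b] by auto
      qed simp
    qed
    then obtain M where M: "\<forall>s. length s = Suc n \<longrightarrow> M s \<in> \<U> n \<and> X closure_of U s \<subseteq> M s"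
      by (elim choice[THEN exE])
    let ?I = "{s :: bool list. length s \<le> n}" and ?J = "{s :: bool list. length s = Suc n}"
    have fin: "finite ?I" "finite ?J"
      using finite_lists_length_le[of "UNIV :: bool set" n] finite_lists_length_eq[of "UNIV :: bool set" "Suc n"] by simp_all
    have "closedin X (\<Union>s\<in>?J. X closure_of U s)"
      using fin(2) by (intro closedin_Union) auto
    moreover have "closedin X (x ` ?I)"
      using fin(1) rX by (intro finite_closed) auto
    ultimately have cl: "closedin X (x ` ?I \<union> (\<Union>s\<in>?J. X closure_of U s))"
      by (intro closedin_Un)
    have "x s \<in> x ` ?I \<union> (\<Union>s\<in>?J. X closure_of U s)" for s
    proof (cases "length s \<le> n")
      case False
      have "U (take (Suc n) s @ drop (Suc n) s) \<subseteq> U (take (Suc n) s)" by (rule mono)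
      then have "x s \<in> U (take (Suc n) s)" using x by auto
      moreover have "take (Suc n) s \<in> ?J" using False by simp
      ultimately show ?thesis using Usub by blast
    qed simp
    then have "F \<subseteq> x ` ?I \<union> (\<Union>s\<in>?J. X closure_of U s)"
      unfolding F_def using cl by (intro closure_of_minimal) auto
    also have "\<dots> \<subseteq> \<Union>(u ` ?I \<union> M ` ?J)"
    proof
      fix y assume "y \<in> x ` ?I \<union> (\<Union>s\<in>?J. X closure_of U s)"
      then consider s where "s \<in> ?I" "y = x s" | s where "s \<in> ?J" "y \<in> X closure_of U s" by blast
      then show "y \<in> \<Union>(u ` ?I \<union> M ` ?J)"
      proof cases
        case 1
        then show ?thesis using u by blast
      next
        case 2
        then have "y \<in> M s" using M by auto
        then show ?thesis using 2 by blast
      qed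
    qed
    finally have "F \<subseteq> \<Union>(u ` ?I \<union> M ` ?J)" .
    moreover have "u ` ?I \<union> M ` ?J \<subseteq> \<U> n" using u M by auto
    ultimately show "\<exists>\<V>. finite \<V> \<and> \<V> \<subseteq> \<U> n \<and> F \<subseteq> \<Union>\<V>"
      using fin by (intro exI[of _ "u ` ?I \<union> M ` ?J"]) auto
  qed
  have sep: "separable_space (subtopology X F)"
    unfolding separable_space_def
  proof (intro exI[of _ "range x"] conjI)
    show "countable (range x)" by simp
    show "range x \<subseteq> topspace (subtopology X F)" using xF FX by auto
    have "range x \<subseteq> F" using xF by blast
    then have "F \<inter> range x = range x" by blast
    then show "subtopology X F closure_of range x = topspace (subtopology X F)"
      using FX by (simp add: closure_of_subtopology F_def[symmetric] Int_absorb1)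
  qed
  have "\<exists>y. \<forall>n. y \<in> F \<inter> U (map u [0..<n])" for u :: "nat \<Rightarrow> bool"
  proof -
    \<comment> \<open>Starting at length \<open>Suc n\<close> lets \<open>step\<close> carry a
      common point of the closures back into the open sets \<open>U\<close>.\<close>
    define C where "C n = X closure_of U (map u [0..<Suc n]) \<inter> F" for n
    have step: "X closure_of U (map u [0..<Suc n]) \<subseteq> U (map u [0..<n])" for n
      using Ucl[rule_format, of "map u [0..<n]" "u n"] by simp
    have "(\<Inter>n. C n) \<noteq> {}"
    proof (rule compact_space_imp_nest)
      show "compact_space (subtopology X F)" using Fcomp by (rule compact_space_subtopology)
      show "closedin (subtopology X F) (C n)" for n
        unfolding C_def closedin_subtopology by (rule exI[of _ "X closure_of U (map u [0..<Suc n])"]) simp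
      have "x (map u [0..<Suc n]) \<in> C n" for n
        unfolding C_def using x xF Usub by blast
      then show "C n \<noteq> {}" for n by blast
      show "decseq C"
      proof (rule decseq_SucI)
        fix n
        show "C (Suc n) \<subseteq> C n"
          unfolding C_def using step[of "Suc n"] Usub[of "map u [0..<Suc n]"] by blast
      qed
    qed
    then obtain y where y: "\<And>n. y \<in> C n" by blast
    have "y \<in> F \<inter> U (map u [0..<n])" for n using y[of n] step[of n] unfolding C_def by blast
    then show ?thesis by blast
  qed
  then obtain \<psi> :: "(nat \<Rightarrow> bool) \<Rightarrow> 'a" where \<psi>: "\<And>u n. \<psi> u \<in> F \<inter> U (map u [0..<n])" by metis
  have \<psi>F: "\<psi> u \<in> F" and \<psi>U: "\<psi> u \<in> U (map u [0..<n]) \<inter> A" for u n using \<psi>[of u n] FA by auto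
  define L where "L = range g"
  have L: "L \<subseteq> G" "countable L" using gG by (auto simp: L_def)
  let ?cl = "pointwise_closure (topspace X) ?Y L"
  define H where "H = restrict_functions ?cl F"
  have compL: "compactin (pointwise_topology (topspace X) ?Y) ?cl"
    using comp L(1) by (rule pointwise_closure_mono_compact)
  have compH: "compactin (pointwise_topology F ?Y) H"
    unfolding H_def restrict_functions_def by (rule image_compactin[OF compL continuous_map_restrict_pointwise[OF FX]])
  have LindH: "Lindelof_space (weak_topology F ?Y H)"
    unfolding H_def by (rule Lind[OF L Fcomp sep])
  have "L \<subseteq> topspace (pointwise_topology (topspace X) ?Y)"
    using L(1) Gc(2) Gs by (auto simp: PiE_iff subset_iff)
  then have Lcl: "L \<subseteq> ?cl" unfolding pointwise_closure_def by (rule closure_of_subset)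
  define gn where "gn k = restrict (g (from_nat k)) F" for k :: nat
  show False
  proof (rule Cantor_map_imp_not_Lindelof[where g = gn and e = "e/2", OF compH _ _ \<psi>F _ _ _ LindH])
    show "gn k \<in> H" for k
      unfolding gn_def H_def restrict_functions_def using Lcl by (auto simp: L_def)
    show "\<exists>k. \<forall>x\<in>E. mdist m (gn k x) (h x) < d" if h: "h \<in> H" and E: "finite E" "E \<subseteq> F" and "d > 0" for h E d
    proof -
      obtain h' where h': "h' \<in> ?cl" "h = restrict h' F" using h by (auto simp: H_def restrict_functions_def)
      obtain l where l: "l \<in> L" "\<forall>x\<in>E. mdist m (l x) (h' x) < d"
        using pointwise_closure_approx[OF h'(1) E(1) _ \<open>d > 0\<close>] E(2) FX by blast
      obtain s where "l = g s" using l(1) by (auto simp: L_def)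
      then have "\<forall>x\<in>E. mdist m (gn (to_nat s) x) (h x) < d"
        using l(2) E(2) h'(2) by (auto simp: gn_def subset_iff)
      then show ?thesis by blast
    qed
    have gn\<psi>: "gn k (\<psi> u) = g (from_nat k) (\<psi> u)" for k u using \<psi>F by (simp add: gn_def)
    show "continuous_map euclidean ?Y (\<lambda>u. gn k (\<psi> u))" for k
      unfolding mtopology_of_def Metric_space.continuous_map_to_metric[OF Metric_space_mspace_mdist]
    proof (intro ballI allI impI)
      fix u :: "nat \<Rightarrow> bool" and \<epsilon> :: real assume "\<epsilon> > 0"
      obtain n0 where n0: "inverse (real (Suc n0)) < \<epsilon>" using reals_Archimedean \<open>\<epsilon> > 0\<close> by blast
      let ?t = "from_nat k :: bool list"
      \<comment> \<open>Sequences that agree in the first \<open>Suc n\<close> coordinates map into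
        a common set of level \<open>Suc n\<close>; since \<open>length ?t \<le> n\<close>, the
        function at \<open>?t\<close> varies there by at most \<open>1/(n+1)\<close>.\<close>
      define n where "n = max n0 (length ?t)"
      have n: "inverse (real (Suc n)) < \<epsilon>" "length ?t \<le> n"
      proof -
        have "inverse (real (Suc n)) \<le> inverse (real (Suc n0))"
          by (rule le_imp_inverse_le) (auto simp: n_def)
        then show "inverse (real (Suc n)) < \<epsilon>" using n0 by linarith
        show "length ?t \<le> n" by (simp add: n_def)
      qed
      have "mdist m (g ?t (\<psi> u)) (g ?t (\<psi> v)) < \<epsilon>" if v: "map v [0..<Suc n] = map u [0..<Suc n]" for v
      proof -
        have "\<psi> u \<in> U (map u [0..<n] @ [u n]) \<inter> A" using \<psi>U[of u "Suc n"] by simp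
        moreover have "\<psi> v \<in> U (map u [0..<n] @ [u n]) \<inter> A" using \<psi>U[of v "Suc n"] unfolding v by simp
        ultimately have "mdist m (g ?t (\<psi> u)) (g ?t (\<psi> v)) \<le> inverse (real (Suc (length (map u [0..<n]))))"
          using Uosc[rule_format, of ?t "map u [0..<n]" "\<psi> u" "u n" "\<psi> v"] n(2) by simp
        then show ?thesis using n(1) by simp
      qed
      moreover have "g ?t (\<psi> w) \<in> mspace m" for w using Gs[OF gG] \<psi>F FX by blast
      ultimately show "\<exists>W. openin euclidean W \<and> u \<in> W \<and> (\<forall>v\<in>W. gn k (\<psi> v) \<in> Metric_space.mball (mspace m) (mdist m) (gn k (\<psi> u)) \<epsilon>)"
        using open_cylinder[of "Suc n" u]
        by (intro exI[of _ "{v. map v [0..<Suc n] = map u [0..<Suc n]}"]) (simp add: gn\<psi> Metric_space.in_mball del: upt_Suc)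
    qed
    show "e/2 > 0" using \<open>e > 0\<close> by simp
    have sepn: "\<exists>k. mdist m (gn k (\<psi> u)) (gn k (\<psi> v)) \<ge> e/2"
      if eq: "map u [0..<n] = map v [0..<n]" and un: "\<not> u n" "v n" for u v :: "nat \<Rightarrow> bool" and n
    proof -
      let ?s = "map u [0..<n]"
      have "\<psi> u \<in> U (?s @ [False]) \<inter> A" using \<psi>U[of u "Suc n"] un by simp
      moreover have "map v [0..<Suc n] = ?s @ [True]" using un(2) by (simp add: eq)
      then have "\<psi> v \<in> U (?s @ [True]) \<inter> A" using \<psi>U[of v "Suc n"] by (simp only:)
      ultimately have "mdist m (g ?s (\<psi> u)) (g ?s (\<psi> v)) \<ge> e/2"
        using Usep by blast
      then show ?thesis by (intro exI[of _ "to_nat ?s"]) (simp add: gn\<psi>)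
    qed
    show "\<exists>k. mdist m (gn k (\<psi> u)) (gn k (\<psi> v)) \<ge> e/2" if uv: "u \<noteq> v" for u v
    proof -
      have ex: "\<exists>n. u n \<noteq> v n" using uv by (auto simp: fun_eq_iff)
      \<comment> \<open>At the first difference the two branches pass to the two children of a
        common word, and the function attached to that word separates them.\<close>
      define n where "n = (LEAST n. u n \<noteq> v n)"
      have n: "u n \<noteq> v n" unfolding n_def using ex by (rule LeastI_ex)
      have "u i = v i" if "i < n" for i using not_less_Least[of i "\<lambda>n. u n \<noteq> v n"] that by (simp add: n_def)
      then have eq: "map u [0..<n] = map v [0..<n]" by simp
      show ?thesis
      proof (cases "u n")
        case True
        then show ?thesis using sepn[OF eq[symmetric]] n by (auto simp: mdist_commute)
      next
        case False
        then show ?thesis using sepn[OF eq] n by simp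
      qed
    qed
  qed
qed

section \<open>The cycle of implications\<close>

theorem theoremB:
  fixes X :: "'a topology" and m :: "'b metric" and G :: "('a \<Rightarrow> 'b) set"
  assumes "Cech_complete_space X"
    and "G \<subseteq> continuous_functions X (mtopology_of m)"
    and "compactin (pointwise_topology (topspace X) (mtopology_of m))
           (pointwise_closure (topspace X) (mtopology_of m) G)"
  shows
    "(hereditarily_almost_equicontinuous X m G \<longleftrightarrow>
        (\<forall>L F. L \<subseteq> G \<and> countable L \<and> compactin X F \<and> separable_space (subtopology X F) \<longrightarrow>
           hereditarily_almost_equicontinuous (subtopology X F) m (restrict_functions L F))) \<and>
     (hereditarily_almost_equicontinuous X m G \<longleftrightarrow>
        (\<forall>L F. L \<subseteq> G \<and> countable L \<and> compactin X F \<and> separable_space (subtopology X F) \<longrightarrow>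
           metrizable_space (subtopology (pointwise_topology F (mtopology_of m))
                               (restrict_functions (pointwise_closure (topspace X) (mtopology_of m) L) F)))) \<and>
     (hereditarily_almost_equicontinuous X m G \<longleftrightarrow>
        (\<forall>L F. L \<subseteq> G \<and> countable L \<and> compactin X F \<and> separable_space (subtopology X F) \<longrightarrow>
           Lindelof_space (weak_topology F (mtopology_of m)
                               (restrict_functions (pointwise_closure (topspace X) (mtopology_of m) L) F))))"
proof -
  let ?Y = "mtopology_of m" and ?cl = "pointwise_closure (topspace X) (mtopology_of m)"
  have haus: "Hausdorff_space X" using assms(1) by (simp add: Cech_complete_space_def)
  have Gc: "continuous_map X ?Y g" if "g \<in> G" for g
    using subsetD[OF assms(2) that] by (simp add: continuous_functions_def)
  have Gs: "g x \<in> mspace m" if "g \<in> G" "x \<in> topspace X" for g x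
    using continuous_map_funspace[OF Gc[OF that(1)]] that(2) by auto
  have ab: "hereditarily_almost_equicontinuous (subtopology X F) m (restrict_functions L F)"
    if "hereditarily_almost_equicontinuous X m G" "L \<subseteq> G" "compactin X F" for L F
    using hereditarily_almost_equicontinuous_restrict[OF that(1) compactin_imp_closedin[OF haus that(3)] that(2)] .
  \<comment> \<open>Both this step and the next one pass through countable covers for
    \<open>L\<close> on \<open>F\<close>, which are then extended to the pointwise closure.\<close>
  have bc: "metrizable_space (subtopology (pointwise_topology F ?Y) (restrict_functions (?cl L) F))"
    if hae: "hereditarily_almost_equicontinuous (subtopology X F) m (restrict_functions L F)"
      and L: "L \<subseteq> G" "countable L" and F: "compactin X F" for L F
  proof -
    have FX: "F \<subseteq> topspace X" using compactin_subset_topspace[OF F] .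
    have "countably_small m (restrict_functions L F) (topspace (subtopology X F))"
    proof (rule hereditarily_almost_equicontinuous_imp_countably_small[OF _ _ _ hae])
      show "compact_space (subtopology X F)" using F by (rule compact_space_subtopology)
      show "countable (restrict_functions L F)" using L(2) by (simp add: restrict_functions_def)
      fix l assume "l \<in> restrict_functions L F"
      then obtain l' where l': "l' \<in> L" "l = restrict l' F" by (auto simp: restrict_functions_def)
      have "continuous_map (subtopology X F) ?Y l'"
        using Gc L(1) l'(1) by (intro continuous_map_from_subtopology) auto
      then show "continuous_map (subtopology X F) ?Y l"
        by (rule continuous_map_eq) (simp add: l'(2))
    qed
    moreover have "topspace (subtopology X F) = F" using FX by auto
    ultimately have "countably_small m (restrict_functions L F) F" by (simp only:)
    then have "countably_small m L F" by (simp only: countably_small_restrict_functions)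
    then have "countably_small m (?cl L) F"
      using FX by (rule countably_small_closure) (use Gs L(1) in blast)
    then show ?thesis
      using FX pointwise_closure_mono_compact[OF assms(3) L(1)] by (rule countably_small_imp_metrizable)
  qed
  have cd: "Lindelof_space (weak_topology F ?Y (restrict_functions (?cl L) F))"
    if met: "metrizable_space (subtopology (pointwise_topology F ?Y) (restrict_functions (?cl L) F))"
      and L: "L \<subseteq> G" and F: "compactin X F" for L F
  proof -
    have FX: "F \<subseteq> topspace X" using compactin_subset_topspace[OF F] .
    have compL: "compactin (pointwise_topology (topspace X) ?Y) (?cl L)"
      using assms(3) L by (rule pointwise_closure_mono_compact)
    have "countably_small m L F"
      by (rule metrizable_imp_countably_small[OF F _ compL met]) (use L assms(2) in blast)
    then have "countably_small m (?cl L) F"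
      using FX by (rule countably_small_closure) (use Gs L in blast)
    then have "countably_small m (restrict_functions (?cl L) F) F"
      by (simp only: countably_small_restrict_functions)
    then show ?thesis
    proof (rule countably_small_imp_Lindelof)
      fix h x assume h: "h \<in> restrict_functions (?cl L) F" and x: "x \<in> F"
      obtain h' where h': "h' \<in> ?cl L" "h = restrict h' F" using h by (auto simp: restrict_functions_def)
      have "h' \<in> topspace X \<rightarrow>\<^sub>E mspace m" using compactin_subset_topspace[OF compL] h'(1) by auto
      then show "h x \<in> mspace m" using x FX h'(2) by auto
    qed
  qed
  have da: "hereditarily_almost_equicontinuous X m G"
    if "\<And>L F. L \<subseteq> G \<Longrightarrow> countable L \<Longrightarrow> compactin X F \<Longrightarrow> separable_space (subtopology X F) \<Longrightarrow>
        Lindelof_space (weak_topology F ?Y (restrict_functions (?cl L) F))"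
    using assms that by (rule Lindelof_imp_hereditarily_almost_equicontinuous)
  have equiv: "(a \<longleftrightarrow> b) \<and> (a \<longleftrightarrow> c) \<and> (a \<longleftrightarrow> d)" if "a \<Longrightarrow> b" "b \<Longrightarrow> c" "c \<Longrightarrow> d" "d \<Longrightarrow> a" for a b c d
    using that by blast
  show ?thesis
  proof (rule equiv, goal_cases)
    case 1
    then show ?case using ab by simp
  next
    case 2
    then show ?case using bc by simp
  next
    case 3
    then show ?case using cd by simp
  next
    case 4
    then show ?case using da by simp
  qed
qed

end
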